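(* Let $\boldsymbol f$ be a global (defined for all $t\ge0$) solution of the flow $$\partial_t\boldsymbol f=\boldsymbol\kappa-\frac{L}{2A}\boldsymbol\nu$$ of closed plane curves, such that the initial rotation number is $1$ and the initial signed area is positive. Put $f=f_1+if_2$ and, for each fixed $t$, let $f(s,t)=\sum_{k\in\mathbb Z}\hat f(k)(t)\varphi_k(s)$ be its Fourier expansion. Set $$\boldsymbol c(t)=\frac1{\sqrt{L(t)}}\bigl(\Re\hat f(0)(t),\Im\hat f(0)(t)\bigr),$$ and define $r(t)\ge0$ and $\sigma(t)\in\mathbb R/L(t)\mathbb Z$ by $$\hat f(1)(t)=\sqrt{L(t)}\,r(t)\exp\left(i\frac{2\pi\sigma(t)}{L(t)}\right).$$ Furthermore set $\tilde{\boldsymbol f}(\theta,t)=\boldsymbol f(L(t)\theta-\sigma(t),t)$ for $(\theta,t)\in\mathbb R/\mathbb Z\times[0,\infty)$. Let $L_\infty=\lim_{t\to\infty}L(t)$ and $r_\infty=\frac{L_\infty}{2\pi}$. Then the following claims hold, where $C,\gamma>0$ (possibly different in each claim) are independent of $t$. (1) There exists $\boldsymbol c_\infty\in\mathbb R^2$ such that $\|\boldsymbol c(t)-\boldsymbol c_\infty\|\le Ce^{-\gamma t}$. (2) The function $r(t)$ converges to the constant $\frac{L_\infty}{2\pi}$ exponentially as $t\to\infty$: $\left|r(t)-\frac{L_\infty}{2\pi}\right|\le Ce^{-\gamma t}$. (3) There exists $\sigma_\infty\in\mathbb R$ such that $|\sigma(t)-\sigma_\infty|\le Ce^{-\gamma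 t}$, where $|\cdot|$ denotes the distance in $\mathbb R/L(t)\mathbb Z$ between $\sigma(t)$ and the class of $\sigma_\infty$. (4) For any $k\in\{0\}\cup\mathbb N$ there exist $C_k>0$ and $\gamma_k>0$ such that $$\|\tilde{\boldsymbol f}(\cdot,t)-\tilde{\boldsymbol f}_\infty\|_{C^k(\mathbb R/\mathbb Z)}\le C_ke^{-\gamma_kt},\qquad\text{where}\quad \tilde{\boldsymbol f}_\infty(\theta)=\boldsymbol c_\infty+\frac{L_\infty}{2\pi}(\cos2\pi\theta,\sin2\pi\theta).$$ (5) For sufficiently large $t$, $\mathrm{Im}\,\tilde{\boldsymbol f}(\cdot,t)$ is the boundary of a bounded domain $\Omega(t)$. Furthermore, there exists $T_\ast\ge0$ such that $\Omega(t)$ is strictly convex for $t\ge T_\ast$. (6) Let $D_{r_\infty}(\boldsymbol c_\infty)$ be the closed disk with center $\boldsymbol c_\infty$ and radius $r_\infty$. Then, for sufficiently large $t$, $d_H(\overline{\Omega(t)},D_{r_\infty}(\boldsymbol c_\infty))\le Ce^{-\gamma t}$, where $d_H$ is the Hausdorff distance. (7) Let $\boldsymbol b(t)=\frac1{A(t)}\iint_{\Omega(t)}\boldsymbol x\,d\boldsymbol x$ be the barycenter of $\Omega(t)$. Then, for sufficiently large $t$, $\|A(t)(\boldsymbol b(t)-\boldsymbol c(t))\|\le Ce^{-\gamma t}$.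
   Context: For a closed plane curve of length $L$ with arc-length parametrization $\boldsymbol f=(f_1,f_2):\mathbb R/L\mathbb Z\to\mathbb R^2$, let $\boldsymbol\nu=(-\partial_sf_2,\partial_sf_1)$ be the unit normal, $\boldsymbol\kappa=\partial_s^2\boldsymbol f$ the curvature vector, $\kappa=\boldsymbol\kappa\cdot\boldsymbol\nu$ the curvature, and $A=-\frac12\int_0^L\boldsymbol f\cdot\boldsymbol\nu\,ds$ the signed area. Rotation number $1$ means $\int_0^L\kappa\,ds=2\pi$. Curves need not be simple or convex. A global solution of the flow is a smooth family of immersed closed curves $F:\mathbb R/\mathbb Z\times[0,\infty)\to\mathbb R^2$ such that, at each fixed parameter $p\in\mathbb R/\mathbb Z$, $\partial_tF(p,t)=\boldsymbol\kappa-\frac{L(t)}{2A(t)}\boldsymbol\nu$ evaluated at the point $F(p,t)$ of the curve $F(\cdot,t)$. Here $\boldsymbol f(\cdot,t):\mathbb R/L(t)\mathbb Z\to\mathbb R^2$ is the arc-length parametrization of $F(\cdot,t)$ with base point $\boldsymbol f(0,t)=F(0,t)$ and the orientation of $F$, and $L(t),A(t)$ are the length and signed area at time $t$. For such solutions with initial rotation number $1$ and positive initial signed area, $L(t)$ converges to a positive limit $L_\infty$ as $t\to\infty$. Fourier notation: $\varphi_k(s)=\frac1{\sqrt L}\exp\left(\frac{2\pi iks}{L}\right)$ and $\hat f(k)=\int_0^Lf\,\overline{\varphi_k}\,ds$, with $L=L(t)$. If $r(t)=0$, $\sigma(t)$ is arbitrary. *)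

theory Defs
  imports "HOL-Analysis.Analysis"
begin

text \<open>
  The plane \<open>\<real>\<^sup>2\<close> is modelled by \<^typ>\<open>complex\<close>, so that \<open>f = f\<^sub>1 + i f\<^sub>2\<close> is the curve itself;
  \<open>\<bullet>\<close> and \<^const>\<open>norm\<close> are the Euclidean inner product and norm. Functions on \<open>\<real>/\<ell>\<int>\<close> are
  \<open>\<ell>\<close>-periodic functions on \<open>\<real>\<close>.
\<close>

subsection \<open>Closed plane curves\<close>

definition curve_length :: "(real \<Rightarrow> complex) \<Rightarrow> real" where
  "curve_length g = integral {0..1} (\<lambda>x. norm (vector_derivative g (at x)))"

text \<open>Arc length from the base point \<open>g 0\<close>; negative for negative \<open>p\<close>.\<close>

definition arc_length :: "(real \<Rightarrow> complex) \<Rightarrow> real \<Rightarrow> real" where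
  "arc_length g p = (LBINT x=ereal 0..ereal p. norm (vector_derivative g (at x)))"

text \<open>
  For an immersed 1-periodic \<open>g\<close>, \<^term>\<open>arc_length g\<close> is an increasing bijection of \<open>\<real>\<close>, so this is
  the arc-length parametrization with base point \<open>g 0\<close> and the orientation of \<open>g\<close>. It has period
  \<^term>\<open>curve_length g\<close>.
\<close>

definition arc_length_param :: "(real \<Rightarrow> complex) \<Rightarrow> real \<Rightarrow> complex" where
  "arc_length_param g s = g (inv (arc_length g) s)"

text \<open>In the following, \<open>f\<close> is parametrized by arc length and has period \<open>L\<close>.\<close>

definition unit_normal :: "(real \<Rightarrow> complex) \<Rightarrow> real \<Rightarrow> complex" where
  "unit_normal f s =
     Complex (- Im (vector_derivative f (at s))) (Re (vector_derivative f (at s)))"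

definition curvature_vector :: "(real \<Rightarrow> complex) \<Rightarrow> real \<Rightarrow> complex" where
  "curvature_vector f s = vector_derivative (\<lambda>x. vector_derivative f (at x)) (at s)"

definition curvature :: "(real \<Rightarrow> complex) \<Rightarrow> real \<Rightarrow> real" where
  "curvature f s = curvature_vector f s \<bullet> unit_normal f s"

definition signed_area :: "real \<Rightarrow> (real \<Rightarrow> complex) \<Rightarrow> real" where
  "signed_area L f = - (1/2) * integral {0..L} (\<lambda>s. f s \<bullet> unit_normal f s)"

definition rotation_number :: "real \<Rightarrow> (real \<Rightarrow> complex) \<Rightarrow> real" where
  "rotation_number L f = integral {0..L} (curvature f) / (2 * pi)"

subsection \<open>The flow\<close>

text \<open>
  \<open>F p t\<close> is the position at time \<open>t\<close> of the point with parameter \<open>p\<close>; values at negative times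
  are irrelevant.
\<close>

definition flow_length :: "(real \<Rightarrow> real \<Rightarrow> complex) \<Rightarrow> real \<Rightarrow> real" where
  "flow_length F t = curve_length (\<lambda>p. F p t)"

definition flow_curve :: "(real \<Rightarrow> real \<Rightarrow> complex) \<Rightarrow> real \<Rightarrow> real \<Rightarrow> complex" where
  "flow_curve F t = arc_length_param (\<lambda>p. F p t)"

definition flow_area :: "(real \<Rightarrow> real \<Rightarrow> complex) \<Rightarrow> real \<Rightarrow> real" where
  "flow_area F t = signed_area (flow_length F t) (flow_curve F t)"

text \<open>
  \<open>C\<^sup>\<infinity>\<close> on \<open>\<real> \<times> [0,\<infinity>)\<close>: \<open>D j k\<close> is the partial derivative of order \<open>j\<close> in space and \<open>k\<close> in time,
  one-sided in time at \<open>t = 0\<close>.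
\<close>

definition smooth_family :: "(real \<Rightarrow> real \<Rightarrow> complex) \<Rightarrow> bool" where
  "smooth_family F \<longleftrightarrow>
     (\<exists>D :: nat \<Rightarrow> nat \<Rightarrow> real \<Rightarrow> real \<Rightarrow> complex.
        D 0 0 = F \<and>
        (\<forall>j k. continuous_on (UNIV \<times> {0..}) (\<lambda>(p, t). D j k p t)) \<and>
        (\<forall>j k p. \<forall>t\<ge>0.
           ((\<lambda>x. D j k x t) has_vector_derivative D (Suc j) k p t) (at p) \<and>
           ((\<lambda>u. D j k p u) has_vector_derivative D j (Suc k) p t) (at t within {0..})))"

text \<open>
  The point \<open>F p t\<close> is \<open>f(s,t)\<close> with \<open>s = arc_length (\<lambda>x. F x t) p\<close>. That the area is nonzero is not
  required: along the flow it is nondecreasing as long as it is positive (isoperimetric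
  inequality), hence it never vanishes if the rotation number is 1 and the initial area is
  positive.
\<close>

definition global_solution :: "(real \<Rightarrow> real \<Rightarrow> complex) \<Rightarrow> bool" where
  "global_solution F \<longleftrightarrow>
     smooth_family F \<and>
     (\<forall>p. \<forall>t\<ge>0. F (p + 1) t = F p t) \<and>
     (\<forall>p. \<forall>t\<ge>0. vector_derivative (\<lambda>x. F x t) (at p) \<noteq> 0) \<and>
     (\<forall>p. \<forall>t\<ge>0.
        ((\<lambda>u. F p u) has_vector_derivative
           (let s = arc_length (\<lambda>x. F x t) p
            in curvature_vector (flow_curve F t) s -
               (flow_length F t / (2 * flow_area F t)) *\<^sub>R unit_normal (flow_curve F t) s))
        (at t within {0..}))"

definition limit_length :: "(real \<Rightarrow> real \<Rightarrow> complex) \<Rightarrow> real" where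
  "limit_length F = Lim at_top (flow_length F)"

subsection \<open>Fourier coefficients\<close>

definition fourier_basis :: "real \<Rightarrow> int \<Rightarrow> real \<Rightarrow> complex" where
  "fourier_basis L k s =
     complex_of_real (1 / sqrt L) * exp (\<i> * complex_of_real (2 * pi * of_int k * s / L))"

definition fourier_coeff :: "real \<Rightarrow> (real \<Rightarrow> complex) \<Rightarrow> int \<Rightarrow> complex" where
  "fourier_coeff L f k = integral {0..L} (\<lambda>s. f s * cnj (fourier_basis L k s))"

definition flow_coeff :: "(real \<Rightarrow> real \<Rightarrow> complex) \<Rightarrow> int \<Rightarrow> real \<Rightarrow> complex" where
  "flow_coeff F k t = fourier_coeff (flow_length F t) (flow_curve F t) k"

definition flow_center :: "(real \<Rightarrow> real \<Rightarrow> complex) \<Rightarrow> real \<Rightarrow> complex" where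
  "flow_center F t =
     (1 / sqrt (flow_length F t)) *\<^sub>R Complex (Re (flow_coeff F 0 t)) (Im (flow_coeff F 0 t))"

definition normalized_curve ::
    "(real \<Rightarrow> real \<Rightarrow> complex) \<Rightarrow> (real \<Rightarrow> real) \<Rightarrow> real \<Rightarrow> real \<Rightarrow> complex" where
  "normalized_curve F \<sigma> t \<theta> = flow_curve F t (flow_length F t * \<theta> - \<sigma> t)"

subsection \<open>Distances, norms and domains\<close>

text \<open>Distance in \<open>\<real>/\<ell>\<int>\<close> between the classes of \<open>x\<close> and \<open>y\<close>.\<close>

definition quotient_dist :: "real \<Rightarrow> real \<Rightarrow> real \<Rightarrow> real" where
  "quotient_dist l x y = (INF n::int. \<bar>x - y - of_int n * l\<bar>)"

definition iterated_derivative :: "nat \<Rightarrow> (real \<Rightarrow> complex) \<Rightarrow> real \<Rightarrow> complex" where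
  "iterated_derivative j g = ((\<lambda>h x. vector_derivative h (at x)) ^^ j) g"

definition Ck_norm :: "nat \<Rightarrow> (real \<Rightarrow> complex) \<Rightarrow> real" where
  "Ck_norm k g = (\<Sum>j\<le>k. SUP x. norm (iterated_derivative j g x))"

definition hausdorff_dist :: "complex set \<Rightarrow> complex set \<Rightarrow> real" where
  "hausdorff_dist A B = max (SUP a\<in>A. infdist a B) (SUP b\<in>B. infdist b A)"

definition bounded_domain :: "complex set \<Rightarrow> bool" where
  "bounded_domain S \<longleftrightarrow> open S \<and> connected S \<and> S \<noteq> {} \<and> bounded S"

definition strictly_convex :: "complex set \<Rightarrow> bool" where
  "strictly_convex S \<longleftrightarrow>
     (\<forall>x\<in>closure S. \<forall>y\<in>closure S. x \<noteq> y \<longrightarrow> open_segment x y \<subseteq> interior S)"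

end

theory Submission
  imports Defs
begin

text \<open>
  The length \<open>L\<close> and the area \<open>A\<close> enter through the isoperimetric deficit \<open>D = L\<^sup>2 - 4 \<pi> A\<close> and the mean
  square deviation \<open>E0 = \<integral> (\<kappa> - 2 \<pi> / L)\<^sup>2 ds\<close> of the curvature from its mean. Along the flow
  \<open>D' = - 2 L E0\<close>, since the terms that contain \<open>L / (2 A)\<close> cancel. The isoperimetric inequality \<open>D \<ge> 0\<close>
  (proved following Lax, lemma \<open>isoperimetric_inequality\<close>) therefore makes the area increase, so that it
  stays positive, and \<open>E0\<close> integrable in time. The reverse inequality \<open>D \<le> L\<^sup>3 E0\<close>
  (\<open>isoperimetric_deficit_le\<close>) says that the deficit is quadratically small near a circle; it bounds area
  and length from above (\<open>A_bounded\<close>).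

  The derivative of \<open>E0\<close> is the diffusion term \<open>- 2 \<integral> \<kappa>\<^sub>s\<^sup>2 ds\<close> plus a reaction term that is quadratically
  small in \<open>\<kappa> - 2 \<pi> / L\<close> and \<open>D\<close>. Hence \<open>E0 + N D\<close> is a Lyapunov function once it is small, and it becomes
  small because \<open>E0\<close> is integrable: \<open>E0\<close> and \<open>D\<close> decay exponentially (\<open>E0_D_exp_decay\<close>). Next \<open>\<integral> \<kappa>\<^sub>s\<^sup>2 ds\<close> is
  bounded by interpolation, so the curvature is bounded; Bernstein's maximum principle argument bounds
  all its derivatives by arc length (\<open>K_bounded\<close>), and interpolation between decay and boundedness makes
  all of them decay (\<open>E_exp_decay\<close>).

  Everything that moves at a rate controlled by the normal speed or by \<open>\<kappa>\<^sub>s\<close> now converges exponentially: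
  length, area, centre of mass, and the tangent \<open>T 0\<close> at the base point. Fourier analysis is reduced to
  one identity. With \<open>\<omega> = 2 \<pi> / L\<close>, the vector \<open>f - T / (i\<omega>)\<close> is the centre and \<open>T e\<^sup>-\<^sup>i\<^sup>\<omega>\<^sup>s\<close> the phase of the
  circle of curvature \<open>\<omega>\<close> that touches the curve at \<open>s\<close>; both are nearly constant, as their
  derivatives are proportional to \<open>\<kappa> - \<omega>\<close>. The first of them has no first Fourier mode, so the first
  coefficient is nearly \<open>T 0 / (i\<omega>)\<close> (\<open>first_coefficient_close\<close>). This yields the limits of \<open>r\<close> and \<open>\<sigma>\<close>, and the
  same two quantities describe the whole curve, which gives uniform convergence to the circle
  (\<open>gap_0_le\<close>). Since all derivatives are bounded, Landau's interpolation inequality upgrades this to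
  convergence in every \<open>C\<^sup>k\<close> (\<open>gap_exp_decay\<close>).

  A curve that is \<open>C\<^sup>2\<close>-close to a circle lies strictly on one side of each of its tangents
  (\<open>support_local\<close>). It follows that it is the full boundary of its convex hull and that the hull is
  strictly convex; the hull contains the disk of radius \<open>R - \<epsilon>\<close> and lies in that of radius \<open>R + \<epsilon>\<close>, which
  gives the estimates of the Hausdorff distance and, since the first moment of a disk about its centre
  vanishes, of the barycentre (\<open>first_moment_close\<close>).
\<close>

section \<open>Calculus on the line\<close>

lemma norm_diff_le_of_derivative_bound:
  fixes g :: "real \<Rightarrow> 'a::real_normed_vector"
  assumes d: "\<And>x. (g has_vector_derivative g' x) (at x)"
    and b: "\<And>x. x \<in> closed_segment a b \<Longrightarrow> norm (g' x) \<le> B"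
  shows "norm (g b - g a) \<le> B * \<bar>b - a\<bar>"
proof -
  have "norm (g b - g a) \<le> B * norm (b - a)"
  proof (rule differentiable_bound[of "closed_segment a b" g "\<lambda>x h. h *\<^sub>R g' x"])
    show "\<And>x. x \<in> closed_segment a b \<Longrightarrow> (g has_derivative (\<lambda>h. h *\<^sub>R g' x)) (at x within closed_segment a b)"
      using d by (simp add: has_vector_derivative_def has_derivative_at_withinI)
    show "\<And>x. x \<in> closed_segment a b \<Longrightarrow> onorm (\<lambda>h. h *\<^sub>R g' x) \<le> B"
      using b by (intro onorm_le) (simp add: mult.commute[of B] mult_left_mono)
  qed auto
  then show ?thesis by simp
qed

lemma second_order_remainder:
  fixes g :: "real \<Rightarrow> 'a::real_normed_vector"
  assumes d1: "\<And>x. (g has_vector_derivative g' x) (at x)"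
    and d2: "\<And>x. (g' has_vector_derivative g'' x) (at x)"
    and b: "\<And>x. norm (g'' x) \<le> M"
  shows "norm (g y - g x - (y - x) *\<^sub>R g' x) \<le> M * (y - x)\<^sup>2"
proof -
  have M: "0 \<le> M" using b[of 0] norm_ge_zero order_trans by blast
  have "norm ((g y - y *\<^sub>R g' x) - (g x - x *\<^sub>R g' x)) \<le> (M * \<bar>y - x\<bar>) * \<bar>y - x\<bar>"
  proof (rule norm_diff_le_of_derivative_bound)
    show "((\<lambda>z. g z - z *\<^sub>R g' x) has_vector_derivative (g' z - g' x)) (at z)" for z
      by (auto intro!: derivative_eq_intros d1)
    show "norm (g' z - g' x) \<le> M * \<bar>y - x\<bar>" if z: "z \<in> closed_segment x y" for z
    proof -
      have "norm (g' z - g' x) \<le> M * \<bar>z - x\<bar>"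
        by (rule norm_diff_le_of_derivative_bound[OF d2 b])
      also have "\<dots> \<le> M * \<bar>y - x\<bar>"
        using z M by (intro mult_left_mono) (auto simp: closed_segment_eq_real_ivl split: if_splits)
      finally show ?thesis .
    qed
  qed
  then show ?thesis by (simp add: power2_eq_square algebra_simps abs_mult_self)
qed

text \<open>
  Landau's interpolation between a function and its second derivative: over a step of length \<open>h\<close> the
  function changes by at most \<open>2 h\<^sup>2\<close>, and the Taylor remainder is at most \<open>M h\<^sup>2\<close>. Hence a bound \<open>h\<^sup>2\<close> on
  the function gives its square root as a bound on the derivative.
\<close>

lemma landau_derivative_bound:
  fixes g :: "real \<Rightarrow> 'a::real_normed_vector"
  assumes d1: "\<And>x. (g has_vector_derivative g' x) (at x)"
    and d2: "\<And>x. (g' has_vector_derivative g'' x) (at x)"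
    and b: "\<And>x. norm (g'' x) \<le> M" and s: "\<And>x. norm (g x) \<le> h\<^sup>2" and h: "h > 0"
  shows "norm (g' x) \<le> (2 + M) * h"
proof -
  have "h * norm (g' x) = norm (h *\<^sub>R g' x)" using h by simp
  also have "\<dots> = norm (g (x + h) - g x - (g (x + h) - g x - ((x + h) - x) *\<^sub>R g' x))"
    by simp
  also have "\<dots> \<le> norm (g (x + h)) + norm (g x) + norm (g (x + h) - g x - ((x + h) - x) *\<^sub>R g' x)"
    using norm_triangle_ineq4[of "g (x + h)" "g x"]
      norm_triangle_ineq4[of "g (x + h) - g x" "g (x + h) - g x - ((x + h) - x) *\<^sub>R g' x"]
    by linarith
  also have "\<dots> \<le> h\<^sup>2 + h\<^sup>2 + M * ((x + h) - x)\<^sup>2"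
    by (intro add_mono s second_order_remainder[OF d1 d2 b])
  also have "\<dots> = h * ((2 + M) * h)" by (simp add: power2_eq_square algebra_simps)
  finally show ?thesis using h by simp
qed

text \<open>Increments of \<open>g\<close> are dominated by those of a primitive of the bound, hence \<open>g\<close> is Cauchy at infinity.\<close>

lemma exponential_limit:
  fixes g :: "real \<Rightarrow> 'a::banach"
  assumes d: "\<And>t. t \<ge> 0 \<Longrightarrow> (g has_vector_derivative g' t) (at t within {0..})"
    and b: "\<And>t. t \<ge> 0 \<Longrightarrow> norm (g' t) \<le> C * exp (- \<gamma> * t)" and C: "C \<ge> 0" and \<gamma>: "\<gamma> > 0"
  shows "\<exists>l. (g \<longlongrightarrow> l) at_top \<and> (\<forall>t\<ge>0. norm (g t - l) \<le> C / \<gamma> * exp (- \<gamma> * t))"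
proof -
  have key: "norm (g y - g x) \<le> C / \<gamma> * exp (- \<gamma> * x) - C / \<gamma> * exp (- \<gamma> * y)"
    if "0 \<le> x" "x \<le> y" for x y
  proof (cases "x = y")
    case False
    then have xy: "x < y" using that by simp
    have "norm (g y - g x) \<le> (- C / \<gamma> * exp (- \<gamma> * y)) - (- C / \<gamma> * exp (- \<gamma> * x))"
    proof (rule differentiable_bound_general[OF xy, where f'=g' and \<phi>'="\<lambda>t. C * exp (- \<gamma> * t)"])
      show "continuous_on {x..y} g"
        using that by (intro continuous_on_vector_derivative[where f'=g'])
           (auto intro: has_vector_derivative_within_subset[OF d])
      show "(g has_vector_derivative g' t) (at t)" if "x < t" "t < y" for t
        using d[of t] that \<open>0 \<le> x\<close> at_within_interior[of t "{0..}"]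
        by (simp add: interior_Ici[of "-1"])
      show "((\<lambda>t. - C / \<gamma> * exp (- \<gamma> * t)) has_vector_derivative C * exp (- \<gamma> * t)) (at t)" for t
        using \<gamma> unfolding has_real_derivative_iff_has_vector_derivative[symmetric]
        by (auto intro!: derivative_eq_intros)
    qed (use b that \<gamma> in \<open>auto intro!: continuous_intros\<close>)
    then show ?thesis by simp
  qed simp
  have tz: "((\<lambda>t. C / \<gamma> * exp (- \<gamma> * t)) \<longlongrightarrow> 0) at_top"
  proof -
    have "((\<lambda>t. exp (- (\<gamma> * t))) \<longlongrightarrow> 0) at_top"
      using \<gamma> by (intro filterlim_compose[OF exp_at_bot] filterlim_compose[OF filterlim_uminus_at_bot_at_top]
          filterlim_tendsto_pos_mult_at_top[OF tendsto_const]) (auto simp: filterlim_ident)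
    from tendsto_mult_left[OF this, of "C / \<gamma>"] show ?thesis by simp
  qed
  have cauchy: "norm (g y - g x) \<le> C / \<gamma> * exp (- \<gamma> * min x y)" if "0 \<le> x" "0 \<le> y" for x y
  proof -
    have p: "0 \<le> C / \<gamma> * exp (- \<gamma> * z)" for z using C \<gamma> by simp
    show ?thesis
    proof (cases "x \<le> y")
      case True then show ?thesis using key[of x y] that p[of y] by (simp add: min_def)
    next
      case False then show ?thesis using key[of y x] that p[of x] by (simp add: min_def norm_minus_commute)
    qed
  qed
  have "\<exists>l. (\<lambda>n. g (real n)) \<longlonglongrightarrow> l"
  proof -
    have "Cauchy (\<lambda>n. g (real n))"
    proof (rule CauchyI)
      fix e :: real assume "e > 0"
      then have "eventually (\<lambda>t. C / \<gamma> * exp (- \<gamma> * t) < e) at_top"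
        using order_tendstoD(2)[OF tz] by simp
      then obtain M where M: "\<And>t. t \<ge> M \<Longrightarrow> C / \<gamma> * exp (- \<gamma> * t) < e"
        by (auto simp: eventually_at_top_linorder)
      obtain N where N: "M \<le> real N" using real_arch_simple by blast
      show "\<exists>M. \<forall>m\<ge>M. \<forall>n\<ge>M. norm (g (real m) - g (real n)) < e"
      proof (intro exI allI impI)
        fix m n assume "N \<le> m" "N \<le> n"
        then have "M \<le> min (real n) (real m)" using N by auto
        then show "norm (g (real m) - g (real n)) < e" using cauchy[of "real n" "real m"] M by fastforce
      qed
    qed
    then show ?thesis by (simp add: Cauchy_convergent_iff convergent_def)
  qed
  then obtain l where l: "(\<lambda>n. g (real n)) \<longlonglongrightarrow> l" by auto
  have bound: "norm (g t - l) \<le> C / \<gamma> * exp (- \<gamma> * t)" if t: "t \<ge> 0" for t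
  proof (rule LIMSEQ_le_const2)
    show "(\<lambda>n. norm (g t - g (real n))) \<longlonglongrightarrow> norm (g t - l)" by (intro tendsto_intros l)
    obtain N where N: "t \<le> real N" using real_arch_simple by blast
    show "\<exists>N. \<forall>n\<ge>N. norm (g t - g (real n)) \<le> C / \<gamma> * exp (- \<gamma> * t)"
    proof (intro exI allI impI)
      fix n assume "N \<le> n" then have "t \<le> real n" using N by auto
      then show "norm (g t - g (real n)) \<le> C / \<gamma> * exp (- \<gamma> * t)" using cauchy[of "real n" t] t
        by (simp add: min_def split: if_splits)
    qed
  qed
  have "((\<lambda>t. g t - l) \<longlongrightarrow> 0) at_top"
    by (rule Lim_null_comparison[OF _ tz]) (use bound in \<open>auto simp: eventually_at_top_linorder\<close>)
  then have "(g \<longlongrightarrow> l) at_top" by (simp add: Lim_null[symmetric])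
  then show ?thesis using bound by blast
qed

text \<open>With the speed of a parametrization as weight the integrals are those over arc length.\<close>

lemma integral_cauchy_schwarz:
  fixes u w \<rho> :: "real \<Rightarrow> real"
  assumes c: "continuous_on {a..b} u" "continuous_on {a..b} w" "continuous_on {a..b} \<rho>"
    and \<rho>: "\<And>x. x \<in> {a..b} \<Longrightarrow> \<rho> x \<ge> 0"
  shows "(integral {a..b} (\<lambda>x. u x * w x * \<rho> x))\<^sup>2
    \<le> integral {a..b} (\<lambda>x. (u x)\<^sup>2 * \<rho> x) * integral {a..b} (\<lambda>x. (w x)\<^sup>2 * \<rho> x)"
    (is "?B\<^sup>2 \<le> ?A * ?C")
proof -
  have q: "0 \<le> z\<^sup>2 * ?A + 2 * z * ?B + ?C" for z
  proof -
    have "0 \<le> integral {a..b} (\<lambda>x. (z * u x + w x)\<^sup>2 * \<rho> x)"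
      using \<rho> by (intro integral_nonneg integrable_continuous_real continuous_intros c) auto
    also have "\<dots> = integral {a..b} (\<lambda>x. z\<^sup>2 * ((u x)\<^sup>2 * \<rho> x) + (2 * z) * (u x * w x * \<rho> x) + (w x)\<^sup>2 * \<rho> x)"
      by (rule arg_cong[where f="integral {a..b}"]) (auto simp: power2_eq_square algebra_simps)
    also have "\<dots> = z\<^sup>2 * ?A + 2 * z * ?B + ?C"
      by (subst integral_add integral_mult_right; (intro integrable_continuous_real continuous_intros c)?)+ simp
    finally show ?thesis .
  qed
  show ?thesis
  proof (cases "?A = 0")
    case True
    have "?B = 0"
    proof (rule ccontr)
      assume B: "?B \<noteq> 0"
      have "0 \<le> 2 * (- (?C + 1) / (2 * ?B)) * ?B + ?C" using q[of "- (?C + 1) / (2 * ?B)"] True by simp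
      then show False using B by (simp add: field_simps)
    qed
    then show ?thesis using True by simp
  next
    case False
    have "?A \<ge> 0" using \<rho> by (intro integral_nonneg integrable_continuous_real continuous_intros c) auto
    with False have "?A > 0" by simp
    then show ?thesis using q[of "- ?B / ?A"]
      by (simp add: field_simps power2_eq_square)
  qed
qed

text \<open>On \<open>[0, \<pi>/2]\<close> the sine is concave, hence above its chord.\<close>

lemma two_div_pi_le_sin:
  fixes x :: real
  assumes "0 \<le> x" "x \<le> pi / 2"
  shows "2 / pi * x \<le> sin x"
proof -
  have "convex_on {0..pi/2} (\<lambda>x. - sin x)"
    by (rule f''_ge0_imp_convex[where f'="\<lambda>x. - cos x" and f''="\<lambda>x. sin x"])
       (auto intro!: derivative_eq_intros sin_ge_zero)
  from convex_onD[OF this, of "2 / pi * x" 0 "pi/2"] show ?thesis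
    using assms by (simp add: field_simps)
qed

lemma norm_exp_i_minus_1: "norm (exp (\<i> * complex_of_real x) - 1) = 2 * \<bar>sin (x / 2)\<bar>"
proof -
  have "exp (\<i> * complex_of_real x) - 1 = cis x - 1" by (simp add: cis_conv_exp)
  moreover have "(norm (cis x - 1))\<^sup>2 = (2 * \<bar>sin (x / 2)\<bar>)\<^sup>2"
  proof -
    have "(norm (cis x - 1))\<^sup>2 = (cos x - 1)\<^sup>2 + (sin x)\<^sup>2" by (simp add: cmod_power2)
    also have "\<dots> = 2 - 2 * cos (2 * (x / 2))"
      by (simp add: power2_diff sin_squared_eq)
    also have "\<dots> = 4 * (sin (x / 2))\<^sup>2" unfolding cos_double_sin by simp
    finally show ?thesis by (simp add: power_mult_distrib)
  qed
  ultimately show ?thesis by (metis abs_ge_zero norm_ge_zero power2_eq_imp_eq mult_nonneg_nonneg zero_le_numeral)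
qed

lemma norm_exp_i_diff_le: "norm (exp (\<i> * complex_of_real x) - exp (\<i> * complex_of_real y)) \<le> \<bar>x - y\<bar>"
proof -
  have "exp (\<i> * complex_of_real x) - exp (\<i> * complex_of_real y)
     = exp (\<i> * complex_of_real y) * (exp (\<i> * complex_of_real (x - y)) - 1)"
    by (simp add: algebra_simps exp_add[symmetric] flip: exp_diff)
  then have "norm (exp (\<i> * complex_of_real x) - exp (\<i> * complex_of_real y)) = 2 * \<bar>sin ((x - y) / 2)\<bar>"
    by (simp add: norm_mult norm_exp_i_minus_1 del: of_real_diff)
  also have "\<dots> \<le> 2 * \<bar>(x - y) / 2\<bar>" using abs_sin_x_le_abs_x[of "(x - y) / 2"] by simp
  finally show ?thesis by simp
qed

text \<open>An arc of length at most \<open>\<pi>\<close> is at most \<open>\<pi>/2\<close> times as long as its chord.\<close>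

lemma distance_to_multiples_of_2pi:
  fixes x :: real
  shows "\<exists>n::int. \<bar>x - 2 * pi * of_int n\<bar> \<le> pi / 2 * norm (exp (\<i> * complex_of_real x) - 1)"
proof -
  define n where "n = round (x / (2 * pi))"
  define y where "y = x - 2 * pi * of_int n"
  have "\<bar>x / (2 * pi) - of_int n\<bar> \<le> 1/2"
    unfolding n_def using of_int_round_abs_le[of "x / (2 * pi)"] by (simp add: abs_minus_commute)
  then have y: "\<bar>y\<bar> \<le> pi" by (auto simp: y_def field_simps abs_le_iff)
  have "2 / pi * (\<bar>y\<bar> / 2) \<le> sin (\<bar>y\<bar> / 2)" using y by (intro two_div_pi_le_sin) auto
  also have "\<dots> \<le> \<bar>sin (y / 2)\<bar>" by (auto simp: abs_if)
  also have "\<dots> = norm (exp (\<i> * complex_of_real y) - 1) / 2" by (simp add: norm_exp_i_minus_1)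
  also have "exp (\<i> * complex_of_real y) = exp (\<i> * complex_of_real x)"
    unfolding exp_eq by (rule exI[of _ "- n"]) (simp add: y_def algebra_simps)
  finally show ?thesis by (intro exI[of _ n]) (simp add: y_def field_simps)
qed

lemma scaleR_inverse_sqrt_twice:
  fixes z :: complex
  assumes "x > 0"
  shows "(1 / sqrt x) *\<^sub>R (z * (1 / of_real (sqrt x))) = (1 / x) *\<^sub>R z"
proof -
  have "z * (1 / of_real (sqrt x)) = (1 / sqrt x) *\<^sub>R z" by (simp add: scaleR_conv_of_real)
  then have "(1 / sqrt x) *\<^sub>R (z * (1 / of_real (sqrt x))) = (1 / sqrt x * (1 / sqrt x)) *\<^sub>R z"
    by (simp only: scaleR_scaleR)
  also have "1 / sqrt x * (1 / sqrt x) = 1 / x" using assms by simp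
  finally show ?thesis .
qed

lemma has_vector_derivative_complex_of_real:
  "(f has_vector_derivative f') net \<Longrightarrow>
    ((\<lambda>x. complex_of_real (f x)) has_vector_derivative of_real f') net"
  by (rule bounded_linear.has_vector_derivative[OF bounded_linear_of_real])

lemma inner_eq_Re: "(a::complex) \<bullet> b = Re (cnj a * b)"
  by (simp add: inner_complex_def)

text \<open>
  The inequality \<open>\<mu>\<^sup>2 \<integral> y\<^sup>2 \<le> \<integral> y'\<^sup>2\<close> is the square completion
  \<open>y'\<^sup>2 - \<mu>\<^sup>2 y\<^sup>2 = (y' - \<phi> y)\<^sup>2 + (\<phi> y\<^sup>2)'\<close> with the Riccati solution
  \<open>\<phi> = - \<mu> tan (\<mu> (x - m))\<close>, \<open>m\<close> the midpoint; the last term integrates to zero because \<open>y\<close> vanishes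
  at the end points. For \<open>\<mu> < \<pi> / (b - a)\<close> the function \<open>\<phi>\<close> has no pole in the interval; the
  optimal constant is reached in the limit.
\<close>

lemma wirtinger_dirichlet:
  fixes y y' :: "real \<Rightarrow> real"
  assumes d: "\<And>x. x \<in> {a..b} \<Longrightarrow> (y has_vector_derivative y' x) (at x within {a..b})"
    and c: "continuous_on {a..b} y'" and z: "y a = 0" "y b = 0" and ab: "a < b"
  shows "(pi / (b - a))\<^sup>2 * integral {a..b} (\<lambda>x. (y x)\<^sup>2) \<le> integral {a..b} (\<lambda>x. (y' x)\<^sup>2)"
proof -
  have cy: "continuous_on {a..b} y" using d by (rule continuous_on_vector_derivative)
  define m where "m = (a + b) / 2"
  have sub: "\<mu>\<^sup>2 * integral {a..b} (\<lambda>x. (y x)\<^sup>2) \<le> integral {a..b} (\<lambda>x. (y' x)\<^sup>2)"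
    if \<mu>: "0 < \<mu>" "\<mu> < pi / (b - a)" for \<mu>
  proof -
    define \<phi> where "\<phi> x = - \<mu> * tan (\<mu> * (x - m))" for x
    have cz: "cos (\<mu> * (x - m)) \<noteq> 0" if x: "x \<in> {a..b}" for x
    proof -
      have "\<bar>x - m\<bar> \<le> (b - a) / 2" using x by (auto simp: m_def field_simps abs_le_iff)
      then have "\<bar>\<mu> * (x - m)\<bar> \<le> \<mu> * ((b - a) / 2)" using \<mu> by (simp add: abs_mult)
      also have "\<dots> < pi / 2" using \<mu> ab by (simp add: field_simps)
      finally have "cos (\<mu> * (x - m)) > 0" by (intro cos_gt_zero_pi) auto
      then show ?thesis by simp
    qed
    have d\<phi>: "(\<phi> has_field_derivative (- \<mu>\<^sup>2 - (\<phi> x)\<^sup>2)) (at x within {a..b})" if x: "x \<in> {a..b}" for x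
      unfolding \<phi>_def
      by (rule derivative_eq_intros refl cz[OF x] | simp)+
         (use cz[OF x] in \<open>simp add: tan_def field_simps power2_eq_square,
           metis (no_types) sin_cos_squared_add3 distrib_left mult.commute mult.left_commute mult_1_right add.commute\<close>)
    have dy: "(y has_field_derivative y' x) (at x within {a..b})" if x: "x \<in> {a..b}" for x
      using d[OF x] by (simp add: has_real_derivative_iff_has_vector_derivative)
    have "((\<lambda>x. (- \<mu>\<^sup>2 - (\<phi> x)\<^sup>2) * (y x)\<^sup>2 + 2 * \<phi> x * y x * y' x) has_integral \<phi> b * (y b)\<^sup>2 - \<phi> a * (y a)\<^sup>2) {a..b}"
    proof (rule fundamental_theorem_of_calculus)
      fix x assume x: "x \<in> {a..b}"
      have "((\<lambda>x. \<phi> x * (y x)\<^sup>2) has_field_derivative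
          (- \<mu>\<^sup>2 - (\<phi> x)\<^sup>2) * (y x)\<^sup>2 + 2 * \<phi> x * y x * y' x) (at x within {a..b})"
        by (rule derivative_eq_intros refl d\<phi> dy x | simp)+
      then show "((\<lambda>x. \<phi> x * (y x)\<^sup>2) has_vector_derivative
          (- \<mu>\<^sup>2 - (\<phi> x)\<^sup>2) * (y x)\<^sup>2 + 2 * \<phi> x * y x * y' x) (at x within {a..b})"
        by (simp add: has_real_derivative_iff_has_vector_derivative)
    qed (use ab in auto)
    then have I0: "integral {a..b} (\<lambda>x. (- \<mu>\<^sup>2 - (\<phi> x)\<^sup>2) * (y x)\<^sup>2 + 2 * \<phi> x * y x * y' x) = 0"
      using z by (simp add: integral_unique)
    have c\<phi>: "continuous_on {a..b} \<phi>"
      using d\<phi> by (intro DERIV_continuous_on)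
    have "0 \<le> integral {a..b} (\<lambda>x. (y' x - \<phi> x * y x)\<^sup>2)"
      by (intro integral_nonneg integrable_continuous_real continuous_intros c cy c\<phi>) auto
    also have "\<dots> = integral {a..b} (\<lambda>x. ((y' x)\<^sup>2 - \<mu>\<^sup>2 * (y x)\<^sup>2)
         - ((- \<mu>\<^sup>2 - (\<phi> x)\<^sup>2) * (y x)\<^sup>2 + 2 * \<phi> x * y x * y' x))"
      by (rule arg_cong[where f="integral {a..b}"]) (auto simp: power2_eq_square algebra_simps)
    also have "\<dots> = integral {a..b} (\<lambda>x. (y' x)\<^sup>2 - \<mu>\<^sup>2 * (y x)\<^sup>2)"
      by (subst integral_diff) (auto intro!: integrable_continuous_real continuous_intros c cy c\<phi> simp: I0)
    also have "\<dots> = integral {a..b} (\<lambda>x. (y' x)\<^sup>2) - \<mu>\<^sup>2 * integral {a..b} (\<lambda>x. (y x)\<^sup>2)"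
      by (subst integral_diff) (auto intro!: integrable_continuous_real continuous_intros c cy)
    finally show ?thesis by simp
  qed
  have "((\<lambda>\<mu>. \<mu>\<^sup>2 * integral {a..b} (\<lambda>x. (y x)\<^sup>2)) \<longlongrightarrow>
      (pi / (b - a))\<^sup>2 * integral {a..b} (\<lambda>x. (y x)\<^sup>2)) (at_left (pi / (b - a)))"
    by (intro tendsto_intros)
  then show ?thesis
  proof (rule tendsto_upperbound)
    have "0 < pi / (b - a)" using ab by simp
    then show "\<forall>\<^sub>F \<mu> in at_left (pi / (b - a)). \<mu>\<^sup>2 * integral {a..b} (\<lambda>x. (y x)\<^sup>2) \<le> integral {a..b} (\<lambda>x. (y' x)\<^sup>2)"
      using sub unfolding eventually_at_left_field by blast
  qed auto
qed

lemma one_minus_cos_ge: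
  fixes x :: real
  assumes "\<bar>x\<bar> \<le> 1 / 2"
  shows "8 * x\<^sup>2 \<le> 1 - cos (2 * pi * x)"
proof -
  have "pi * \<bar>x\<bar> \<le> pi * (1 / 2)" using assms by (intro mult_left_mono) auto
  then have "2 / pi * (pi * \<bar>x\<bar>) \<le> sin (pi * \<bar>x\<bar>)" by (intro two_div_pi_le_sin) auto
  then have "2 * \<bar>x\<bar> \<le> sin (pi * \<bar>x\<bar>)" by simp
  then have "(2 * \<bar>x\<bar>)\<^sup>2 \<le> (sin (pi * \<bar>x\<bar>))\<^sup>2" by (intro power_mono) auto
  also have "(sin (pi * \<bar>x\<bar>))\<^sup>2 = (sin (pi * x))\<^sup>2" by (cases "x \<ge> 0") auto
  finally have "4 * x\<^sup>2 \<le> (sin (pi * x))\<^sup>2" by (simp add: power_mult_distrib)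
  moreover have "1 - cos (2 * pi * x) = 2 * (sin (pi * x))\<^sup>2"
    using cos_double_sin[of "pi * x"] by (simp add: mult.assoc)
  ultimately show ?thesis by simp
qed

lemma periodic_int_shift:
  fixes f :: "real \<Rightarrow> 'a" and n :: int
  assumes "\<And>x. f (x + l) = f x"
  shows "f (x + of_int n * l) = f x"
proof (induction n arbitrary: x rule: int_induct[where k=0])
  case (step1 i) then show ?case using assms[of "x + of_int i * l"] by (simp add: algebra_simps)
next
  case (step2 i) then show ?case using assms[of "x + of_int (i - 1) * l"] by (simp add: algebra_simps)
qed simp

lemma periodic_frac:
  fixes f :: "real \<Rightarrow> 'a"
  assumes "\<And>x. f (x + 1) = f x"
  shows "f (frac x) = f x"
  using periodic_int_shift[where f=f and l=1, OF assms, of "frac x" "\<lfloor>x\<rfloor>"] by (simp add: frac_def)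

lemma periodic_vector_derivative:
  fixes g :: "real \<Rightarrow> 'a::real_normed_vector"
  assumes "\<And>x. (g has_vector_derivative g' x) (at x)" "\<And>x. g (x + 1) = g x"
  shows "g' (x + 1) = g' x"
proof -
  have "((\<lambda>y. g (y + 1)) has_vector_derivative g' (x + 1)) (at x)"
    using vector_diff_chain_at[of "\<lambda>y. y + 1" "1 + 0" x g "g' (x + 1)"] assms(1)
      has_vector_derivative_add[OF has_vector_derivative_id has_vector_derivative_const]
    by (simp add: o_def)
  then show ?thesis unfolding assms(2) using assms(1) vector_derivative_unique_at by blast
qed

lemma vector_derivative_unique_Ici:
  fixes f :: "real \<Rightarrow> 'a::euclidean_space"
  assumes "(f has_vector_derivative a) (at t within {0..})" "(f has_vector_derivative b) (at t within {0..})" "t \<ge> 0"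
  shows "a = b"
proof -
  have "at t within {0..} \<noteq> bot"
    using islimpt_subset[of t "{t..t+1}" "{0..}"] assms(3) by (auto simp: trivial_limit_within islimpt_Icc)
  then show ?thesis using assms vector_derivative_unique_within by blast
qed

text \<open>
  \<open>W1\<close> and \<open>W2\<close> are the derivatives of \<open>W\<close> by arc length: the parameter derivative is divided by the
  speed \<open>v\<close>. If the maximum over a period and the time interval up to \<open>t\<close> exceeded \<open>B\<close>, it would be
  attained at a positive time; there \<open>W2 \<le> 0\<close> and \<open>W\<^sub>t \<ge> 0\<close>, which contradicts the differential
  inequality where \<open>W > C\<close>.
\<close>

lemma parabolic_maximum_principle:
  fixes W W\<^sub>t W1 W2 v :: "real \<Rightarrow> real \<Rightarrow> real"
  assumes cont: "continuous_on (UNIV \<times> {0..}) (\<lambda>(p, t). W p t)"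
    and per: "\<And>p t. t \<ge> 0 \<Longrightarrow> W (p + 1) t = W p t"
    and dt: "\<And>p t. t \<ge> 0 \<Longrightarrow> ((\<lambda>\<tau>. W p \<tau>) has_real_derivative W\<^sub>t p t) (at t within {0..})"
    and d1: "\<And>p t. t \<ge> 0 \<Longrightarrow> ((\<lambda>x. W x t) has_real_derivative v p t * W1 p t) (at p)"
    and d2: "\<And>p t. t \<ge> 0 \<Longrightarrow> ((\<lambda>x. W1 x t) has_real_derivative v p t * W2 p t) (at p)"
    and v: "\<And>p t. t \<ge> 0 \<Longrightarrow> v p t > 0"
    and ineq: "\<And>p t. t \<ge> 0 \<Longrightarrow> W\<^sub>t p t \<le> W2 p t - W p t + C"
    and init: "\<And>p. W p 0 \<le> B" and CB: "C \<le> B" and t: "t \<ge> 0"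
  shows "W p t \<le> B"
proof (rule ccontr)
  assume "\<not> W p t \<le> B"
  then have gt: "W (frac p) t > B" using periodic_frac[where f="\<lambda>x. W x t", OF per[OF t], of p] by simp
  define S :: "(real \<times> real) set" where "S = {0..1} \<times> {0..t}"
  have "compact S" unfolding S_def by (intro compact_Times compact_Icc)
  moreover have inS: "(frac p, t) \<in> S" using t by (auto simp: S_def frac_lt_1 less_imp_le)
  moreover have "continuous_on S (\<lambda>(p, t). W p t)"
    by (rule continuous_on_subset[OF cont]) (auto simp: S_def)
  ultimately obtain z where z: "z \<in> S" "\<And>y. y \<in> S \<Longrightarrow> (\<lambda>(p, t). W p t) y \<le> (\<lambda>(p, t). W p t) z"
    using continuous_attains_sup[of S "\<lambda>(p, t). W p t"] by blast
  obtain q s where q: "z = (q, s)" by (cases z)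
  have s: "0 \<le> s" "s \<le> t" using z(1) by (auto simp: q S_def)
  have big: "W q s > B" using z(2)[OF inS] gt by (simp add: q)
  have s0: "s > 0" using init[of q] big s by (cases "s = 0") auto
  have max_t: "W q \<tau> \<le> W q s" if "0 \<le> \<tau>" "\<tau> \<le> s" for \<tau>
    using z(2)[of "(q, \<tau>)"] z(1) that s by (auto simp: q S_def)
  have max_p: "W x s \<le> W q s" for x
  proof -
    have "W (frac x) s \<le> W q s" using z(2)[of "(frac x, s)"] s by (auto simp: q S_def frac_lt_1 less_imp_le)
    then show ?thesis using periodic_frac[where f="\<lambda>x. W x s", OF per[OF s(1)], of x] by simp
  qed
  have "v q s * W1 q s = 0"
    by (rule DERIV_local_max[OF d1[OF s(1)], of 1]) (use max_p in auto)
  then have W1: "W1 q s = 0" using v[OF s(1), of q] by simp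
  \<comment> \<open>Otherwise the first derivative would be positive to the right of the maximum.\<close>
  have "W2 q s \<le> 0"
  proof (rule ccontr)
    assume "\<not> W2 q s \<le> 0"
    then have "v q s * W2 q s > 0" using v[OF s(1), of q] by simp
    from DERIV_pos_inc_right[OF d2[OF s(1)] this]
    obtain d where d: "d > 0" "\<And>h. 0 < h \<Longrightarrow> h < d \<Longrightarrow> W1 q s < W1 (q + h) s" by blast
    have "W q s < W (q + d/2) s"
    proof (rule DERIV_pos_imp_increasing_open[of q "q + d/2" "\<lambda>x. W x s"])
      fix x assume x: "q < x" "x < q + d/2"
      then have "W1 x s > 0" using d(2)[of "x - q"] d(1) W1 by auto
      then show "\<exists>y. ((\<lambda>x. W x s) has_real_derivative y) (at x) \<and> 0 < y"
        by (intro exI[of _ "v x s * W1 x s"] conjI d1 mult_pos_pos v s(1))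
    next
      show "continuous_on {q..q + d/2} (\<lambda>x. W x s)"
        by (rule DERIV_continuous_on[OF has_field_derivative_at_within[OF d1[OF s(1)]]])
    qed (use d(1) in simp)
    then show False using max_p[of "q + d/2"] by simp
  qed
  \<comment> \<open>Only earlier times are compared, so \<open>s\<close> may be the final time \<open>t\<close>.\<close>
  moreover have "W\<^sub>t q s \<ge> 0"
  proof (rule ccontr)
    assume neg: "\<not> W\<^sub>t q s \<ge> 0"
    have "((\<lambda>\<tau>. W q \<tau>) has_real_derivative W\<^sub>t q s) (at s)"
      using dt[OF s(1), of q] at_within_interior[of s "{0..}"] s0 by (simp add: interior_Ici[of "-1"])
    from DERIV_neg_dec_left[OF this] neg
    obtain d where d: "d > 0" "\<And>h. 0 < h \<Longrightarrow> h < d \<Longrightarrow> W q s < W q (s - h)" by force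
    define e where "e = min (d/2) s"
    have e: "0 < e" "e < d" "e \<le> s" using d(1) s0 by (auto simp: e_def min_def)
    then have "W q (s - e) \<le> W q s" by (intro max_t) auto
    then show False using d(2)[OF e(1,2)] by simp
  qed
  ultimately show False using ineq[OF s(1), of q] big CB by linarith
qed

section \<open>Barriers and exponential decay\<close>

lemma nonincreasing_if_derivative_nonpos:
  fixes f :: "real \<Rightarrow> real"
  assumes d: "\<And>x. a \<le> x \<Longrightarrow> x \<le> b \<Longrightarrow> (f has_vector_derivative f' x) (at x within {0..})"
    and n: "\<And>x. a < x \<Longrightarrow> x < b \<Longrightarrow> f' x \<le> 0" and ab: "0 \<le> a" "a \<le> b"
  shows "f b \<le> f a"
proof (rule DERIV_nonpos_imp_decreasing_open[OF ab(2)])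
  show "\<exists>y. (f has_real_derivative y) (at x) \<and> y \<le> 0" if "a < x" "x < b" for x
  proof -
    have "at x within {0..} = at x" using that ab by (intro at_within_interior) (simp add: interior_Ici[of "-1"])
    then show ?thesis using d[of x] n[of x] that by (auto simp: has_real_derivative_iff_has_vector_derivative)
  qed
  show "continuous_on {a..b} f"
    by (rule continuous_on_vector_derivative, rule has_vector_derivative_within_subset[OF d]) (use ab in auto)
qed

lemma continuous_on_Ici_if_derivative:
  fixes f :: "real \<Rightarrow> 'a::real_normed_vector"
  assumes "\<And>x. 0 \<le> x \<Longrightarrow> (f has_vector_derivative f' x) (at x within {0..})"
  shows "continuous_on {0..} f"
  by (rule continuous_on_vector_derivative) (use assms in auto)

text \<open>
  After the last time before \<open>t\<close> at which \<open>f \<le> M\<close>, the values of \<open>f\<close> exceed \<open>M\<close>, hence \<open>B\<close>, so that \<open>f\<close>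
  does not increase from there on.
\<close>

lemma stays_below_barrier:
  fixes f :: "real \<Rightarrow> real"
  assumes d: "\<And>x. 0 \<le> x \<Longrightarrow> (f has_vector_derivative f' x) (at x within {0..})"
    and n: "\<And>x. a \<le> x \<Longrightarrow> f x \<ge> B \<Longrightarrow> f' x \<le> 0" and a: "0 \<le> a" "a \<le> t"
    and M: "f a \<le> M" "B \<le> M"
  shows "f t \<le> M"
proof (rule ccontr)
  assume t: "\<not> f t \<le> M"
  define S where "S = {x \<in> {a..t}. f x \<le> M}"
  have c: "continuous_on {a..t} f"
    by (rule continuous_on_subset[OF continuous_on_Ici_if_derivative[OF d]]) (use a in auto)
  then have "closed S" unfolding S_def by (intro continuous_on_closed_Collect_le continuous_on_const) auto
  moreover have "a \<in> S" using a M by (simp add: S_def)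
  moreover have bdd: "bdd_above S" by (auto simp: S_def bdd_above_def)
  ultimately have s: "Sup S \<in> S" by (intro closed_contains_Sup) auto
  have "f t \<le> f (Sup S)"
  proof (rule nonincreasing_if_derivative_nonpos[where f=f and f'=f' and a="Sup S" and b=t])
    show "f' x \<le> 0" if x: "Sup S < x" "x < t" for x
    proof (rule n)
      have "x \<notin> S" using cSup_upper[OF _ bdd, of x] x by auto
      then show "B \<le> f x" "a \<le> x" using x s M by (auto simp: S_def)
    qed
  qed (use s a d in \<open>auto simp: S_def\<close>)
  then show False using s t by (simp add: S_def)
qed

text \<open>Up to the first time at which \<open>f\<close> reaches \<open>B\<close>, it does not increase.\<close>

lemma stays_below_threshold:
  fixes f :: "real \<Rightarrow> real"
  assumes d: "\<And>x. 0 \<le> x \<Longrightarrow> (f has_vector_derivative f' x) (at x within {0..})"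
    and n: "\<And>x. a \<le> x \<Longrightarrow> f x < B \<Longrightarrow> f' x \<le> 0" and a: "0 \<le> a" "a \<le> t" and B: "f a < B"
  shows "f t < B"
proof (rule ccontr)
  assume t: "\<not> f t < B"
  define S where "S = {x \<in> {a..t}. B \<le> f x}"
  have c: "continuous_on {a..t} f"
    by (rule continuous_on_subset[OF continuous_on_Ici_if_derivative[OF d]]) (use a in auto)
  then have "closed S" unfolding S_def by (intro continuous_on_closed_Collect_le continuous_on_const) auto
  moreover have "t \<in> S" using a t by (simp add: S_def)
  moreover have bdd: "bdd_below S" by (auto simp: S_def bdd_below_def)
  ultimately have s: "Inf S \<in> S" by (intro closed_contains_Inf) auto
  have "f (Inf S) \<le> f a"
  proof (rule nonincreasing_if_derivative_nonpos[where f=f and f'=f' and a=a and b="Inf S"])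
    show "f' x \<le> 0" if x: "a < x" "x < Inf S" for x
    proof (rule n)
      have "x \<notin> S" using cInf_lower[OF _ bdd, of x] x by auto
      then show "f x < B" "a \<le> x" using x s by (auto simp: S_def)
    qed
  qed (use s a d in \<open>auto simp: S_def\<close>)
  then show False using s B by (simp add: S_def)
qed

text \<open>Only a bound from above, so that the notion passes to every smaller function, signed ones included.\<close>

definition exp_decay :: "(real \<Rightarrow> real) \<Rightarrow> bool" where
  "exp_decay h \<longleftrightarrow> (\<exists>C>0. \<exists>\<gamma>>0. \<forall>t\<ge>0. h t \<le> C * exp (- \<gamma> * t))"

lemma exp_decayI:
  assumes C: "C \<ge> 0" and \<gamma>: "\<gamma> > 0" and h: "\<And>t. t \<ge> 0 \<Longrightarrow> h t \<le> C * exp (- \<gamma> * t)"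
  shows "exp_decay h"
proof -
  have "h t \<le> (C + 1) * exp (- \<gamma> * t)" if "t \<ge> 0" for t
    using h[OF that] by (simp add: distrib_right add_increasing2)
  moreover have "C + 1 > 0" using C by simp
  ultimately show ?thesis unfolding exp_decay_def using \<gamma> by blast
qed

lemma exp_decay_mono: "exp_decay h \<Longrightarrow> (\<And>t. t \<ge> 0 \<Longrightarrow> g t \<le> h t) \<Longrightarrow> exp_decay g"
  unfolding exp_decay_def by (meson order_trans)

lemma exp_decay_add: assumes "exp_decay g" "exp_decay h" shows "exp_decay (\<lambda>t. g t + h t)"
proof -
  from assms obtain C1 \<gamma>1 C2 \<gamma>2 where *: "C1 > 0" "\<gamma>1 > 0" "C2 > 0" "\<gamma>2 > 0"
    "\<And>t. t \<ge> 0 \<Longrightarrow> g t \<le> C1 * exp (- \<gamma>1 * t)" "\<And>t. t \<ge> 0 \<Longrightarrow> h t \<le> C2 * exp (- \<gamma>2 * t)"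
    unfolding exp_decay_def by blast
  show ?thesis
  proof (rule exp_decayI[of "C1 + C2" "min \<gamma>1 \<gamma>2"])
    fix t :: real assume t: "t \<ge> 0"
    have "C1 * exp (- \<gamma>1 * t) \<le> C1 * exp (- min \<gamma>1 \<gamma>2 * t)" "C2 * exp (- \<gamma>2 * t) \<le> C2 * exp (- min \<gamma>1 \<gamma>2 * t)"
      using * t by (auto intro!: mult_right_mono)
    then show "g t + h t \<le> (C1 + C2) * exp (- min \<gamma>1 \<gamma>2 * t)"
      using *(5,6)[OF t] by (simp add: distrib_right)
  qed (use * in auto)
qed

lemma exp_decay_cmult: assumes "exp_decay h" "c \<ge> 0" shows "exp_decay (\<lambda>t. c * h t)"
proof -
  from assms(1) obtain C \<gamma> where *: "C > 0" "\<gamma> > 0" "\<And>t. t \<ge> 0 \<Longrightarrow> h t \<le> C * exp (- \<gamma> * t)"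
    unfolding exp_decay_def by blast
  show ?thesis
    by (rule exp_decayI[of "c * C" \<gamma>]) (use * assms(2) mult_left_mono[OF *(3) assms(2)] in \<open>auto simp: mult.assoc\<close>)
qed

lemma exp_decay_sqrt:
  assumes "exp_decay h"
  shows "exp_decay (\<lambda>t. sqrt (h t))"
proof -
  from assms obtain C \<gamma> where *: "C > 0" "\<gamma> > 0" "\<And>t. t \<ge> 0 \<Longrightarrow> h t \<le> C * exp (- \<gamma> * t)"
    unfolding exp_decay_def by blast
  show ?thesis
  proof (rule exp_decayI[of "sqrt C" "\<gamma> / 2"])
    fix t :: real assume "t \<ge> 0"
    then have "sqrt (h t) \<le> sqrt (C * exp (- \<gamma> * t))" using * by simp
    also have "exp (- \<gamma> * t) = (exp (- (\<gamma> / 2) * t))\<^sup>2"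
      by (simp add: power2_eq_square exp_add[symmetric])
    also have "sqrt (C * (exp (- (\<gamma> / 2) * t))\<^sup>2) = sqrt C * exp (- (\<gamma> / 2) * t)"
      by (simp add: real_sqrt_mult)
    finally show "sqrt (h t) \<le> sqrt C * exp (- (\<gamma> / 2) * t)" .
  qed (use * in auto)
qed

lemma exp_decay_if_sq: "exp_decay (\<lambda>t. (h t)\<^sup>2) \<Longrightarrow> exp_decay h"
  by (rule exp_decay_mono[OF exp_decay_sqrt]) auto

text \<open>What happens before time \<open>T\<close> is absorbed by a larger constant.\<close>

lemma exp_decay_extend:
  assumes c: "continuous_on {0..} h" and T: "\<And>t. t \<ge> T \<Longrightarrow> h t \<le> C * exp (- \<gamma> * t)" and \<gamma>: "\<gamma> > 0"
  shows "exp_decay h"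
proof -
  have "bounded (h ` {0..max T 0})"
    by (intro compact_imp_bounded compact_continuous_image continuous_on_subset[OF c]) auto
  then obtain B where "\<forall>x\<in>h ` {0..max T 0}. norm x \<le> B" unfolding bounded_iff by blast
  then have B: "\<bar>h t\<bar> \<le> B" if "0 \<le> t" "t \<le> max T 0" for t using that by auto
  have B0: "B \<ge> 0" using B[of 0] abs_ge_zero[of "h 0"] by linarith
  show ?thesis
  proof (rule exp_decayI[of "\<bar>C\<bar> + B * exp (\<gamma> * max T 0)" \<gamma>])
    fix t :: real assume t: "t \<ge> 0"
    show "h t \<le> (\<bar>C\<bar> + B * exp (\<gamma> * max T 0)) * exp (- \<gamma> * t)"
    proof (cases "t \<le> max T 0")
      case True
      have "h t \<le> B" using B[OF t True] by simp
      also have "B * 1 \<le> B * exp (\<gamma> * (max T 0 - t))" using B0 True \<gamma> by (intro mult_left_mono) auto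
      then have "B \<le> B * exp (\<gamma> * max T 0) * exp (- \<gamma> * t)"
        by (simp add: exp_add[symmetric] algebra_simps)
      also have "\<dots> \<le> (\<bar>C\<bar> + B * exp (\<gamma> * max T 0)) * exp (- \<gamma> * t)"
        by (intro mult_right_mono) auto
      finally show ?thesis .
    next
      case False
      then have "h t \<le> C * exp (- \<gamma> * t)" using T by auto
      also have "\<dots> \<le> (\<bar>C\<bar> + B * exp (\<gamma> * max T 0)) * exp (- \<gamma> * t)"
        using B0 by (intro mult_right_mono) (auto intro: add_increasing2)
      finally show ?thesis .
    qed
  qed (use B0 \<gamma> in auto)
qed

lemma exp_decay_small:
  assumes "exp_decay h" "e > 0"
  shows "\<exists>s\<ge>0. \<forall>t\<ge>s. h t \<le> e"
proof -
  from assms(1) obtain C \<gamma> where *: "C > 0" "\<gamma> > 0" "\<And>t. t \<ge> 0 \<Longrightarrow> h t \<le> C * exp (- \<gamma> * t)"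
    unfolding exp_decay_def by blast
  define s where "s = max 0 (ln (C / e) / \<gamma>)"
  have "h t \<le> e" if "t \<ge> s" for t
  proof -
    have "ln (C / e) / \<gamma> \<le> t" "0 \<le> t" using that by (auto simp: s_def)
    then have "ln (C / e) \<le> \<gamma> * t" using * by (simp add: field_simps)
    then have "C / e \<le> exp (\<gamma> * t)" using * assms(2) by (metis divide_pos_pos exp_le_cancel_iff exp_ln)
    then have "C * exp (- \<gamma> * t) \<le> e" using assms(2) by (simp add: exp_minus field_simps)
    then show ?thesis using *(3)[OF \<open>0 \<le> t\<close>] by simp
  qed
  then show ?thesis by (intro exI[of _ s]) (auto simp: s_def)
qed

lemma exp_decay_eventually:
  assumes "exp_decay h" "\<And>t. t \<ge> s \<Longrightarrow> g t \<le> h t"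
  shows "\<exists>C>0. \<exists>\<gamma>>0. \<forall>\<^sub>F t in at_top. g t \<le> C * exp (- \<gamma> * t)"
proof -
  from assms(1) obtain C \<gamma> where *: "C > 0" "\<gamma> > 0" "\<And>t. t \<ge> 0 \<Longrightarrow> h t \<le> C * exp (- \<gamma> * t)"
    unfolding exp_decay_def by blast
  have "\<forall>\<^sub>F t in at_top. g t \<le> C * exp (- \<gamma> * t)"
    using eventually_ge_at_top[of "max s 0"]
  proof (rule eventually_mono)
    fix t assume "max s 0 \<le> t"
    then show "g t \<le> C * exp (- \<gamma> * t)" using assms(2)[of t] *(3)[of t] by simp
  qed
  then show ?thesis using * by blast
qed

lemma exp_decay_zero: "exp_decay (\<lambda>t. 0)"
  by (rule exp_decayI[of 1 1]) auto

lemma exp_decay_sum: "(\<And>j. j \<in> S \<Longrightarrow> exp_decay (e j)) \<Longrightarrow> exp_decay (\<lambda>t. \<Sum>j\<in>S. e j t)"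
  by (induction S rule: infinite_finite_induct) (auto intro: exp_decay_zero exp_decay_add)

lemma exp_decay_limit:
  fixes g :: "real \<Rightarrow> 'a::banach"
  assumes d: "\<And>t. t \<ge> 0 \<Longrightarrow> (g has_vector_derivative g' t) (at t within {0..})"
    and b: "\<And>t. t \<ge> 0 \<Longrightarrow> norm (g' t) \<le> e t" and e: "exp_decay e"
  shows "\<exists>l. (g \<longlongrightarrow> l) at_top \<and> exp_decay (\<lambda>t. norm (g t - l))"
proof -
  from e obtain C \<gamma> where *: "C > 0" "\<gamma> > 0" "\<And>t. t \<ge> 0 \<Longrightarrow> e t \<le> C * exp (- \<gamma> * t)"
    unfolding exp_decay_def by blast
  obtain l where "(g \<longlongrightarrow> l) at_top" "\<forall>t\<ge>0. norm (g t - l) \<le> C / \<gamma> * exp (- \<gamma> * t)"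
    using exponential_limit[OF d order_trans[OF b *(3)]] * by (metis less_imp_le)
  then show ?thesis using * exp_decayI[of "C / \<gamma>" \<gamma>] by (metis divide_nonneg_pos less_imp_le)
qed

text \<open>
  A decaying family whose derivatives are all merely bounded has decaying derivatives of all orders:
  by Landau's interpolation each derivative keeps half of the decay rate of the preceding one.
\<close>

lemma derivatives_exp_decay:
  fixes G :: "nat \<Rightarrow> real \<Rightarrow> real \<Rightarrow> 'a::real_normed_vector"
  assumes d: "\<And>j t x. t \<ge> 0 \<Longrightarrow> (G j t has_vector_derivative G (Suc j) t x) (at x)"
    and b: "\<And>j. \<exists>B. \<forall>t\<ge>0. \<forall>x. norm (G (Suc j) t x) \<le> B"
    and z: "exp_decay e0" "\<And>t x. t \<ge> 0 \<Longrightarrow> norm (G 0 t x) \<le> e0 t"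
  shows "\<exists>e. exp_decay e \<and> (\<forall>t\<ge>0. \<forall>x. norm (G j t x) \<le> e t)"
proof (induction j)
  case 0 then show ?case using z by blast
next
  case (Suc j)
  then obtain e C \<gamma> where e: "\<And>t x. t \<ge> 0 \<Longrightarrow> norm (G j t x) \<le> e t"
    and *: "C > 0" "\<gamma> > 0" "\<And>t. t \<ge> 0 \<Longrightarrow> e t \<le> C * exp (- \<gamma> * t)"
    unfolding exp_decay_def by blast
  obtain M where M: "\<And>t x. t \<ge> 0 \<Longrightarrow> norm (G (Suc (Suc j)) t x) \<le> M" using b by blast
  define h where "h t = sqrt (C * exp (- \<gamma> * t))" for t
  have M0: "M \<ge> 0" using M[of 0 0] norm_ge_zero order_trans by blast
  have "norm (G (Suc j) t x) \<le> (2 + M) * h t" if t: "t \<ge> 0" for t x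
  proof (rule landau_derivative_bound[OF d[OF t] d[OF t] M[OF t]])
    show "norm (G j t x) \<le> (h t)\<^sup>2" for x using order_trans[OF e[OF t] *(3)[OF t]] * by (simp add: h_def)
    show "h t > 0" using * by (simp add: h_def)
  qed
  moreover have "exp_decay (\<lambda>t. (2 + M) * h t)"
    unfolding h_def by (intro exp_decay_cmult exp_decay_sqrt exp_decayI[of C \<gamma>]) (use * M0 in auto)
  ultimately show ?case by blast
qed

section \<open>Smooth one-parameter families\<close>

abbreviation has_space_derivative ::
    "(real \<Rightarrow> real \<Rightarrow> 'a::real_normed_vector) \<Rightarrow> (real \<Rightarrow> real \<Rightarrow> 'a) \<Rightarrow> bool" where
  "has_space_derivative u a \<equiv> \<forall>p. \<forall>t\<ge>0. ((\<lambda>x. u x t) has_vector_derivative a p t) (at p)"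

abbreviation has_time_derivative ::
    "(real \<Rightarrow> real \<Rightarrow> 'a::real_normed_vector) \<Rightarrow> (real \<Rightarrow> real \<Rightarrow> 'a) \<Rightarrow> bool" where
  "has_time_derivative u b \<equiv>
     \<forall>p. \<forall>t\<ge>0. ((\<lambda>\<tau>. u p \<tau>) has_vector_derivative b p t) (at t within {0..})"

text \<open>
  \<open>C\<^sup>n\<close> on \<open>\<real> \<times> [0, \<infinity>)\<close>, by recursion on the order with existentially quantified first derivatives
  instead of a family of all mixed derivatives: closure under products, reciprocals and square roots
  then follows by induction on \<open>n\<close>.
\<close>

primrec Cn_family :: "nat \<Rightarrow> (real \<Rightarrow> real \<Rightarrow> 'a::real_normed_vector) \<Rightarrow> bool" where
  "Cn_family 0 u \<longleftrightarrow> continuous_on (UNIV \<times> {0..}) (\<lambda>(p, t). u p t)"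
| "Cn_family (Suc n) u \<longleftrightarrow> continuous_on (UNIV \<times> {0..}) (\<lambda>(p, t). u p t) \<and>
     (\<exists>a b. Cn_family n a \<and> Cn_family n b \<and> has_space_derivative u a \<and> has_time_derivative u b)"

definition Cinf_family :: "(real \<Rightarrow> real \<Rightarrow> 'a::real_normed_vector) \<Rightarrow> bool" where
  "Cinf_family u \<longleftrightarrow> (\<forall>n. Cn_family n u)"

lemma Cn_family_continuous: "Cn_family n u \<Longrightarrow> continuous_on (UNIV \<times> {0..}) (\<lambda>(p, t). u p t)"
  by (cases n) auto

lemma Cn_family_mono: "Cn_family (Suc n) u \<Longrightarrow> Cn_family n u"
proof (induction n arbitrary: u)
  case (Suc n)
  from Suc.prems show ?case by (subst (asm) Cn_family.simps(2), subst Cn_family.simps(2)) (use Suc.IH in blast)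
qed simp

lemma Cn_family_cong:
  assumes "Cn_family n u" and eq: "\<And>p t. t \<ge> 0 \<Longrightarrow> w p t = u p t"
  shows "Cn_family n w"
proof -
  have c: "continuous_on (UNIV \<times> {0..}) (\<lambda>(p, t). w p t)"
    using Cn_family_continuous[OF assms(1)] by (rule continuous_on_eq) (auto simp: eq)
  show ?thesis
  proof (cases n)
    case (Suc m)
    then obtain a b where ab: "Cn_family m a" "Cn_family m b"
      "has_space_derivative u a" "has_time_derivative u b" using assms(1) by auto
    have "has_space_derivative w a" using ab(3) by (simp add: eq)
    moreover have "has_time_derivative w b"
      using ab(4) eq by (auto intro: has_vector_derivative_transform)
    ultimately show ?thesis using Suc c ab by auto
  qed (use c in simp)
qed

lemma Cn_family_const: "Cn_family n (\<lambda>p t. c)"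
proof (induction n arbitrary: c)
  case (Suc n)
  show ?case unfolding Cn_family.simps
    by (intro conjI exI[of _ "\<lambda>p t. 0"] Suc.IH) auto
qed (auto)

lemma Cn_family_add: "Cn_family n u \<Longrightarrow> Cn_family n w \<Longrightarrow> Cn_family n (\<lambda>p t. u p t + w p t)"
proof (induction n arbitrary: u w)
  case 0 then show ?case by (auto simp: split_beta intro!: continuous_intros)
next
  case (Suc n)
  from Suc.prems obtain a b a' b' where
    h: "Cn_family n a" "Cn_family n b" "has_space_derivative u a" "has_time_derivative u b"
     "Cn_family n a'" "Cn_family n b'" "has_space_derivative w a'" "has_time_derivative w b'" by auto
  have "continuous_on (UNIV \<times> {0..}) (\<lambda>(p, t). u p t + w p t)"
    using Suc.prems by (auto simp: split_beta intro!: continuous_intros)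
  then show ?case unfolding Cn_family.simps
    by (intro conjI exI[of _ "\<lambda>p t. a p t + a' p t"] exI[of _ "\<lambda>p t. b p t + b' p t"] Suc.IH h)
       (use h in \<open>auto intro!: has_vector_derivative_add\<close>)
qed

lemma Cn_family_linear:
  assumes "bounded_linear h"
  shows "Cn_family n u \<Longrightarrow> Cn_family n (\<lambda>p t. h (u p t))"
proof (induction n arbitrary: u)
  case 0 then show ?case using bounded_linear.continuous_on[OF assms] by (auto simp: split_beta)
next
  case (Suc n)
  from Suc.prems obtain a b where
    h: "Cn_family n a" "Cn_family n b" "has_space_derivative u a" "has_time_derivative u b" by auto
  have "continuous_on (UNIV \<times> {0..}) (\<lambda>(p, t). h (u p t))"
    using Suc.prems bounded_linear.continuous_on[OF assms] by (auto simp: split_beta)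
  then show ?case unfolding Cn_family.simps
    by (intro conjI exI[of _ "\<lambda>p t. h (a p t)"] exI[of _ "\<lambda>p t. h (b p t)"] Suc.IH h)
       (use h in \<open>auto intro!: bounded_linear.has_vector_derivative[OF assms]\<close>)
qed

lemma Cn_family_mult:
  fixes u w :: "real \<Rightarrow> real \<Rightarrow> 'a::real_normed_algebra"
  shows "Cn_family n u \<Longrightarrow> Cn_family n w \<Longrightarrow> Cn_family n (\<lambda>p t. u p t * w p t)"
proof (induction n arbitrary: u w)
  case 0 then show ?case by (auto simp: split_beta intro!: continuous_intros)
next
  case (Suc n)
  from Suc.prems obtain a b a' b' where
    h: "Cn_family n a" "Cn_family n b" "has_space_derivative u a" "has_time_derivative u b"
     "Cn_family n a'" "Cn_family n b'" "has_space_derivative w a'" "has_time_derivative w b'" by auto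
  have uw: "Cn_family n u" "Cn_family n w" using Suc.prems Cn_family_mono by blast+
  have "continuous_on (UNIV \<times> {0..}) (\<lambda>(p, t). u p t * w p t)"
    using Suc.prems by (auto simp: split_beta intro!: continuous_intros)
  then show ?case unfolding Cn_family.simps
    by (intro conjI exI[of _ "\<lambda>p t. u p t * a' p t + a p t * w p t"]
          exI[of _ "\<lambda>p t. u p t * b' p t + b p t * w p t"] Suc.IH Cn_family_add h uw)
       (use h in \<open>auto intro!: has_vector_derivative_mult\<close>)
qed

lemma has_vector_derivative_inverse_real:
  fixes f :: "real \<Rightarrow> real"
  assumes "(f has_vector_derivative f') (at x within S)" "f x \<noteq> 0"
  shows "((\<lambda>x. inverse (f x)) has_vector_derivative (- 1) * (inverse (f x) * f' * inverse (f x))) (at x within S)"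
  using DERIV_inverse'[of f f' x S] assms by (simp add: has_real_derivative_iff_has_vector_derivative)

lemma has_vector_derivative_sqrt:
  fixes f :: "real \<Rightarrow> real"
  assumes "(f has_vector_derivative f') (at x within S)" "f x > 0"
  shows "((\<lambda>x. sqrt (f x)) has_vector_derivative (1/2) * (f' * inverse (sqrt (f x)))) (at x within S)"
proof -
  have "((\<lambda>x. sqrt (f x)) has_field_derivative (inverse (sqrt (f x)) / 2) * f') (at x within S)"
    using assms by (intro DERIV_chain'[of f f' x S sqrt] DERIV_real_sqrt)
      (simp_all add: has_real_derivative_iff_has_vector_derivative)
  then show ?thesis by (simp add: has_real_derivative_iff_has_vector_derivative mult.commute)
qed

lemma Cn_family_inverse:
  fixes u :: "real \<Rightarrow> real \<Rightarrow> real"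
  assumes nz: "\<And>p t. t \<ge> 0 \<Longrightarrow> u p t \<noteq> 0"
  shows "Cn_family n u \<Longrightarrow> Cn_family n (\<lambda>p t. inverse (u p t))"
proof (induction n)
  case 0 then show ?case by (auto simp: split_beta nz intro!: continuous_intros)
next
  case (Suc n)
  from Suc.prems obtain a b where
    h: "Cn_family n a" "Cn_family n b" "has_space_derivative u a" "has_time_derivative u b" by auto
  have I: "Cn_family n (\<lambda>p t. inverse (u p t))" using Suc Cn_family_mono by blast
  have c: "continuous_on (UNIV \<times> {0..}) (\<lambda>(p, t). inverse (u p t))"
    using Suc.prems by (auto simp: split_beta nz intro!: continuous_intros)
  then show ?case unfolding Cn_family.simps
    by (intro conjI exI[of _ "\<lambda>p t. (- 1) * (inverse (u p t) * a p t * inverse (u p t))"]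
          exI[of _ "\<lambda>p t. (- 1) * (inverse (u p t) * b p t * inverse (u p t))"]
           Cn_family_mult Cn_family_const h(1,2) I c allI impI
           has_vector_derivative_inverse_real h(3,4)[rule_format] nz)
qed

lemma Cn_family_sqrt:
  fixes u :: "real \<Rightarrow> real \<Rightarrow> real"
  assumes nz: "\<And>p t. t \<ge> 0 \<Longrightarrow> u p t > 0"
  shows "Cn_family n u \<Longrightarrow> Cn_family n (\<lambda>p t. sqrt (u p t))"
proof (induction n)
  case 0 then show ?case by (auto simp: split_beta nz intro!: continuous_intros)
next
  case (Suc n)
  from Suc.prems obtain a b where
    h: "Cn_family n a" "Cn_family n b" "has_space_derivative u a" "has_time_derivative u b" by auto
  have I: "Cn_family n (\<lambda>p t. inverse (sqrt (u p t)))"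
  proof (rule Cn_family_inverse)
    show "Cn_family n (\<lambda>p t. sqrt (u p t))" by (rule Suc.IH[OF Cn_family_mono[OF Suc.prems]])
    show "sqrt (u p t) \<noteq> 0" if "t \<ge> 0" for p t using nz[OF that, of p] by simp
  qed
  have c: "continuous_on (UNIV \<times> {0..}) (\<lambda>(p, t). sqrt (u p t))"
    using Suc.prems by (auto simp: split_beta nz intro!: continuous_intros)
  then show ?case unfolding Cn_family.simps
    by (intro conjI exI[of _ "\<lambda>p t. (1/2) * (a p t * inverse (sqrt (u p t)))"]
          exI[of _ "\<lambda>p t. (1/2) * (b p t * inverse (sqrt (u p t)))"]
           Cn_family_mult Cn_family_const h(1,2) I c allI impI
           has_vector_derivative_sqrt h(3,4)[rule_format] nz)
qed

lemma has_space_derivative_unique: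
  assumes "has_space_derivative u a" "has_space_derivative u a'" "t \<ge> 0"
  shows "a p t = a' p t"
  using assms vector_derivative_unique_at by blast

lemma has_time_derivative_unique:
  fixes u :: "real \<Rightarrow> real \<Rightarrow> 'a::euclidean_space"
  assumes "has_time_derivative u a" "has_time_derivative u a'" "t \<ge> 0"
  shows "a p t = a' p t"
  using assms vector_derivative_unique_Ici by blast

lemma Cinf_family_space_derivative:
  assumes u: "Cinf_family u" and a: "has_space_derivative u a"
  shows "Cinf_family a"
  unfolding Cinf_family_def
proof
  fix n
  obtain a' where a': "Cn_family n a'" "has_space_derivative u a'"
    using u unfolding Cinf_family_def by (metis Cn_family.simps(2))
  show "Cn_family n a"
    by (rule Cn_family_cong[OF a'(1)]) (use has_space_derivative_unique[OF a a'(2)] in simp)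
qed

lemma Cinf_family_time_derivative:
  fixes u :: "real \<Rightarrow> real \<Rightarrow> 'a::euclidean_space"
  assumes u: "Cinf_family u" and a: "has_time_derivative u a"
  shows "Cinf_family a"
  unfolding Cinf_family_def
proof
  fix n
  obtain a' where a': "Cn_family n a'" "has_time_derivative u a'"
    using u unfolding Cinf_family_def by (metis Cn_family.simps(2))
  show "Cn_family n a"
    by (rule Cn_family_cong[OF a'(1)]) (use has_time_derivative_unique[OF a a'(2)] in simp)
qed

lemma Cinf_family_derivatives_exist:
  assumes "Cinf_family u"
  shows "\<exists>a. has_space_derivative u a" "\<exists>b. has_time_derivative u b"
  using assms unfolding Cinf_family_def by (metis Cn_family.simps(2))+

lemma Cinf_family_continuous:
  "Cinf_family u \<Longrightarrow> continuous_on (UNIV \<times> {0..}) (\<lambda>(p, t). u p t)"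
  unfolding Cinf_family_def using Cn_family_continuous by blast

lemma Cinf_family_cong:
  "Cinf_family u \<Longrightarrow> (\<And>p t. t \<ge> 0 \<Longrightarrow> w p t = u p t) \<Longrightarrow> Cinf_family w"
  unfolding Cinf_family_def using Cn_family_cong by blast

lemma Cinf_family_const: "Cinf_family (\<lambda>p t. c)"
  unfolding Cinf_family_def using Cn_family_const by blast

lemma Cinf_family_add: "Cinf_family u \<Longrightarrow> Cinf_family w \<Longrightarrow> Cinf_family (\<lambda>p t. u p t + w p t)"
  and Cinf_family_linear: "bounded_linear h \<Longrightarrow> Cinf_family z \<Longrightarrow> Cinf_family (\<lambda>p t. h (z p t))"
  unfolding Cinf_family_def using Cn_family_add Cn_family_linear by blast+

lemma Cinf_family_mult:
  fixes u w :: "real \<Rightarrow> real \<Rightarrow> 'a::real_normed_algebra"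
  shows "Cinf_family u \<Longrightarrow> Cinf_family w \<Longrightarrow> Cinf_family (\<lambda>p t. u p t * w p t)"
  unfolding Cinf_family_def using Cn_family_mult by blast

lemma Cinf_family_inverse:
  fixes u :: "real \<Rightarrow> real \<Rightarrow> real"
  assumes "\<And>p t. t \<ge> 0 \<Longrightarrow> u p t \<noteq> 0" "Cinf_family u"
  shows "Cinf_family (\<lambda>p t. inverse (u p t))"
  using assms Cn_family_inverse unfolding Cinf_family_def by blast

lemma Cinf_family_sqrt:
  fixes u :: "real \<Rightarrow> real \<Rightarrow> real"
  assumes "\<And>p t. t \<ge> 0 \<Longrightarrow> u p t > 0" "Cinf_family u"
  shows "Cinf_family (\<lambda>p t. sqrt (u p t))"
  using assms Cn_family_sqrt unfolding Cinf_family_def by blast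

lemma Cinf_family_if_smooth_family:
  assumes "smooth_family F"
  shows "Cinf_family F"
proof -
  from assms obtain D :: "nat \<Rightarrow> nat \<Rightarrow> real \<Rightarrow> real \<Rightarrow> complex" where D: "D 0 0 = F"
    "\<And>j k. continuous_on (UNIV \<times> {0..}) (\<lambda>(p, t). D j k p t)"
    "\<And>j k. has_space_derivative (D j k) (D (Suc j) k)" "\<And>j k. has_time_derivative (D j k) (D j (Suc k))"
    unfolding smooth_family_def by blast
  have "Cn_family n (D j k)" for n j k
  proof (induction n arbitrary: j k)
    case (Suc n)
    show ?case unfolding Cn_family.simps using D(2,3,4) Suc by blast
  qed (use D(2) in simp)
  then show ?thesis unfolding Cinf_family_def using D(1) by metis
qed

lemma continuous_on_slice:
  assumes "continuous_on (UNIV \<times> {0..}) (\<lambda>(p, t). u p t)" "t \<ge> (0::real)"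
  shows "continuous_on S (\<lambda>p. u p t)"
proof -
  have "continuous_on S (\<lambda>p. (p, t))" "(\<lambda>p. (p, t)) ` S \<subseteq> UNIV \<times> {0..}"
    using assms(2) by (auto intro!: continuous_intros)
  from continuous_on_compose2[OF assms(1) this] show ?thesis by simp
qed

lemma continuous_on_time_slice:
  assumes "continuous_on (UNIV \<times> {0..}) (\<lambda>(p, t). u p t)" "S \<subseteq> {0::real..}"
  shows "continuous_on S (\<lambda>t. u p t)"
proof -
  have "continuous_on S (\<lambda>t. (p, t))" "(\<lambda>t. (p, t)) ` S \<subseteq> UNIV \<times> {0..}"
    using assms(2) by (auto intro!: continuous_intros)
  from continuous_on_compose2[OF assms(1) this] show ?thesis by simp
qed

lemma continuous_on_swap_family:
  fixes u :: "real \<Rightarrow> real \<Rightarrow> 'a::topological_space"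
  assumes "continuous_on (UNIV \<times> {0..}) (\<lambda>(p, t). u p t)"
  shows "continuous_on ({0..} \<times> S) (\<lambda>(t, p). u p t)"
proof -
  have "continuous_on ({0::real..} \<times> S) (\<lambda>z. (snd z, fst z))"
    "(\<lambda>z. (snd z, fst z)) ` ({0::real..} \<times> S) \<subseteq> UNIV \<times> {0..}"
    by (auto intro!: continuous_intros)
  from continuous_on_compose2[OF assms this] show ?thesis by (simp add: split_beta)
qed

lemma has_time_derivative_integral:
  fixes u :: "real \<Rightarrow> real \<Rightarrow> 'a::banach"
  assumes d: "has_time_derivative u b"
    and cu: "continuous_on (UNIV \<times> {0..}) (\<lambda>(p, t). u p t)"
    and c: "continuous_on (UNIV \<times> {0..}) (\<lambda>(p, t). b p t)" and t: "t \<ge> 0"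
  shows "((\<lambda>t. integral {x..y} (\<lambda>p. u p t)) has_vector_derivative integral {x..y} (\<lambda>p. b p t)) (at t within {0..})"
proof -
  have "((\<lambda>t. integral (cbox x y) (\<lambda>p. u p t)) has_vector_derivative integral (cbox x y) (\<lambda>p. b p t)) (at t within {0..})"
  proof (rule leibniz_rule_vector_derivative)
    show "(\<lambda>p. u p t) integrable_on cbox x y" if "t \<in> {0..}" for t
      using that by (auto intro!: integrable_continuous_real continuous_on_slice[OF cu])
  qed (use d t continuous_on_swap_family[OF c] in auto)
  then show ?thesis by simp
qed

text \<open>
  Schwarz's theorem up to the boundary \<open>t = 0\<close>, for which only the mixed derivative \<open>c\<close> in one order is
  given: in \<open>u p \<tau> = u p 0 + \<integral> b\<close> the space derivative is taken under the integral, and the result is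
  differentiated in time.
\<close>

lemma mixed_derivatives_commute:
  fixes u :: "real \<Rightarrow> real \<Rightarrow> 'a::euclidean_space"
  assumes a: "has_space_derivative u a" and b: "has_time_derivative u b"
    and c: "has_space_derivative b c"
    and ca: "continuous_on (UNIV \<times> {0..}) (\<lambda>(p, t). a p t)"
    and cb: "continuous_on (UNIV \<times> {0..}) (\<lambda>(p, t). b p t)"
    and cc: "continuous_on (UNIV \<times> {0..}) (\<lambda>(p, t). c p t)"
  shows "has_time_derivative a c"
proof (intro allI impI)
  fix p t :: real assume t: "t \<ge> 0"
  have incr: "u p \<tau> - u p 0 = integral {0..\<tau>} (\<lambda>s. b p s)" if "\<tau> \<ge> 0" for p \<tau>
  proof -
    have "((\<lambda>s. b p s) has_integral u p \<tau> - u p 0) {0..\<tau>}"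
      using that by (intro fundamental_theorem_of_calculus)
        (simp, rule has_vector_derivative_within_subset[OF b[rule_format]], auto)
    then show ?thesis by (simp add: integral_unique)
  qed
  have diff: "a p \<tau> - a p 0 = integral {0..\<tau>} (\<lambda>s. c p s)" if \<tau>: "\<tau> \<ge> 0" for \<tau>
  proof -
    have "((\<lambda>p. integral (cbox 0 \<tau>) (\<lambda>s. b p s)) has_vector_derivative integral (cbox 0 \<tau>) (\<lambda>s. c p s)) (at p within UNIV)"
    proof (rule leibniz_rule_vector_derivative)
      show "(\<lambda>s. b p s) integrable_on cbox 0 \<tau>" for p
        by (auto intro!: integrable_continuous_real continuous_on_time_slice[OF cb])
      show "continuous_on (UNIV \<times> cbox 0 \<tau>) (\<lambda>(x, t). c x t)"
        by (rule continuous_on_subset[OF cc]) auto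
    qed (use c in auto)
    moreover have "((\<lambda>p. integral {0..\<tau>} (\<lambda>s. b p s)) has_vector_derivative a p \<tau> - a p 0) (at p)"
      unfolding incr[OF \<tau>, symmetric] using a \<tau> by (auto intro!: has_vector_derivative_diff)
    ultimately show ?thesis using vector_derivative_unique_at by fastforce
  qed
  have "((\<lambda>\<tau>. integral {0..\<tau>} (\<lambda>s. c p s)) has_vector_derivative c p t) (at t within {0..t+1})"
    using t by (intro integral_has_vector_derivative continuous_on_time_slice[OF cc]) auto
  then have "((\<lambda>\<tau>. a p 0 + integral {0..\<tau>} (\<lambda>s. c p s)) has_vector_derivative c p t) (at t within {0..t+1})"
    by (auto intro!: derivative_eq_intros)
  then have "(a p has_vector_derivative c p t) (at t within {0..t+1})"
  proof (rule has_vector_derivative_transform[rotated 2])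
    show "a p \<tau> = a p 0 + integral {0..\<tau>} (\<lambda>s. c p s)" if "\<tau> \<in> {0..t+1}" for \<tau>
      using diff[of \<tau>] that by (simp add: diff_eq_eq)
  qed (use t in auto)
  moreover have "at t within {0..t+1} = at t within {0..}"
    by (rule at_within_nhd[of t "{..<t+1}"]) auto
  ultimately show "((\<lambda>\<tau>. a p \<tau>) has_vector_derivative c p t) (at t within {0..})" by simp
qed

section \<open>The isoperimetric deficit of a closed curve\<close>

locale unit_speed_curve =
  fixes f T :: "real \<Rightarrow> complex" and k :: "real \<Rightarrow> real" and L :: real
  assumes L_pos: "L > 0"
    and f_deriv: "\<And>s. (f has_vector_derivative T s) (at s)"
    and T_deriv: "\<And>s. (T has_vector_derivative \<i> * of_real (k s) * T s) (at s)"
    and T_unit: "\<And>s. norm (T s) = 1"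
    and f_per: "\<And>s. f (s + L) = f s" and T_per: "\<And>s. T (s + L) = T s"
    and k_cont: "continuous_on UNIV k"
begin

text \<open>
  Comparison with the circle of length \<open>L\<close>, which has curvature \<open>\<omega>\<close>. Undoing the rotation of its tangent
  turns \<open>T\<close> into \<open>twist\<close>, and \<open>centre s\<close> is the centre of the circle of curvature \<open>\<omega>\<close> that touches the
  curve at \<open>s\<close>. Both are constant on that circle; in general their derivatives are proportional to
  \<open>k - \<omega>\<close>, so that their oscillation is controlled by \<open>deviation\<close>.
\<close>

definition "\<omega> = 2 * pi / L"
definition "mean = (1 / L) *\<^sub>R integral {0..L} f"
definition "area = integral {0..L} (\<lambda>s. Im (cnj (f s) * T s)) / 2"
definition "deviation = integral {0..L} (\<lambda>s. \<bar>k s - \<omega>\<bar>)"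
definition "twist s = T s * exp (- \<i> * of_real (\<omega> * s))"
definition "centre s = f s - T s / (\<i> * of_real \<omega>)"

lemma \<omega>_pos: "\<omega> > 0" and \<omega>_L: "\<omega> * L = 2 * pi" and \<omega>_complex_nz: "\<i> * of_real \<omega> \<noteq> (0::complex)"
  using L_pos by (auto simp: \<omega>_def)

lemma f_cont: "continuous_on S f" and T_cont: "continuous_on S T"
  by (rule continuous_on_vector_derivative[OF has_vector_derivative_at_within[OF f_deriv]])
     (rule continuous_on_vector_derivative[OF has_vector_derivative_at_within[OF T_deriv]])

lemmas f_deriv_within = has_vector_derivative_at_within[OF f_deriv]
  and T_deriv_within = has_vector_derivative_at_within[OF T_deriv]

lemma k_cont': "continuous_on S k" by (rule continuous_on_subset[OF k_cont]) simp

lemma f_L: "f L = f 0" and T_L: "T L = T 0" using f_per[of 0] T_per[of 0] by auto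

lemma T_has_integral: "(T has_integral 0) {0..L}"
proof -
  have "(T has_integral f L - f 0) {0..L}"
    using L_pos by (intro fundamental_theorem_of_calculus f_deriv_within) simp
  then show ?thesis by (simp add: f_L)
qed

lemma e_L: "exp (- \<i> * of_real (\<omega> * L)) = (1::complex)"
proof -
  have "- \<i> * of_real (\<omega> * L) = - (2 * of_real pi * \<i>)" unfolding \<omega>_L by simp
  then show ?thesis by (simp only: exp_minus exp_two_pi_i inverse_1)
qed

lemma exp_vector_derivative:
  "((\<lambda>s. exp (- \<i> * of_real (\<omega> * s))) has_vector_derivative
     - \<i> * of_real \<omega> * exp (- \<i> * of_real (\<omega> * s))) (at s within S)"
proof -
  have "- \<i> * of_real (\<omega> * s) = s *\<^sub>R (- \<i> * of_real \<omega>)" for s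
    by (simp add: scaleR_conv_of_real)
  then show ?thesis
    using exp_scaleR_has_vector_derivative_right[of "- \<i> * of_real \<omega>" s S] by (simp only: mult.commute)
qed

lemma e_has_integral: "((\<lambda>s. exp (- \<i> * of_real (\<omega> * s))) has_integral (0::complex)) {0..L}"
proof -
  have "((\<lambda>s. (1 / (- \<i> * of_real \<omega>)) * exp (- \<i> * of_real (\<omega> * s))) has_vector_derivative
      (1 / (- \<i> * of_real \<omega>)) * (- \<i> * of_real \<omega> * exp (- \<i> * of_real (\<omega> * s)))) (at s within {0..L})" for s
    by (intro has_vector_derivative_mult_right exp_vector_derivative)
  moreover have "(1 / (- \<i> * of_real \<omega>)) * (- \<i> * of_real \<omega> * z) = z" for z
    using \<omega>_complex_nz by simp
  ultimately have "((\<lambda>s. exp (- \<i> * of_real (\<omega> * s))) has_integral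
      (1 / (- \<i> * of_real \<omega>)) * exp (- \<i> * of_real (\<omega> * L)) - (1 / (- \<i> * of_real \<omega>)) * exp (- \<i> * of_real (\<omega> * 0))) {0..L}"
    using L_pos by (intro fundamental_theorem_of_calculus) auto
  then show ?thesis unfolding e_L by simp
qed

lemma twist_deriv: "(twist has_vector_derivative \<i> * of_real (k s - \<omega>) * twist s) (at s)"
proof -
  have "(twist has_vector_derivative T s * (- \<i> * of_real \<omega> * exp (- \<i> * of_real (\<omega> * s)))
     + \<i> * of_real (k s) * T s * exp (- \<i> * of_real (\<omega> * s))) (at s)"
    unfolding twist_def by (intro has_vector_derivative_mult T_deriv exp_vector_derivative)
  then show ?thesis by (simp add: twist_def algebra_simps)
qed

lemma centre_deriv: "(centre has_vector_derivative - of_real ((k s - \<omega>) / \<omega>) * T s) (at s)"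
proof -
  have "(centre has_vector_derivative T s - \<i> * of_real (k s) * T s / (\<i> * of_real \<omega>)) (at s)"
    unfolding centre_def divide_inverse
    by (intro has_vector_derivative_diff f_deriv has_vector_derivative_mult_left T_deriv)
  moreover have "T s - \<i> * of_real (k s) * T s / (\<i> * of_real \<omega>) = - of_real ((k s - \<omega>) / \<omega>) * T s"
    using \<omega>_pos by (simp add: field_simps)
  ultimately show ?thesis by simp
qed

lemma twist_per: "twist (s + L) = twist s"
proof -
  have "exp (- \<i> * of_real (\<omega> * (s + L))) = exp (- \<i> * of_real (\<omega> * s)) * exp (- \<i> * of_real (\<omega> * L))"
    by (simp add: exp_add[symmetric] algebra_simps)
  then show ?thesis using e_L by (simp add: twist_def T_per)
qed

lemma centre_per: "centre (s + L) = centre s"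
  by (simp add: centre_def f_per T_per)

text \<open>By periodicity \<open>s\<close> may be taken in \<open>[0, L]\<close>, and the variation of \<open>g\<close> there is the integral of \<open>|g'|\<close>.\<close>

lemma variation_le_deviation:
  fixes g :: "real \<Rightarrow> complex"
  assumes d: "\<And>s. (g has_vector_derivative g' s) (at s)" and b: "\<And>s. norm (g' s) \<le> c * \<bar>k s - \<omega>\<bar>"
    and per: "\<And>s. g (s + L) = g s" and c: "c \<ge> 0"
  shows "norm (g s - g 0) \<le> c * deviation"
proof -
  define r where "r = L * frac (s / L)"
  have "r = s + of_int (- \<lfloor>s / L\<rfloor>) * L"
    using L_pos by (simp add: r_def frac_def field_simps)
  then have gr: "g r = g s" using periodic_int_shift[where f=g and l=L, OF per, of s "- \<lfloor>s / L\<rfloor>"] by simp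
  have r: "0 \<le> r" "r \<le> L" using L_pos frac_lt_1[of "s / L"] by (auto simp: r_def mult_left_le less_imp_le)
  have gi: "(g' has_integral g r - g 0) {0..r}"
    using r d by (intro fundamental_theorem_of_calculus) (auto simp: has_vector_derivative_at_within)
  have int: "(\<lambda>s. c * \<bar>k s - \<omega>\<bar>) integrable_on {x..y}" for x y
    by (intro integrable_continuous_real continuous_intros k_cont')
  have "norm (integral {0..r} g') \<le> integral {0..r} (\<lambda>s. c * \<bar>k s - \<omega>\<bar>)"
    using gi b int by (intro integral_norm_bound_integral) auto
  also have "\<dots> \<le> integral {0..L} (\<lambda>s. c * \<bar>k s - \<omega>\<bar>)"
    using r int c by (intro integral_subset_le) auto
  also have "\<dots> = c * deviation" by (simp add: deviation_def)
  finally show ?thesis using gi gr by (simp add: integral_unique)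
qed

lemma twist_close: "norm (twist s - T 0) \<le> deviation"
proof -
  have "norm (twist s - twist 0) \<le> 1 * deviation"
    by (rule variation_le_deviation[OF twist_deriv _ twist_per])
       (simp_all add: norm_mult twist_def T_unit del: of_real_diff)
  then show ?thesis by (simp add: twist_def)
qed

lemma centre_close_0: "norm (centre s - centre 0) \<le> deviation / \<omega>"
proof -
  have "norm (centre s - centre 0) \<le> (1 / \<omega>) * deviation"
    by (rule variation_le_deviation[OF centre_deriv _ centre_per])
       (use \<omega>_pos in \<open>simp_all add: norm_mult T_unit abs_divide del: of_real_divide of_real_diff\<close>)
  then show ?thesis by simp
qed

lemma deviation_nonneg: "deviation \<ge> 0"
  unfolding deviation_def by (intro integral_nonneg integrable_continuous_real continuous_intros k_cont') auto

lemma deviation_sq_le: "deviation\<^sup>2 \<le> L * integral {0..L} (\<lambda>s. (k s - \<omega>)\<^sup>2)"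
proof -
  have "(integral {0..L} (\<lambda>s. \<bar>k s - \<omega>\<bar> * 1 * 1))\<^sup>2
      \<le> integral {0..L} (\<lambda>s. \<bar>k s - \<omega>\<bar>\<^sup>2 * 1) * integral {0..L} (\<lambda>s. 1\<^sup>2 * 1)"
    by (rule integral_cauchy_schwarz) (auto intro!: continuous_intros k_cont')
  then show ?thesis using L_pos by (simp add: deviation_def mult.commute)
qed

lemma deviation_le:
  assumes "\<And>s. \<bar>k s - \<omega>\<bar> \<le> \<eta>"
  shows "deviation \<le> L * \<eta>"
proof -
  have "deviation \<le> integral {0..L} (\<lambda>s. \<eta>)"
    unfolding deviation_def
    by (intro integral_le integrable_continuous_real continuous_intros k_cont' assms)
  then show ?thesis using L_pos by simp
qed

lemma centre_cont: "continuous_on S centre"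
  unfolding centre_def using \<omega>_pos by (auto intro!: continuous_intros f_cont T_cont)

lemma mean_eq_mean_centre: "integral {0..L} centre = L *\<^sub>R mean"
proof -
  have "((\<lambda>s. f s - T s / (\<i> * of_real \<omega>)) has_integral (integral {0..L} f - 0 / (\<i> * of_real \<omega>))) {0..L}"
    by (intro has_integral_diff has_integral_divide T_has_integral integrable_integral
        integrable_continuous_real f_cont)
  then show ?thesis using L_pos by (simp add: centre_def[abs_def] mean_def integral_unique)
qed

lemma mean_close:
  fixes g :: "real \<Rightarrow> complex"
  assumes "continuous_on {0..L} g" "\<And>s. s \<in> {0..L} \<Longrightarrow> norm (g s - z) \<le> B"
  shows "norm ((1 / L) *\<^sub>R integral {0..L} g - z) \<le> B"
proof -
  have "integral {0..L} (\<lambda>s. g s - z) = integral {0..L} g - L *\<^sub>R z"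
    using L_pos assms(1) by (subst integral_diff) (auto intro!: integrable_continuous_real)
  moreover have "norm (integral {0..L} (\<lambda>s. g s - z)) \<le> B * (L - 0)"
    using L_pos assms by (intro integral_bound) (auto intro!: continuous_intros)
  ultimately have le: "norm (integral {0..L} g - L *\<^sub>R z) \<le> B * L" by simp
  have "(1 / L) *\<^sub>R integral {0..L} g - z = (1 / L) *\<^sub>R (integral {0..L} g - L *\<^sub>R z)"
    using L_pos by (simp add: scaleR_diff_right)
  then have "norm ((1 / L) *\<^sub>R integral {0..L} g - z) = norm (integral {0..L} g - L *\<^sub>R z) / L"
    using L_pos by simp
  then show ?thesis using L_pos le by (simp add: divide_le_eq)
qed

lemma centre_close: "norm (centre s - mean) \<le> 2 * deviation / \<omega>"
proof -
  have "norm ((1 / L) *\<^sub>R integral {0..L} centre - centre 0) \<le> deviation / \<omega>"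
    by (intro mean_close centre_cont centre_close_0)
  then have "norm (mean - centre 0) \<le> deviation / \<omega>" using L_pos by (simp add: mean_eq_mean_centre)
  with centre_close_0[of s] have "norm ((centre s - centre 0) - (mean - centre 0)) \<le> deviation / \<omega> + deviation / \<omega>"
    using norm_triangle_ineq4[of "centre s - centre 0" "mean - centre 0"] by linarith
  then show ?thesis by simp
qed

text \<open>
  The integrand is the derivative of a multiple of \<open>f s e\<^sup>-\<^sup>i\<^sup>\<omega>\<^sup>s\<close>: passing from \<open>f\<close> to \<open>centre\<close> removes
  exactly the first Fourier mode.
\<close>

lemma centre_orthogonal: "((\<lambda>s. centre s * exp (- \<i> * of_real (\<omega> * s))) has_integral 0) {0..L}"
proof -
  have "((\<lambda>s. (- 1 / (\<i> * of_real \<omega>)) * (f s * exp (- \<i> * of_real (\<omega> * s)))) has_vector_derivative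
      centre s * exp (- \<i> * of_real (\<omega> * s))) (at s within {0..L})" for s
  proof -
    have "((\<lambda>s. (- 1 / (\<i> * of_real \<omega>)) * (f s * exp (- \<i> * of_real (\<omega> * s)))) has_vector_derivative
      (- 1 / (\<i> * of_real \<omega>)) * (f s * (- \<i> * of_real \<omega> * exp (- \<i> * of_real (\<omega> * s))) + T s * exp (- \<i> * of_real (\<omega> * s)))) (at s within {0..L})"
      by (intro has_vector_derivative_mult_right has_vector_derivative_mult exp_vector_derivative
          f_deriv_within)
    also have "(- 1 / (\<i> * of_real \<omega>)) * (f s * (- \<i> * of_real \<omega> * exp (- \<i> * of_real (\<omega> * s))) + T s * exp (- \<i> * of_real (\<omega> * s)))
       = centre s * exp (- \<i> * of_real (\<omega> * s))"
      using \<omega>_pos by (simp add: centre_def field_simps)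
    finally show ?thesis .
  qed
  then have "((\<lambda>s. centre s * exp (- \<i> * of_real (\<omega> * s))) has_integral
      (- 1 / (\<i> * of_real \<omega>)) * (f L * exp (- \<i> * of_real (\<omega> * L)))
      - (- 1 / (\<i> * of_real \<omega>)) * (f 0 * exp (- \<i> * of_real (\<omega> * 0)))) {0..L}"
    using L_pos by (intro fundamental_theorem_of_calculus) auto
  then show ?thesis using e_L f_L by simp
qed

text \<open>
  Since \<open>f = centre + T / (i\<omega>)\<close> and \<open>centre\<close> has no first Fourier mode, the coefficient is the mean of
  \<open>twist\<close> divided by \<open>i\<omega>\<close>, and \<open>twist\<close> stays near its value \<open>T 0\<close> at the base point.
\<close>

lemma first_coefficient_close:
  "norm ((1 / L) *\<^sub>R integral {0..L} (\<lambda>s. f s * exp (- \<i> * of_real (\<omega> * s))) - T 0 / (\<i> * of_real \<omega>))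
     \<le> deviation / \<omega>"
proof -
  have ti: "twist integrable_on {0..L}"
    unfolding twist_def by (intro integrable_continuous_real continuous_intros T_cont)
  have "((\<lambda>s. centre s * exp (- \<i> * of_real (\<omega> * s)) + twist s / (\<i> * of_real \<omega>)) has_integral
      (0 + integral {0..L} twist / (\<i> * of_real \<omega>))) {0..L}"
    by (intro has_integral_add centre_orthogonal has_integral_divide integrable_integral ti)
  moreover have "(\<lambda>s. centre s * exp (- \<i> * of_real (\<omega> * s)) + twist s / (\<i> * of_real \<omega>))
      = (\<lambda>s. f s * exp (- \<i> * of_real (\<omega> * s)))"
    by (auto simp: centre_def twist_def algebra_simps add_divide_distrib[symmetric] diff_divide_distrib)
  ultimately have I: "integral {0..L} (\<lambda>s. f s * exp (- \<i> * of_real (\<omega> * s))) = integral {0..L} twist / (\<i> * of_real \<omega>)"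
    by (simp add: integral_unique)
  have "norm ((1 / L) *\<^sub>R integral {0..L} twist - T 0) \<le> deviation"
    unfolding twist_def[abs_def] by (intro mean_close continuous_intros T_cont) (use twist_close in \<open>simp add: twist_def\<close>)
  moreover have "(1 / L) *\<^sub>R integral {0..L} (\<lambda>s. f s * exp (- \<i> * of_real (\<omega> * s))) - T 0 / (\<i> * of_real \<omega>)
     = ((1 / L) *\<^sub>R integral {0..L} twist - T 0) / (\<i> * of_real \<omega>)"
    unfolding I by (simp add: diff_divide_distrib scaleR_conv_of_real)
  ultimately show ?thesis using \<omega>_pos by (simp add: norm_divide norm_mult divide_right_mono)
qed

text \<open>
  A reverse isoperimetric inequality: the deficit is quadratic in the deviation of the curvature. It is,
  up to a factor, the integral of the inner product of \<open>centre - centre 0\<close> with \<open>T / (i\<omega>)\<close>. As \<open>centre\<close>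
  has no first Fourier mode, the first mode \<open>T 0 e\<^sup>i\<^sup>\<omega>\<^sup>s / (i\<omega>)\<close> can be subtracted from the second factor,
  and then both factors are at most \<open>deviation / \<omega>\<close>.
\<close>

lemma isoperimetric_deficit_le: "L\<^sup>2 - 4 * pi * area \<le> L ^ 3 * integral {0..L} (\<lambda>s. (k s - \<omega>)\<^sup>2)"
proof -
  define a where "a = T 0 / (\<i> * of_real \<omega>)"
  define e where "e s = exp (- \<i> * of_real (\<omega> * s))" for s
  have ec: "continuous_on S e" for S unfolding e_def by (intro continuous_intros)
  have ee: "cnj (e s) = inverse (e s)" for s by (simp add: e_def exp_cnj exp_minus)
  \<comment> \<open>The area appears through \<open>f\<close>, the length through \<open>|T| = 1\<close>.\<close>
  have inner_T: "integral {0..L} (\<lambda>s. (centre s - centre 0) \<bullet> (T s / (\<i> * of_real \<omega>))) = 2 * area / \<omega> - L / \<omega>\<^sup>2"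
  proof -
    have p: "(centre s - centre 0) \<bullet> (T s / (\<i> * of_real \<omega>))
        = (Im (cnj (f s) * T s) / \<omega> - 1 / \<omega>\<^sup>2) - centre 0 \<bullet> (T s / (\<i> * of_real \<omega>))" for s
    proof -
      have u: "(Re (T s))\<^sup>2 + (Im (T s))\<^sup>2 = 1" using T_unit[of s] by (simp add: cmod_def)
      have t: "T s / (\<i> * of_real \<omega>) = Complex (Im (T s) / \<omega>) (- Re (T s) / \<omega>)"
        using \<omega>_pos by (simp add: complex_eq_iff Re_divide Im_divide power2_eq_square)
      have tt: "(T s / (\<i> * of_real \<omega>)) \<bullet> (T s / (\<i> * of_real \<omega>)) = 1 / \<omega>\<^sup>2"
        unfolding t inner_complex_def using u
        by (simp add: add_divide_distrib[symmetric] power2_eq_square[symmetric] add.commute power_divide)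
      have "f s \<bullet> (T s / (\<i> * of_real \<omega>)) = Im (cnj (f s) * T s) / \<omega>"
        unfolding t inner_complex_def by (simp add: field_simps diff_divide_distrib)
      then show ?thesis by (simp add: centre_def[of s] inner_diff_left tt)
    qed
    have z: "((\<lambda>s. centre 0 \<bullet> (T s / (\<i> * of_real \<omega>))) has_integral centre 0 \<bullet> (0 / (\<i> * of_real \<omega>))) {0..L}"
      using has_integral_linear[OF has_integral_divide[OF T_has_integral] bounded_linear_inner_right]
      by (simp add: o_def)
    have "((\<lambda>s. (Im (cnj (f s) * T s) / \<omega> - 1 / \<omega>\<^sup>2) - centre 0 \<bullet> (T s / (\<i> * of_real \<omega>))) has_integral
       ((2 * area) / \<omega> - (L - 0) *\<^sub>R (1 / \<omega>\<^sup>2)) - centre 0 \<bullet> (0 / (\<i> * of_real \<omega>))) {0..L}"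
      using L_pos has_integral_const_real[of "1 / \<omega>\<^sup>2" 0 L]
      by (intro has_integral_diff z has_integral_divide)
         (auto simp: area_def intro!: integrable_integral integrable_continuous_real continuous_intros f_cont T_cont)
    then show ?thesis unfolding p by (simp add: integral_unique)
  qed
  \<comment> \<open>Subtracting \<open>a * cnj (e s)\<close> does not change the integral.\<close>
  have inner_e: "integral {0..L} (\<lambda>s. (centre s - centre 0) \<bullet> (a * cnj (e s))) = 0"
  proof -
    have "((\<lambda>s. centre s * e s - centre 0 * e s) has_integral (0 - centre 0 * 0)) {0..L}"
      using centre_orthogonal e_has_integral unfolding e_def[symmetric]
      by (intro has_integral_diff has_integral_mult_right)
    from has_integral_linear[OF this bounded_linear_inner_left[of a]]
    have "((\<lambda>s. (centre s * e s - centre 0 * e s) \<bullet> a) has_integral 0) {0..L}" by (simp add: o_def)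
    moreover have "(centre s * e s - centre 0 * e s) \<bullet> a = (centre s - centre 0) \<bullet> (a * cnj (e s))" for s
      by (simp add: inner_complex_def algebra_simps)
    ultimately show ?thesis by (simp add: integral_unique)
  qed
  have "\<bar>integral {0..L} (\<lambda>s. (centre s - centre 0) \<bullet> (T s / (\<i> * of_real \<omega>) - a * cnj (e s)))\<bar>
     \<le> (deviation / \<omega> * (deviation / \<omega>)) * (L - 0)"
  proof -
    have "\<bar>(centre s - centre 0) \<bullet> (T s / (\<i> * of_real \<omega>) - a * cnj (e s))\<bar> \<le> deviation / \<omega> * (deviation / \<omega>)" for s
    proof -
      have nz: "e s \<noteq> 0" by (simp add: e_def)
      have n1: "norm (e s) = 1" by (simp add: e_def)
      have "(twist s - T 0) * cnj (e s) = T s * (e s * cnj (e s)) - T 0 * cnj (e s)"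
        by (simp add: twist_def e_def algebra_simps)
      also have "\<dots> = T s - T 0 * cnj (e s)" using nz unfolding ee by simp
      finally have "T s / (\<i> * of_real \<omega>) - a * cnj (e s) = (twist s - T 0) * cnj (e s) / (\<i> * of_real \<omega>)"
        by (simp add: a_def diff_divide_distrib)
      then have "norm (T s / (\<i> * of_real \<omega>) - a * cnj (e s)) = norm (twist s - T 0) / \<omega>"
        using \<omega>_pos by (simp add: norm_mult norm_divide n1)
      also have "\<dots> \<le> deviation / \<omega>" using twist_close \<omega>_pos by (simp add: divide_right_mono)
      finally show ?thesis
        using Cauchy_Schwarz_ineq2[of "centre s - centre 0"] centre_close_0[of s]
        by (meson mult_mono norm_ge_zero order_trans)
    qed
    then have "norm (integral {0..L} (\<lambda>s. (centre s - centre 0) \<bullet> (T s / (\<i> * of_real \<omega>) - a * cnj (e s))))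
      \<le> (deviation / \<omega> * (deviation / \<omega>)) * (L - 0)"
      using L_pos by (intro integral_bound) (auto intro!: continuous_intros centre_cont T_cont ec simp: less_imp_neq[OF \<omega>_pos, symmetric])
    then show ?thesis by simp
  qed
  moreover have "integral {0..L} (\<lambda>s. (centre s - centre 0) \<bullet> (T s / (\<i> * of_real \<omega>) - a * cnj (e s)))
     = 2 * area / \<omega> - L / \<omega>\<^sup>2"
    unfolding inner_diff_right
    by (subst integral_diff; (intro integrable_continuous_real continuous_intros centre_cont T_cont ec)?)
       (auto simp: inner_T inner_e less_imp_neq[OF \<omega>_pos, symmetric])
  ultimately have "\<bar>2 * area / \<omega> - L / \<omega>\<^sup>2\<bar> \<le> (deviation / \<omega> * (deviation / \<omega>)) * L"
    by (simp only: diff_zero)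
  then have "L / \<omega>\<^sup>2 - 2 * area / \<omega> \<le> (deviation / \<omega> * (deviation / \<omega>)) * L" by linarith
  then have "\<omega>\<^sup>2 * (L / \<omega>\<^sup>2 - 2 * area / \<omega>) \<le> \<omega>\<^sup>2 * ((deviation / \<omega> * (deviation / \<omega>)) * L)"
    by (intro mult_left_mono) auto
  then have "L - 2 * area * \<omega> \<le> deviation\<^sup>2 * L"
    using \<omega>_pos by (simp add: right_diff_distrib power2_eq_square mult_ac)
  then have "L * (L - 2 * area * \<omega>) \<le> L * (deviation\<^sup>2 * L)" using L_pos by simp
  also have "L * (L - 2 * area * \<omega>) = L\<^sup>2 - 4 * pi * area"
    using \<omega>_L by (simp add: power2_eq_square algebra_simps)
  also have "L * (deviation\<^sup>2 * L) \<le> L * ((L * integral {0..L} (\<lambda>s. (k s - \<omega>)\<^sup>2)) * L)"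
    using deviation_sq_le L_pos by (intro mult_left_mono mult_right_mono) auto
  finally show ?thesis by (simp add: power3_eq_cube mult_ac)
qed

text \<open>
  Lax's proof. A motion puts two points that halve the length on the real axis, so that the ordinate \<open>y\<close>
  vanishes at \<open>0\<close>, \<open>L / 2\<close> and \<open>L\<close>. Twice the area is \<open>- 2 \<integral> y x'\<close>, which by the arithmetic-geometric mean
  inequality and \<open>x'\<^sup>2 = 1 - y'\<^sup>2\<close> is at most \<open>L / \<omega> + \<omega> \<integral> y\<^sup>2 - \<integral> y'\<^sup>2 / \<omega>\<close>; Wirtinger's inequality on both
  halves bounds this by \<open>L / \<omega>\<close>.
\<close>

lemma isoperimetric_inequality: "4 * pi * area \<le> L\<^sup>2"
proof -
  define P where "P = f 0"
  define Q where "Q = f (L / 2)"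
  \<comment> \<open>The rotation that makes the chord \<open>Q - P\<close> real; the identity if the chord degenerates.\<close>
  define u where "u = (if Q = P then 1 else cnj (sgn (Q - P)))"
  have u1: "norm u = 1" by (simp add: u_def norm_sgn)
  have uQ: "Im (u * (Q - P)) = 0"
    by (simp add: u_def sgn_eq add_divide_distrib[symmetric] algebra_simps)
  define x where "x s = Re (u * (f s - P))" for s
  define y where "y s = Im (u * (f s - P))" for s
  define x' where "x' s = Re (u * T s)" for s
  define y' where "y' s = Im (u * T s)" for s
  have gd: "((\<lambda>s. u * (f s - P)) has_vector_derivative u * T s) (at s)" for s
    by (auto intro!: derivative_eq_intros f_deriv)
  have dx: "(x has_vector_derivative x' s) (at s)" for s
    unfolding x_def x'_def by (rule bounded_linear.has_vector_derivative[OF bounded_linear_Re gd])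
  have dy: "(y has_vector_derivative y' s) (at s)" for s
    unfolding y_def y'_def by (rule bounded_linear.has_vector_derivative[OF bounded_linear_Im gd])
  have cx: "continuous_on S x" "continuous_on S y" "continuous_on S x'" "continuous_on S y'" for S
    unfolding x_def y_def x'_def y'_def by (intro continuous_intros f_cont T_cont)+
  have xy1: "(x' s)\<^sup>2 + (y' s)\<^sup>2 = 1" for s
    using cmod_power2[of "u * T s"] by (simp add: x'_def y'_def norm_mult u1 T_unit)
  have y0: "y 0 = 0" "y L = 0" "y (L / 2) = 0" using uQ by (auto simp: y_def P_def Q_def f_L)
  have A: "integral {0..L} (\<lambda>s. x s * y' s - y s * x' s) = 2 * area"
  proof -
    have "x s * y' s - y s * x' s = Im (cnj (f s) * T s) - Im (cnj P * T s)" for s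
    proof -
      have "x s * y' s - y s * x' s = Im (cnj (u * (f s - P)) * (u * T s))"
        by (simp add: x_def y_def x'_def y'_def algebra_simps)
      also have "cnj (u * (f s - P)) * (u * T s) = (u * cnj u) * (cnj (f s - P) * T s)" by (simp add: mult_ac)
      also have "u * cnj u = 1" using u1 complex_norm_square[of u] by simp
      finally show ?thesis by (simp add: algebra_simps)
    qed
    moreover have "((\<lambda>s. Im (cnj (f s) * T s) - Im (cnj P * T s)) has_integral 2 * area - 0) {0..L}"
    proof (rule has_integral_diff)
      show "((\<lambda>s. Im (cnj P * T s)) has_integral 0) {0..L}"
        using has_integral_linear[OF has_integral_mult_right[OF T_has_integral, of "cnj P"] bounded_linear_Im]
        by (simp add: o_def)
      show "((\<lambda>s. Im (cnj (f s) * T s)) has_integral 2 * area) {0..L}"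
        by (auto simp: area_def intro!: integrable_integral integrable_continuous_real continuous_intros f_cont T_cont)
    qed
    ultimately show ?thesis by (simp add: integral_unique)
  qed
  \<comment> \<open>An exact derivative, subtracted to remove \<open>x\<close> from the area integral.\<close>
  have B: "integral {0..L} (\<lambda>s. x s * y' s + x' s * y s) = 0"
  proof -
    have "((\<lambda>s. x s * y' s + x' s * y s) has_integral x L * y L - x 0 * y 0) {0..L}"
      using L_pos by (intro fundamental_theorem_of_calculus has_vector_derivative_mult
          dx[THEN has_vector_derivative_at_within] dy[THEN has_vector_derivative_at_within]) auto
    then show ?thesis using y0 by (simp add: integral_unique)
  qed
  have "2 * area = integral {0..L} (\<lambda>s. x s * y' s - y s * x' s) - integral {0..L} (\<lambda>s. x s * y' s + x' s * y s)"
    using A B by simp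
  also have "\<dots> = integral {0..L} (\<lambda>s. - 2 * (y s * x' s))"
    by (subst integral_diff[symmetric])
       (auto intro!: integrable_continuous_real continuous_intros cx integral_cong simp: algebra_simps)
  also have "\<dots> \<le> integral {0..L} (\<lambda>s. \<omega> * (y s)\<^sup>2 + (1 - (y' s)\<^sup>2) / \<omega>)"
  proof (intro integral_le integrable_continuous_real continuous_intros cx)
    fix s
    have "0 \<le> (\<omega> * y s + x' s)\<^sup>2 / \<omega>" using \<omega>_pos by simp
    also have "\<dots> = \<omega> * (y s)\<^sup>2 + (x' s)\<^sup>2 / \<omega> + 2 * (y s * x' s)"
      using \<omega>_pos by (simp add: field_simps power2_eq_square)
    finally have nn: "0 \<le> \<omega> * (y s)\<^sup>2 + (x' s)\<^sup>2 / \<omega> + 2 * (y s * x' s)" .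
    have e: "1 - (y' s)\<^sup>2 = (x' s)\<^sup>2" using xy1[of s] by linarith
    show "- 2 * (y s * x' s) \<le> \<omega> * (y s)\<^sup>2 + (1 - (y' s)\<^sup>2) / \<omega>"
      using nn unfolding e by linarith
  qed (use \<omega>_pos in auto)
  also have "\<dots> = \<omega> * integral {0..L} (\<lambda>s. (y s)\<^sup>2) + (L - integral {0..L} (\<lambda>s. (y' s)\<^sup>2)) / \<omega>"
  proof -
    have "integral {0..L} (\<lambda>s. 1 - (y' s)\<^sup>2) = L - integral {0..L} (\<lambda>s. (y' s)\<^sup>2)"
      using L_pos by (subst integral_diff; (intro integrable_continuous_real continuous_intros cx)?) simp
    then show ?thesis
      by (subst integral_add; (intro integrable_continuous_real continuous_intros cx)?)
         (simp_all add: integral_divide less_imp_neq[OF \<omega>_pos, symmetric])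
  qed
  also have "\<dots> \<le> L / \<omega>"
  proof -
    \<comment> \<open>On an interval of length \<open>L / 2\<close> the critical frequency is exactly \<open>\<omega>\<close>.\<close>
    have h: "\<omega>\<^sup>2 * integral {a..b} (\<lambda>s. (y s)\<^sup>2) \<le> integral {a..b} (\<lambda>s. (y' s)\<^sup>2)"
      if "y a = 0" "y b = 0" "b - a = L / 2" for a b
    proof -
      have "(pi / (b - a))\<^sup>2 * integral {a..b} (\<lambda>x. (y x)\<^sup>2) \<le> integral {a..b} (\<lambda>x. (y' x)\<^sup>2)"
        using that L_pos by (intro wirtinger_dirichlet cx dy[THEN has_vector_derivative_at_within]) auto
      then show ?thesis using that by (simp add: \<omega>_def mult.commute)
    qed
    have s: "integral {0..L} g = integral {0..L/2} g + integral {L/2..L} g" if "continuous_on {0..L} g"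
      for g :: "real \<Rightarrow> real"
      using L_pos that by (intro Henstock_Kurzweil_Integration.integral_combine[symmetric] integrable_continuous_real) auto
    have "\<omega>\<^sup>2 * integral {0..L} (\<lambda>s. (y s)\<^sup>2) \<le> integral {0..L} (\<lambda>s. (y' s)\<^sup>2)"
      using h[of 0 "L/2"] h[of "L/2" L] y0 by (subst (1 2) s) (auto intro!: continuous_intros cx simp: distrib_left)
    then show ?thesis using \<omega>_pos by (simp add: field_simps power2_eq_square)
  qed
  finally show ?thesis using L_pos by (simp add: \<omega>_def field_simps power2_eq_square)
qed

end

section \<open>Parametrization by arc length\<close>

locale immersed_closed_curve =
  fixes g g' :: "real \<Rightarrow> complex"
  assumes g_deriv: "\<And>x. (g has_vector_derivative g' x) (at x)"
    and g'_cont: "continuous_on UNIV g'" and g'_nz: "\<And>x. g' x \<noteq> 0" and g_per: "\<And>x. g (x + 1) = g x"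
begin

lemma vector_derivative_g: "vector_derivative g (at x) = g' x"
  by (rule vector_derivative_at[OF g_deriv])

lemma g'_per: "g' (x + 1) = g' x"
  using periodic_vector_derivative[OF g_deriv g_per] .

lemma g'_cont': "continuous_on S g'" by (rule continuous_on_subset[OF g'_cont]) simp

lemma arc_length_deriv: "(arc_length g has_real_derivative norm (g' p)) (at p)"
proof -
  define b where "b = \<bar>p\<bar> + 1"
  have "((\<lambda>u. LBINT y=ereal 0..ereal u. norm (g' y)) has_vector_derivative norm (g' p)) (at p within {-b..b})"
    by (rule interval_integral_FTC2) (auto simp: b_def intro!: continuous_intros g'_cont')
  moreover have "at p within {-b..b} = at p"
    by (rule at_within_interior) (auto simp: b_def)
  ultimately show ?thesis
    by (simp add: arc_length_def[abs_def] vector_derivative_g has_real_derivative_iff_has_vector_derivative)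
qed

lemma arc_length_0: "arc_length g 0 = 0"
  by (simp add: arc_length_def interval_integral_endpoints_same)

lemma arc_length_1: "arc_length g 1 = curve_length g"
proof -
  have "((\<lambda>p. norm (g' p)) has_integral arc_length g 1 - arc_length g 0) {0..1}"
    by (intro fundamental_theorem_of_calculus)
       (auto simp: has_real_derivative_iff_has_vector_derivative[symmetric]
         intro: has_field_derivative_at_within[OF arc_length_deriv])
  then show ?thesis by (simp add: arc_length_0 curve_length_def vector_derivative_g integral_unique)
qed

lemma arc_length_shift: "arc_length g (p + 1) = arc_length g p + curve_length g"
proof -
  have "((\<lambda>p. arc_length g (p + 1) - arc_length g p) has_real_derivative 0) (at p)" for p
  proof -
    have "((\<lambda>p. arc_length g (p + 1)) has_real_derivative norm (g' (p + 1)) * 1) (at p)"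
      by (rule DERIV_chain'[of "\<lambda>p. p + 1" 1 p UNIV "arc_length g"])
         (auto intro!: derivative_eq_intros arc_length_deriv)
    from DERIV_diff[OF this arc_length_deriv[of p]] show ?thesis by (simp add: g'_per)
  qed
  then have "arc_length g (p + 1) - arc_length g p = arc_length g (0 + 1) - arc_length g 0"
    by (intro DERIV_isconst_all) blast
  then show ?thesis by (simp add: arc_length_0 arc_length_1)
qed

lemma arc_length_less: "x < y \<Longrightarrow> arc_length g x < arc_length g y"
  using DERIV_pos_imp_increasing[of x y "arc_length g"] arc_length_deriv g'_nz by (metis zero_less_norm_iff)

lemma curve_length_pos: "curve_length g > 0"
  using arc_length_less[of 0 1] by (simp add: arc_length_0 arc_length_1)

lemma arc_length_cont: "continuous_on S (arc_length g)"
  by (rule DERIV_continuous_on[OF has_field_derivative_at_within[OF arc_length_deriv]])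

lemma arc_length_inj: "inj (arc_length g)"
  by (rule linorder_injI) (metis arc_length_less less_irrefl)

lemma arc_length_of_int: "arc_length g (of_int n) = of_int n * curve_length g"
proof -
  define h where "h x = arc_length g x - x * curve_length g" for x
  have "h (0 + of_int n * 1) = h 0"
    by (rule periodic_int_shift) (simp add: h_def arc_length_shift algebra_simps)
  then show ?thesis by (simp add: h_def arc_length_0)
qed

text \<open>The arc length of whole periods is unbounded in both directions.\<close>

lemma arc_length_surj: "surj (arc_length g)"
  unfolding surj_def
proof
  fix y
  define n where "n = \<lfloor>y / curve_length g\<rfloor>"
  have "arc_length g (of_int n) \<le> y"
    using curve_length_pos of_int_floor_le[of "y / curve_length g"]
    by (simp add: arc_length_of_int n_def pos_le_divide_eq[symmetric])
  moreover have "y \<le> arc_length g (of_int (n + 1))"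
  proof -
    have "y / curve_length g \<le> of_int (n + 1)" unfolding n_def by linarith
    then have "y / curve_length g * curve_length g \<le> of_int (n + 1) * curve_length g"
      using curve_length_pos by (intro mult_right_mono) auto
    then show ?thesis unfolding arc_length_of_int using curve_length_pos by simp
  qed
  ultimately show "\<exists>x. y = arc_length g x"
    using IVT'[of "arc_length g" "of_int n" y "of_int (n + 1)"] arc_length_cont by auto
qed

definition "param = inv (arc_length g)"

lemma arc_length_param_inverse: "arc_length g (param s) = s"
  unfolding param_def by (rule surj_f_inv_f[OF arc_length_surj])

lemma param_arc_length: "param (arc_length g p) = p"
  unfolding param_def by (rule inv_f_f[OF arc_length_inj])

lemma param_0: "param 0 = 0" using param_arc_length[of 0] by (simp add: arc_length_0)

lemma param_shift: "param (s + curve_length g) = param s + 1"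
proof -
  have "s + curve_length g = arc_length g (param s + 1)"
    by (simp add: arc_length_shift arc_length_param_inverse)
  then show ?thesis by (simp add: param_arc_length)
qed

lemma param_deriv: "(param has_real_derivative 1 / norm (g' (param s))) (at s)"
proof -
  have nz: "norm (g' (param s)) \<noteq> 0" using g'_nz by simp
  show ?thesis unfolding has_field_derivative_def
  proof (rule has_derivative_inverse_strong_x[of UNIV _ _ "arc_length g" "(*) (norm (g' (param s)))"])
    show "(arc_length g has_derivative (*) (norm (g' (param s)))) (at (param s))"
      using arc_length_deriv by (simp add: has_field_derivative_def)
  qed (use nz in \<open>auto simp: arc_length_cont param_arc_length arc_length_param_inverse fun_eq_iff\<close>)
qed

lemma compose_param_deriv:
  fixes h :: "real \<Rightarrow> 'a::real_normed_vector"
  assumes "\<And>p. (h has_vector_derivative norm (g' p) *\<^sub>R h' p) (at p)"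
  shows "((\<lambda>s. h (param s)) has_vector_derivative h' (param s)) (at s)"
proof -
  have nz: "norm (g' (param s)) \<noteq> 0" using g'_nz by simp
  have "(h \<circ> param has_vector_derivative (1 / norm (g' (param s))) *\<^sub>R (norm (g' (param s)) *\<^sub>R h' (param s))) (at s)"
    by (rule vector_diff_chain_at[OF _ assms])
       (use param_deriv in \<open>simp add: has_real_derivative_iff_has_vector_derivative\<close>)
  then show ?thesis using nz by (simp add: o_def)
qed

lemma param_cont: "continuous_on S param"
  by (rule DERIV_continuous_on[OF has_field_derivative_at_within[OF param_deriv]])

lemma integral_arc_length:
  fixes H :: "real \<Rightarrow> 'a::euclidean_space"
  assumes "continuous_on UNIV H"
  shows "integral {0..curve_length g} H = integral {0..1} (\<lambda>p. norm (g' p) *\<^sub>R H (arc_length g p))"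
proof -
  have mono: "arc_length g x \<le> arc_length g y" if "x \<le> y" for x y
    using arc_length_less[of x y] that by (cases "x = y") auto
  have "((\<lambda>p. norm (g' p) *\<^sub>R H (arc_length g p)) has_integral integral {arc_length g 0..arc_length g 1} H) {0..1}"
    by (rule has_integral_substitution[where c="arc_length g 0" and d="arc_length g 1"])
       (auto intro!: mono continuous_on_subset[OF assms] has_field_derivative_at_within[OF arc_length_deriv])
  then show ?thesis by (simp add: arc_length_0 arc_length_1 integral_unique)
qed

lemma integral_param:
  fixes h :: "real \<Rightarrow> 'a::euclidean_space"
  assumes "continuous_on UNIV h"
  shows "integral {0..curve_length g} (\<lambda>s. h (param s)) = integral {0..1} (\<lambda>p. norm (g' p) *\<^sub>R h p)"
proof -
  have "continuous_on UNIV (\<lambda>s. h (param s))"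
    by (rule continuous_on_compose2[OF assms param_cont]) simp
  from integral_arc_length[OF this] show ?thesis by (simp add: param_arc_length)
qed

end

section \<open>Convex regions bounded by perturbed circles\<close>

definition circ :: "real \<Rightarrow> complex" where "circ \<theta> = exp (\<i> * of_real (2 * pi * \<theta>))"

lemma circ_norm: "norm (circ \<theta>) = 1" by (simp add: circ_def)

lemma circ_Complex: "circ \<theta> = Complex (cos (2 * pi * \<theta>)) (sin (2 * pi * \<theta>))"
  unfolding circ_def cis_conv_exp[symmetric] by (simp add: complex_eq_iff)

lemma circ_deriv: "(circ has_vector_derivative 2 * of_real pi * \<i> * circ \<theta>) (at \<theta>)"
proof -
  have "\<i> * of_real (2 * pi * \<theta>) = \<theta> *\<^sub>R (2 * of_real pi * \<i>)" for \<theta>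
    by (simp add: scaleR_conv_of_real mult_ac)
  then show ?thesis unfolding circ_def[abs_def]
    using exp_scaleR_has_vector_derivative_right[of "2 * of_real pi * \<i>" \<theta> UNIV] by (simp only: mult.commute)
qed

lemma circ_per: "circ (\<theta> + 1) = circ \<theta>"
  by (simp add: circ_Complex complex_eq_iff distrib_left sin_add cos_add)

lemma circ_surj: "norm w = 1 \<Longrightarrow> \<exists>\<theta>. circ \<theta> = w"
proof -
  assume w: "norm w = 1"
  then have "w \<noteq> 0" by auto
  then have "cis (Arg w) = w" using cis_Arg[of w] w by (simp add: sgn_eq)
  then show ?thesis by (intro exI[of _ "Arg w / (2 * pi)"]) (simp add: circ_def cis_conv_exp)
qed

lemma circ_inner: "circ \<theta> \<bullet> circ \<phi> = cos (2 * pi * (\<theta> - \<phi>))"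
  by (simp add: circ_Complex inner_complex_def right_diff_distrib cos_diff)

text \<open>
  The curve is a circle of radius \<open>R\<close> perturbed by \<open>g\<close>, small in \<open>C\<^sup>2\<close>; smallness of two derivatives is what
  makes the curvature positive. The region is the interior of the convex hull of the curve; the point is to show
  that the curve is the whole boundary of its hull.
\<close>

locale near_circle =
  fixes c :: complex and R \<epsilon> :: real and g g' g'' :: "real \<Rightarrow> complex"
  assumes R: "R > 0" and small: "\<epsilon> \<le> R / 4"
    and g_deriv: "\<And>x. (g has_vector_derivative g' x) (at x)"
    and g'_deriv: "\<And>x. (g' has_vector_derivative g'' x) (at x)"
    and g_le: "\<And>x. norm (g x) \<le> \<epsilon>" and g'_le: "\<And>x. norm (g' x) \<le> \<epsilon>" and g''_le: "\<And>x. norm (g'' x) \<le> \<epsilon>"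
    and g_per: "\<And>x. g (x + 1) = g x"
begin

text \<open>\<open>normal\<close> is the inner normal, of the length of the tangent.\<close>

definition "\<gamma> \<theta> = c + R *\<^sub>R circ \<theta> + g \<theta>"
definition "\<gamma>' \<theta> = R *\<^sub>R (2 * of_real pi * \<i> * circ \<theta>) + g' \<theta>"
definition "normal \<theta> = \<i> * \<gamma>' \<theta>"
definition "body = convex hull (range \<gamma>)"

lemma eps: "\<epsilon> \<ge> 0" using g_le[of 0] norm_ge_zero order_trans by blast

lemma \<gamma>_per: "\<gamma> (\<theta> + 1) = \<gamma> \<theta>" by (simp add: \<gamma>_def circ_per g_per)

lemma \<gamma>_deriv: "(\<gamma> has_vector_derivative \<gamma>' \<theta>) (at \<theta>)"
proof -
  have "((\<lambda>\<theta>. c + R *\<^sub>R circ \<theta> + g \<theta>) has_vector_derivative 0 + R *\<^sub>R (2 * of_real pi * \<i> * circ \<theta>) + g' \<theta>) (at \<theta>)"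
    by (intro has_vector_derivative_add has_vector_derivative_const g_deriv
        bounded_linear.has_vector_derivative[OF bounded_linear_scaleR_right] circ_deriv)
  then show ?thesis by (simp add: \<gamma>_def[abs_def] \<gamma>'_def)
qed

lemma i_inner: "x \<bullet> (\<i> * x) = 0" for x :: complex
  by (simp add: inner_complex_def)

text \<open>
  The curve lies strictly on the inner side of its tangents. For the circle the inner product is
  \<open>2 \<pi> R\<^sup>2 (1 - cos (2 \<pi> (\<theta> - \<theta>\<^sub>0)))\<close>, which is at least \<open>16 \<pi> R\<^sup>2 (\<theta> - \<theta>\<^sub>0)\<^sup>2\<close> over half a period. The
  terms with \<open>g\<close> form a function \<open>\<phi>\<close> that vanishes to second order at \<open>\<theta>\<^sub>0\<close>, because the tangent is
  orthogonal to the normal, and whose second derivative is bounded by \<open>M < 16 \<pi> R\<^sup>2\<close>.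
\<close>

lemma support_local:
  assumes x: "\<bar>\<theta> - \<theta>\<^sub>0\<bar> \<le> 1 / 2" "\<theta> \<noteq> \<theta>\<^sub>0"
  shows "(\<gamma> \<theta> - \<gamma> \<theta>\<^sub>0) \<bullet> normal \<theta>\<^sub>0 > 0"
proof -
  define n where "n = normal \<theta>\<^sub>0"
  define a where "a = \<i> * g' \<theta>\<^sub>0"
  have n: "n = - ((2 * pi * R) *\<^sub>R circ \<theta>\<^sub>0) + a"
    by (simp add: n_def normal_def \<gamma>'_def a_def scaleR_conv_of_real algebra_simps)
  define \<phi> where "\<phi> x = R * (circ x \<bullet> a) + g x \<bullet> n - (R * (circ \<theta>\<^sub>0 \<bullet> a) + g \<theta>\<^sub>0 \<bullet> n)" for x
  define \<phi>' where "\<phi>' x = R * ((2 * of_real pi * \<i> * circ x) \<bullet> a) + g' x \<bullet> n" for x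
  define \<phi>'' where "\<phi>'' x = R * ((2 * of_real pi * \<i> * (2 * of_real pi * \<i> * circ x)) \<bullet> a) + g'' x \<bullet> n" for x
  have d1: "(\<phi> has_vector_derivative \<phi>' x) (at x)" for x
  proof -
    have "(\<phi> has_vector_derivative \<phi>' x - 0) (at x)" unfolding \<phi>_def[abs_def] \<phi>'_def
      by (intro has_vector_derivative_diff has_vector_derivative_add has_vector_derivative_const
          has_vector_derivative_mult_right bounded_linear.has_vector_derivative[OF bounded_linear_inner_left]
          g_deriv circ_deriv)
    then show ?thesis by simp
  qed
  have d2: "(\<phi>' has_vector_derivative \<phi>'' x) (at x)" for x
    unfolding \<phi>'_def[abs_def] \<phi>''_def
    by (intro has_vector_derivative_add has_vector_derivative_mult_right
        bounded_linear.has_vector_derivative[OF bounded_linear_inner_left] g'_deriv circ_deriv)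
  have na: "norm a \<le> \<epsilon>" using g'_le by (simp add: a_def norm_mult)
  have nn: "norm n \<le> 2 * pi * R + \<epsilon>" unfolding n
    using R na by (intro order_trans[OF norm_triangle_ineq]) (simp add: circ_norm)
  define M where "M = R * (4 * pi\<^sup>2 * \<epsilon>) + \<epsilon> * (2 * pi * R + \<epsilon>)"
  have "norm (\<phi>'' x) \<le> M" for x
  proof -
    have 1: "\<bar>(2 * of_real pi * \<i> * (2 * of_real pi * \<i> * circ x)) \<bullet> a\<bar> \<le> 4 * pi\<^sup>2 * \<epsilon>"
      by (rule order_trans[OF Cauchy_Schwarz_ineq2]) (use na in \<open>simp add: norm_mult circ_norm power2_eq_square\<close>)
    have 2: "\<bar>g'' x \<bullet> n\<bar> \<le> \<epsilon> * (2 * pi * R + \<epsilon>)"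
      by (rule order_trans[OF Cauchy_Schwarz_ineq2]) (use g''_le nn eps in \<open>auto intro!: mult_mono\<close>)
    have "\<bar>\<phi>'' x\<bar> \<le> R * \<bar>(2 * of_real pi * \<i> * (2 * of_real pi * \<i> * circ x)) \<bullet> a\<bar> + \<bar>g'' x \<bullet> n\<bar>"
      unfolding \<phi>''_def using R by (intro order_trans[OF abs_triangle_ineq]) (simp add: abs_mult)
    also have "\<dots> \<le> M" unfolding M_def using 1 2 R by (intro add_mono mult_left_mono) auto
    finally show ?thesis by simp
  qed
  from second_order_remainder[OF d1 d2 this, of \<theta> \<theta>\<^sub>0]
  have rem: "\<bar>\<phi> \<theta> - \<phi> \<theta>\<^sub>0 - (\<theta> - \<theta>\<^sub>0) * \<phi>' \<theta>\<^sub>0\<bar> \<le> M * (\<theta> - \<theta>\<^sub>0)\<^sup>2" by simp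
  have "\<phi>' \<theta>\<^sub>0 = 0"
  proof -
    have "(2 * of_real pi * \<i> * circ \<theta>\<^sub>0) \<bullet> a = 2 * pi * (circ \<theta>\<^sub>0 \<bullet> g' \<theta>\<^sub>0)"
      by (simp add: a_def inner_complex_def algebra_simps)
    moreover have "g' \<theta>\<^sub>0 \<bullet> n = - (2 * pi * R * (g' \<theta>\<^sub>0 \<bullet> circ \<theta>\<^sub>0))"
      unfolding n inner_add_right a_def by (simp add: inner_commute i_inner)
    ultimately show ?thesis by (simp add: \<phi>'_def inner_commute)
  qed
  moreover have "\<phi> \<theta>\<^sub>0 = 0" by (simp add: \<phi>_def)
  ultimately have \<phi>: "\<phi> \<theta> \<ge> - (M * (\<theta> - \<theta>\<^sub>0)\<^sup>2)" using rem by simp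
  have "\<gamma> \<theta> - \<gamma> \<theta>\<^sub>0 = R *\<^sub>R (circ \<theta> - circ \<theta>\<^sub>0) + (g \<theta> - g \<theta>\<^sub>0)"
    by (simp add: \<gamma>_def scaleR_diff_right)
  then have "(\<gamma> \<theta> - \<gamma> \<theta>\<^sub>0) \<bullet> n = R * ((circ \<theta> - circ \<theta>\<^sub>0) \<bullet> n) + (g \<theta> - g \<theta>\<^sub>0) \<bullet> n"
    by (simp only: inner_add_left inner_scaleR_left)
  also have "(circ \<theta> - circ \<theta>\<^sub>0) \<bullet> n = (circ \<theta> - circ \<theta>\<^sub>0) \<bullet> (- ((2 * pi * R) *\<^sub>R circ \<theta>\<^sub>0)) + (circ \<theta> - circ \<theta>\<^sub>0) \<bullet> a"
    by (simp only: n inner_add_right)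
  also have "R * ((circ \<theta> - circ \<theta>\<^sub>0) \<bullet> (- ((2 * pi * R) *\<^sub>R circ \<theta>\<^sub>0)) + (circ \<theta> - circ \<theta>\<^sub>0) \<bullet> a) + (g \<theta> - g \<theta>\<^sub>0) \<bullet> n
      = R * ((circ \<theta> - circ \<theta>\<^sub>0) \<bullet> (- ((2 * pi * R) *\<^sub>R circ \<theta>\<^sub>0))) + \<phi> \<theta>"
    by (simp only: \<phi>_def inner_diff_left distrib_left right_diff_distrib)
  also have "(circ \<theta> - circ \<theta>\<^sub>0) \<bullet> (- ((2 * pi * R) *\<^sub>R circ \<theta>\<^sub>0)) = 2 * pi * R * (1 - cos (2 * pi * (\<theta> - \<theta>\<^sub>0)))"
    by (simp add: inner_diff_left circ_inner algebra_simps)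
  finally have e: "(\<gamma> \<theta> - \<gamma> \<theta>\<^sub>0) \<bullet> n = 2 * pi * R\<^sup>2 * (1 - cos (2 * pi * (\<theta> - \<theta>\<^sub>0))) + \<phi> \<theta>"
    by (simp add: power2_eq_square mult_ac)
  have "2 * pi * R\<^sup>2 * (8 * (\<theta> - \<theta>\<^sub>0)\<^sup>2) \<le> 2 * pi * R\<^sup>2 * (1 - cos (2 * pi * (\<theta> - \<theta>\<^sub>0)))"
    by (intro mult_left_mono one_minus_cos_ge x) auto
  then have ge: "(16 * pi * R\<^sup>2 - M) * (\<theta> - \<theta>\<^sub>0)\<^sup>2 \<le> (\<gamma> \<theta> - \<gamma> \<theta>\<^sub>0) \<bullet> n"
    using \<phi> unfolding e by (simp add: algebra_simps)
  \<comment> \<open>Here \<open>\<epsilon> \<le> R / 4\<close> and \<open>3 < \<pi> < 4\<close> are used.\<close>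
  have "M < 16 * pi * R\<^sup>2"
  proof -
    have "R * (4 * pi\<^sup>2 * \<epsilon>) \<le> R * (4 * pi\<^sup>2 * (R / 4))" using small R by (intro mult_left_mono) auto
    also have "\<dots> = (pi * R\<^sup>2) * pi" by (simp add: power2_eq_square)
    also have "\<dots> \<le> (pi * R\<^sup>2) * 4" using pi_less_4 by (intro mult_left_mono) auto
    finally have 1: "R * (4 * pi\<^sup>2 * \<epsilon>) \<le> 4 * (pi * R\<^sup>2)" by simp
    have "R * (1 / 4) \<le> R * pi" using pi_gt3 R by (intro mult_left_mono) auto
    then have "\<epsilon> \<le> R * pi" using small by simp
    then have "\<epsilon> * (2 * pi * R + \<epsilon>) \<le> R * (3 * (pi * R))"
      using small eps R by (intro mult_mono) (auto simp: mult_ac)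
    then have 2: "\<epsilon> * (2 * pi * R + \<epsilon>) \<le> 3 * (pi * R\<^sup>2)" by (simp add: power2_eq_square mult_ac)
    have 3: "pi * R\<^sup>2 > 0" using R by simp
    show ?thesis unfolding M_def using 1 2 3 by linarith
  qed
  then have "0 < (16 * pi * R\<^sup>2 - M) * (\<theta> - \<theta>\<^sub>0)\<^sup>2" using x by simp
  then show ?thesis using ge by (simp add: n_def)
qed

text \<open>Every point of the curve has a parameter within half a period of \<open>\<theta>\<^sub>0\<close>.\<close>

lemma support: "\<gamma> \<theta> \<noteq> \<gamma> \<theta>\<^sub>0 \<Longrightarrow> (\<gamma> \<theta> - \<gamma> \<theta>\<^sub>0) \<bullet> normal \<theta>\<^sub>0 > 0"
proof -
  assume ne: "\<gamma> \<theta> \<noteq> \<gamma> \<theta>\<^sub>0"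
  define y where "y = \<theta> + of_int (- round (\<theta> - \<theta>\<^sub>0)) * 1"
  have "\<gamma> y = \<gamma> \<theta>" unfolding y_def by (rule periodic_int_shift) (rule \<gamma>_per)
  moreover have "\<bar>y - \<theta>\<^sub>0\<bar> \<le> 1 / 2"
    using of_int_round_abs_le[of "\<theta> - \<theta>\<^sub>0"] by (simp add: y_def abs_minus_commute algebra_simps)
  moreover have "y \<noteq> \<theta>\<^sub>0" using calculation(1) ne by auto
  ultimately show ?thesis using support_local[of y \<theta>\<^sub>0] by simp
qed

lemma \<gamma>_half: "\<gamma> (\<theta> + 1 / 2) \<noteq> \<gamma> \<theta>"
  using support_local[of "\<theta> + 1 / 2" \<theta>] by auto

text \<open>The open half plane together with the point of contact is convex and contains the curve.\<close>

lemma hull_support: "y \<in> body \<Longrightarrow> y \<noteq> \<gamma> \<theta>\<^sub>0 \<Longrightarrow> (y - \<gamma> \<theta>\<^sub>0) \<bullet> normal \<theta>\<^sub>0 > 0"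
proof -
  define S where "S = {y. y = \<gamma> \<theta>\<^sub>0 \<or> (y - \<gamma> \<theta>\<^sub>0) \<bullet> normal \<theta>\<^sub>0 > 0}"
  have "convex S"
  proof (rule convexI)
    fix x y u w assume h: "x \<in> S" "y \<in> S" "0 \<le> u" "0 \<le> w" "u + w = (1::real)"
    have e: "u *\<^sub>R x + w *\<^sub>R y - \<gamma> \<theta>\<^sub>0 = u *\<^sub>R (x - \<gamma> \<theta>\<^sub>0) + w *\<^sub>R (y - \<gamma> \<theta>\<^sub>0)"
      using h(5) by (simp add: algebra_simps flip: scaleR_add_left)
    have nn: "(x - \<gamma> \<theta>\<^sub>0) \<bullet> normal \<theta>\<^sub>0 \<ge> 0" "(y - \<gamma> \<theta>\<^sub>0) \<bullet> normal \<theta>\<^sub>0 \<ge> 0" using h by (auto simp: S_def)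
    show "u *\<^sub>R x + w *\<^sub>R y \<in> S"
    proof (cases "(u = 0 \<or> x = \<gamma> \<theta>\<^sub>0) \<and> (w = 0 \<or> y = \<gamma> \<theta>\<^sub>0)")
      case True
      then have "u *\<^sub>R x + w *\<^sub>R y - \<gamma> \<theta>\<^sub>0 = 0" unfolding e by auto
      then show ?thesis by (simp add: S_def)
    next
      case False
      then have "0 < u * ((x - \<gamma> \<theta>\<^sub>0) \<bullet> normal \<theta>\<^sub>0) + w * ((y - \<gamma> \<theta>\<^sub>0) \<bullet> normal \<theta>\<^sub>0)"
      proof -
        from False consider "u > 0" "x \<noteq> \<gamma> \<theta>\<^sub>0" | "w > 0" "y \<noteq> \<gamma> \<theta>\<^sub>0" using h by force
        then show ?thesis
        proof cases
          case 1 then show ?thesis using h nn by (intro add_pos_nonneg mult_pos_pos) (auto simp: S_def)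
        next
          case 2 then show ?thesis using h nn by (intro add_nonneg_pos mult_pos_pos) (auto simp: S_def)
        qed
      qed
      then show ?thesis by (simp add: S_def e inner_add_left)
    qed
  qed
  moreover have "range \<gamma> \<subseteq> S" using support by (auto simp: S_def)
  ultimately have "body \<subseteq> S" unfolding body_def by (rule hull_minimal[rotated])
  moreover assume "y \<in> body" "y \<noteq> \<gamma> \<theta>\<^sub>0"
  ultimately show ?thesis by (auto simp: S_def)
qed

lemma \<gamma>_in_hull: "\<gamma> \<theta> \<in> body" unfolding body_def by (rule hull_inc) simp

lemma range_\<gamma>: "range \<gamma> = \<gamma> ` {0..1}"
proof -
  have "\<gamma> x \<in> \<gamma> ` {0..1}" for x
    using periodic_frac[where f=\<gamma>, OF \<gamma>_per, of x] frac_lt_1[of x]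
    by (intro image_eqI[of _ _ "frac x"]) (auto simp: less_imp_le)
  then show ?thesis by auto
qed

lemma compact_hull: "compact body"
proof -
  have "continuous_on {0..1} \<gamma>"
    by (rule continuous_on_vector_derivative[OF has_vector_derivative_at_within[OF \<gamma>_deriv]])
  then show ?thesis unfolding body_def range_\<gamma> by (intro compact_convex_hull compact_continuous_image) auto
qed

lemma convex_hull': "convex body" and hull_ne: "body \<noteq> {}" and closed_hull: "closed body"
  using compact_hull \<gamma>_in_hull by (auto simp: body_def compact_imp_closed)

text \<open>
  At a boundary point of the hull some linear functional attains its minimum. The minimum over the
  curve is attained at some \<open>\<gamma> \<theta>\<^sub>0\<close>, where the functional is a positive multiple of the inner normal, and
  by strict support this point is the only minimum on the hull.
\<close>

lemma frontier_hull: "frontier body \<subseteq> range \<gamma>"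
proof
  fix x assume x: "x \<in> frontier body"
  then have xh: "x \<in> body" using closed_hull by (auto simp: frontier_def)
  obtain a where a: "a \<noteq> 0" "\<And>y. y \<in> body \<Longrightarrow> a \<bullet> x \<le> a \<bullet> y"
  \<comment> \<open>A hull without interior lies in a line, on which the functional is constant.\<close>
  proof (cases "interior body = {}")
    case True
    obtain a b where "a \<noteq> 0" "body \<subseteq> {y. a \<bullet> y = b}"
      using empty_interior_subset_hyperplane[OF convex_hull' True] by blast
    show ?thesis
    proof (rule that)
      show "a \<noteq> 0" by fact
      show "a \<bullet> x \<le> a \<bullet> y" if y: "y \<in> body" for y
        using subsetD[OF \<open>body \<subseteq> {y. a \<bullet> y = b}\<close> y] subsetD[OF \<open>body \<subseteq> {y. a \<bullet> y = b}\<close> xh] by simp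
    qed
  next
    case False
    then have "x \<notin> rel_interior body" using x by (simp add: rel_interior_nonempty_interior frontier_def)
    then show ?thesis using supporting_hyperplane_rel_boundary[OF convex_hull' xh] that by metis
  qed
  obtain \<theta>\<^sub>0 where min: "\<And>\<theta>. a \<bullet> \<gamma> \<theta>\<^sub>0 \<le> a \<bullet> \<gamma> \<theta>"
  proof -
    have "continuous_on {0..1} (\<lambda>\<theta>. a \<bullet> \<gamma> \<theta>)"
      by (intro continuous_intros continuous_on_vector_derivative[OF has_vector_derivative_at_within[OF \<gamma>_deriv]])
    then obtain z where "z \<in> {0..1}" "\<forall>y\<in>{0..1}. a \<bullet> \<gamma> z \<le> a \<bullet> \<gamma> y"
      using continuous_attains_inf[of "{0..1::real}" "\<lambda>\<theta>. a \<bullet> \<gamma> \<theta>"] by auto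
    moreover have "\<gamma> \<theta> \<in> \<gamma> ` {0..1}" for \<theta> using range_\<gamma> by auto
    ultimately show ?thesis using that[of z] by (metis imageE)
  qed
  let ?z = "\<gamma> \<theta>\<^sub>0"
  have "((\<lambda>\<theta>. a \<bullet> \<gamma> \<theta>) has_real_derivative a \<bullet> \<gamma>' \<theta>\<^sub>0) (at \<theta>\<^sub>0)"
    unfolding has_real_derivative_iff_has_vector_derivative
    by (rule bounded_linear.has_vector_derivative[OF bounded_linear_inner_right \<gamma>_deriv])
  then have orth: "a \<bullet> \<gamma>' \<theta>\<^sub>0 = 0" by (rule DERIV_local_min[where d=1]) (auto intro: min)
  have n0: "normal \<theta>\<^sub>0 \<noteq> 0" using support_local[of "\<theta>\<^sub>0 + 1 / 2" \<theta>\<^sub>0] by auto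
  define s where "s = (a \<bullet> normal \<theta>\<^sub>0) / (normal \<theta>\<^sub>0 \<bullet> normal \<theta>\<^sub>0)"
  \<comment> \<open>In the plane a functional that vanishes on the tangent is a multiple of the normal.\<close>
  have as: "a = s *\<^sub>R normal \<theta>\<^sub>0"
  proof -
    have "(Re (\<gamma>' \<theta>\<^sub>0))\<^sup>2 + (Im (\<gamma>' \<theta>\<^sub>0))\<^sup>2 \<noteq> 0"
      using n0 by (auto simp: normal_def complex_eq_iff sum_power2_eq_zero_iff)
    moreover have "Re a * Re (\<gamma>' \<theta>\<^sub>0) = - Im a * Im (\<gamma>' \<theta>\<^sub>0)" using orth by (simp add: inner_complex_def)
    ultimately show ?thesis
      by (simp add: s_def complex_eq_iff normal_def inner_complex_def field_simps power2_eq_square) algebra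
  qed
  have s: "s > 0"
  proof -
    have "a \<bullet> (\<gamma> (\<theta>\<^sub>0 + 1/2) - ?z) \<ge> 0" using min[of "\<theta>\<^sub>0 + 1/2"] by (simp add: inner_diff_right)
    then have "s * ((\<gamma> (\<theta>\<^sub>0 + 1/2) - ?z) \<bullet> normal \<theta>\<^sub>0) \<ge> 0" unfolding as by (simp add: inner_commute)
    moreover have "(\<gamma> (\<theta>\<^sub>0 + 1/2) - ?z) \<bullet> normal \<theta>\<^sub>0 > 0" by (rule support[OF \<gamma>_half])
    ultimately have "s \<ge> 0" by (simp add: zero_le_mult_iff)
    moreover have "s \<noteq> 0" using as a(1) by auto
    ultimately show ?thesis by simp
  qed
  have "x = ?z"
  proof (rule ccontr)
    assume "x \<noteq> ?z"
    then have "s * ((x - ?z) \<bullet> normal \<theta>\<^sub>0) > 0" using hull_support[OF xh] s by simp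
    then have "a \<bullet> x > a \<bullet> ?z" unfolding as by (simp add: inner_commute inner_diff_right algebra_simps)
    then show False using a(2)[OF \<gamma>_in_hull[of \<theta>\<^sub>0]] by simp
  qed
  then show "x \<in> range \<gamma>" by simp
qed

text \<open>Boundary points are points of the curve, and strict support makes them extreme points of the hull.\<close>

lemma open_segment_interior:
  assumes x: "x \<in> body" and y: "y \<in> body" and ne: "x \<noteq> y"
  shows "open_segment x y \<subseteq> interior body"
proof
  fix z assume z: "z \<in> open_segment x y"
  have zh: "z \<in> body" using z x y convex_hull' by (meson convex_contains_open_segment subsetD)
  show "z \<in> interior body"
  proof (rule ccontr)
    assume "z \<notin> interior body"
    then have "z \<in> frontier body" using zh closed_hull by (simp add: frontier_def)
    then obtain \<theta> where \<theta>: "z = \<gamma> \<theta>" using frontier_hull by auto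
    obtain u where u: "0 < u" "u < 1" "z = (1 - u) *\<^sub>R x + u *\<^sub>R y" using z by (auto simp: in_segment)
    have "z \<noteq> x" "z \<noteq> y" using z by (auto simp: open_segment_def)
    then have "(x - z) \<bullet> normal \<theta> > 0" "(y - z) \<bullet> normal \<theta> > 0"
      using hull_support[OF x, of \<theta>] hull_support[OF y, of \<theta>] by (auto simp: \<theta>)
    then have "(1 - u) * ((x - z) \<bullet> normal \<theta>) + u * ((y - z) \<bullet> normal \<theta>) > 0"
      using u by (intro add_pos_pos mult_pos_pos) auto
    also have "(1 - u) * ((x - z) \<bullet> normal \<theta>) + u * ((y - z) \<bullet> normal \<theta>)
       = ((1 - u) *\<^sub>R x + u *\<^sub>R y - z) \<bullet> normal \<theta>"
      by (simp add: inner_add_left inner_diff_left algebra_simps)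
    finally show False using u(3) by simp
  qed
qed

lemma interior_hull_ne: "interior body \<noteq> {}"
proof -
  have ne: "\<gamma> 0 \<noteq> \<gamma> (1/2)" using \<gamma>_half[of 0] by simp
  have "open_segment (\<gamma> 0) (\<gamma> (1/2)) \<subseteq> interior body"
    by (rule open_segment_interior[OF \<gamma>_in_hull \<gamma>_in_hull ne])
  then show ?thesis using ne by (metis open_segment_eq_empty subset_empty)
qed

lemma closure_interior_hull: "closure (interior body) = body"
  using convex_closure_interior[OF convex_hull' interior_hull_ne] closed_hull by (simp add: closure_closed)

text \<open>A point slightly outside along the normal would violate the support inequality.\<close>

lemma \<gamma>_frontier: "\<gamma> \<theta> \<in> frontier body"
proof -
  have "\<gamma> \<theta> \<notin> interior body"
  proof
    assume "\<gamma> \<theta> \<in> interior body"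
    then obtain e where e: "e > 0" "ball (\<gamma> \<theta>) e \<subseteq> body" by (auto simp: mem_interior)
    have n0: "norm (normal \<theta>) > 0" using support_local[of "\<theta> + 1 / 2" \<theta>] by auto
    define y where "y = \<gamma> \<theta> - (e / (2 * norm (normal \<theta>))) *\<^sub>R normal \<theta>"
    have "y \<in> body" using e n0 by (intro subsetD[OF e(2)]) (simp add: y_def dist_norm)
    moreover have "y \<noteq> \<gamma> \<theta>" using e n0 by (simp add: y_def)
    ultimately have "(y - \<gamma> \<theta>) \<bullet> normal \<theta> > 0" by (rule hull_support)
    moreover have "(y - \<gamma> \<theta>) \<bullet> normal \<theta> = - (e / (2 * norm (normal \<theta>))) * (normal \<theta> \<bullet> normal \<theta>)"
      by (simp add: y_def)
    moreover have "normal \<theta> \<bullet> normal \<theta> > 0" using n0 by simp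
    moreover have "0 < e / (2 * norm (normal \<theta>)) * (normal \<theta> \<bullet> normal \<theta>)"
      using e n0 by (intro mult_pos_pos divide_pos_pos) auto
    ultimately show False by linarith
  qed
  then show ?thesis using \<gamma>_in_hull closed_hull by (simp add: frontier_def)
qed

lemma frontier_interior_hull: "frontier (interior body) = range \<gamma>"
proof -
  have "frontier (interior body) = frontier body"
    using closed_hull by (simp add: frontier_def closure_interior_hull)
  then show ?thesis using frontier_hull \<gamma>_frontier by auto
qed

lemma bounded_domain_interior_hull: "bounded_domain (interior body)"
  unfolding bounded_domain_def
  using interior_hull_ne compact_imp_bounded[OF compact_hull] convex_interior[OF convex_hull']
  by (auto intro: convex_connected bounded_interior)

lemma strictly_convex_interior_hull: "strictly_convex (interior body)"
  unfolding strictly_convex_def closure_interior_hull using open_segment_interior by simp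

lemma hull_subset: "body \<subseteq> cball c (R + \<epsilon>)"
  unfolding body_def
proof (rule hull_minimal)
  show "range \<gamma> \<subseteq> cball c (R + \<epsilon>)"
  proof (clarsimp simp: dist_norm)
    fix \<theta>
    have "c - \<gamma> \<theta> = - (R *\<^sub>R circ \<theta> + g \<theta>)" by (simp add: \<gamma>_def)
    then have "norm (c - \<gamma> \<theta>) = norm (R *\<^sub>R circ \<theta> + g \<theta>)" by (simp only: norm_minus_cancel)
    also have "\<dots> \<le> R + \<epsilon>" using R g_le[of \<theta>] by (intro order_trans[OF norm_triangle_ineq]) (simp add: circ_norm)
    finally show "norm (c - \<gamma> \<theta>) \<le> R + \<epsilon>" .
  qed
qed simp

text \<open>
  Let \<open>a\<close> be the point of the hull closest to \<open>b\<close> and \<open>n = b - a\<close>. The hull lies on the far side of the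
  line through \<open>a\<close> orthogonal to \<open>n\<close>; so does the point of the curve with direction \<open>n\<close> on the circle,
  which is within \<open>\<epsilon>\<close> of \<open>c + R n / |n|\<close>. Hence \<open>c\<close> is at distance at least \<open>R - \<epsilon>\<close> from this line.
\<close>

lemma distance_to_hull_le:
  assumes b: "b \<notin> body"
  shows "R - \<epsilon> + infdist b body \<le> norm (b - c)" and "infdist b body > 0"
proof -
  define a where "a = closest_point body b"
  have a: "a \<in> body" "\<And>y. y \<in> body \<Longrightarrow> dist b a \<le> dist b y"
    unfolding a_def using closest_point_exists[OF closed_hull hull_ne] by auto
  define n where "n = b - a"
  have n0: "n \<noteq> 0" using a(1) b by (auto simp: n_def)
  have d: "infdist b body = norm n"
    unfolding n_def dist_norm[symmetric]
  proof (rule antisym)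
    show "infdist b body \<le> dist b a" by (rule infdist_le[OF a(1)])
    show "dist b a \<le> infdist b body"
      unfolding infdist_notempty[OF hull_ne] by (intro cINF_greatest hull_ne a(2))
  qed
  show "infdist b body > 0" using d n0 by simp
  obtain \<theta> where \<theta>: "circ \<theta> = sgn n" using circ_surj[of "sgn n"] n0 by (auto simp: norm_sgn)
  have "(b - a) \<bullet> (\<gamma> \<theta> - a) \<le> 0"
    using closest_point_dot[OF convex_hull' closed_hull \<gamma>_in_hull, of b \<theta>] by (simp add: a_def)
  then have 1: "n \<bullet> (\<gamma> \<theta> - a) \<le> 0" by (simp add: n_def)
  have "n \<bullet> sgn n = norm n"
    using n0 by (simp add: sgn_div_norm dot_square_norm power2_eq_square)
  then have "n \<bullet> (\<gamma> \<theta> - a) = n \<bullet> (c - a) + R * norm n + n \<bullet> g \<theta>"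
    by (simp add: \<gamma>_def \<theta> inner_add_right inner_diff_right)
  moreover have "n \<bullet> g \<theta> \<ge> - (norm n * \<epsilon>)"
    using Cauchy_Schwarz_ineq2[of n "g \<theta>"] mult_left_mono[OF g_le[of \<theta>] norm_ge_zero[of n]] by linarith
  ultimately have 2: "n \<bullet> (c - a) \<le> norm n * \<epsilon> - R * norm n" using 1 by linarith
  have "n \<bullet> (b - c) = n \<bullet> n - n \<bullet> (c - a)" by (simp add: n_def inner_diff_right)
  also have "\<dots> \<ge> norm n * norm n - (norm n * \<epsilon> - R * norm n)"
    using 2 by (simp add: dot_square_norm power2_eq_square)
  finally have "norm n * (norm n - \<epsilon> + R) \<le> n \<bullet> (b - c)" by (simp add: algebra_simps)
  also have "\<dots> \<le> norm n * norm (b - c)" using Cauchy_Schwarz_ineq2[of n "b - c"] by linarith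
  finally have "norm n - \<epsilon> + R \<le> norm (b - c)" using n0 by simp
  then show "R - \<epsilon> + infdist b body \<le> norm (b - c)" using d by simp
qed

lemma inner_disk: "cball c (R - \<epsilon>) \<subseteq> body"
proof
  fix b assume "b \<in> cball c (R - \<epsilon>)"
  then show "b \<in> body" using distance_to_hull_le[of b] by (force simp: dist_norm norm_minus_commute)
qed

lemma hausdorff_dist_le: "hausdorff_dist body (cball c R) \<le> \<epsilon>"
proof -
  have "infdist a (cball c R) \<le> \<epsilon>" if a: "a \<in> body" for a
  proof (cases "norm (a - c) \<le> R")
    case True
    then show ?thesis using eps by (simp add: dist_norm norm_minus_commute)
  next
    case False
    define y where "y = c + (R / norm (a - c)) *\<^sub>R (a - c)"
    have "y \<in> cball c R" using False R by (simp add: y_def dist_norm)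
    moreover have "dist a y = norm (a - c) - R"
    proof -
      have "a - y = (1 - R / norm (a - c)) *\<^sub>R (a - c)" by (simp add: y_def algebra_simps)
      then have "dist a y = \<bar>1 - R / norm (a - c)\<bar> * norm (a - c)" by (simp only: dist_norm norm_scaleR)
      moreover have "R / norm (a - c) < 1" using False R by (simp add: divide_less_eq)
      ultimately have "dist a y = (1 - R / norm (a - c)) * norm (a - c)" by simp
      moreover have "norm (a - c) \<noteq> 0" using False R by auto
      ultimately show ?thesis by (simp only: left_diff_distrib) simp
    qed
    moreover have "norm (a - c) \<le> R + \<epsilon>" using hull_subset a by (auto simp: dist_norm norm_minus_commute)
    ultimately show ?thesis using infdist_le[of y "cball c R" a] by linarith
  qed
  moreover have "infdist b body \<le> \<epsilon>" if b: "b \<in> cball c R" for b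
  proof (cases "b \<in> body")
    case True then show ?thesis using eps by simp
  next
    case False
    then show ?thesis using distance_to_hull_le(1)[OF False] b by (simp add: dist_norm norm_minus_commute)
  qed
  moreover have "cball c R \<noteq> {}" using R by simp
  ultimately show ?thesis unfolding hausdorff_dist_def using hull_ne
    by (intro max.boundedI cSUP_least)
qed

end

section \<open>The first moment of an almost circular region\<close>

lemma borel_integrable_on:
  fixes S :: "complex set"
  assumes "S \<in> sets borel" "bounded S"
  shows "(\<lambda>x. x - c) integrable_on S" and "set_integrable lborel S (\<lambda>x. x - c)"
proof -
  obtain r where "\<forall>x\<in>S. norm x \<le> r" using assms(2) unfolding bounded_iff by blast
  then have r: "S \<subseteq> cball 0 r" by auto
  have "set_integrable lborel (cball 0 r) (\<lambda>x. x - c)"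
    unfolding set_integrable_def
    by (rule borel_integrable_compact[OF compact_cball]) (intro continuous_intros)
  then show si: "set_integrable lborel S (\<lambda>x. x - c)"
    by (rule set_integrable_subset) (use assms(1) r in auto)
  show "(\<lambda>x. x - c) integrable_on S" by (rule set_borel_integral_eq_integral(1)[OF si])
qed

text \<open>Reflection in \<open>c\<close> preserves Lebesgue measure and changes the sign of the integrand.\<close>

lemma ball_centroid: "integral (ball (c::complex) r) (\<lambda>x. x - c) = 0"
proof -
  let ?f = "\<lambda>x. indicator (ball c r) x *\<^sub>R (x - c)"
  \<comment> \<open>The reflection \<open>x \<mapsto> 2 c - x\<close>.\<close>
  have refl: "lborel = distr lborel borel (\<lambda>x. 2 * c + (-1) *\<^sub>R x)"
    using lborel_affine[of "-1" "2 * c"] by (simp add: density_1)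
  have "(LINT x|lborel. ?f x) = (LINT x|distr lborel borel (\<lambda>x. 2 * c + (-1) *\<^sub>R x). ?f x)"
    using refl by simp
  also have "\<dots> = (LINT x|lborel. ?f (2 * c + (-1) *\<^sub>R x))"
  proof (rule integral_distr)
    show "(\<lambda>x. 2 * c + (-1) *\<^sub>R x) \<in> lborel \<rightarrow>\<^sub>M borel"
      unfolding measurable_lborel2 by (intro borel_measurable_continuous_onI continuous_intros)
    show "?f \<in> borel_measurable borel"
      by (rule borel_measurable_scaleR[OF borel_measurable_indicator])
         (auto intro: borel_measurable_continuous_onI continuous_intros)
  qed
  also have "(\<lambda>x. ?f (2 * c + (-1) *\<^sub>R x)) = (\<lambda>x. - ?f x)"
  proof
    fix x
    have "2 * c + (-1) *\<^sub>R x - c = - (x - c)" by (simp add: algebra_simps)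
    moreover have "(2 * c + (-1) *\<^sub>R x \<in> ball c r) = (x \<in> ball c r)"
      by (simp add: dist_norm norm_minus_commute)
    ultimately show "?f (2 * c + (-1) *\<^sub>R x) = - ?f x" by (simp only: indicator_def) simp
  qed
  finally have "(LINT x|lborel. ?f x) = 0" by simp
  then have "(LINT x:ball c r|lborel. x - c) = 0" by (simp add: set_lebesgue_integral_def)
  then show ?thesis
    using set_borel_integral_eq_integral(2)[OF borel_integrable_on(2)[of "ball c r" c]] by simp
qed

lemma content_disk: "r \<ge> 0 \<Longrightarrow> measure lebesgue (ball (z::complex) r) = pi * r\<^sup>2"
  by (simp add: content_ball unit_ball_vol_2)

text \<open>
  The inner disk contributes nothing to the moment about \<open>c\<close>, and the rest lies in an annulus of area
  \<open>4 \<pi> r d\<close>; the same area bounds the error of \<open>\<pi> r\<^sup>2\<close> as the area of \<open>S\<close>.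
\<close>

lemma first_moment_close:
  fixes S :: "complex set"
  assumes S: "open S" and sub: "ball c (r - d) \<subseteq> S" "S \<subseteq> cball c (r + d)" and d: "0 \<le> d" "d \<le> r"
  shows "norm (integral S (\<lambda>x. x) - (pi * r\<^sup>2) *\<^sub>R c) \<le> (norm c + 2 * r) * (4 * pi * r * d)"
proof -
  let ?B = "ball c (r - d)"
  have bS: "bounded S" by (rule bounded_subset[OF bounded_cball sub(2)])
  have mS: "S \<in> lmeasurable" by (rule lmeasurable_open[OF bS S])
  have mD: "S - ?B \<in> lmeasurable" by (intro fmeasurable.Diff mS) simp
  have borel: "S \<in> sets borel" "S - ?B \<in> sets borel" using S by auto
  have cb: "measure lebesgue (cball c (r + d)) = pi * (r + d)\<^sup>2"
    using d by (simp add: content_cball unit_ball_vol_2)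
  have le: "measure lebesgue S \<le> pi * (r + d)\<^sup>2"
    unfolding cb[symmetric] using sub(2) mS by (intro measure_mono_fmeasurable) auto
  have ge: "pi * (r - d)\<^sup>2 \<le> measure lebesgue S"
    unfolding content_disk[of "r - d" c, symmetric, OF diff_ge_0_iff_ge[THEN iffD2, OF d(2)]]
    using sub(1) mS by (intro measure_mono_fmeasurable) auto
  have diff: "measure lebesgue (S - ?B) = measure lebesgue S - pi * (r - d)\<^sup>2"
    using measurable_measure_Diff[OF mS _ sub(1)] content_disk[of "r - d" c] d by simp
  have sq: "pi * (r + d)\<^sup>2 = pi * (r - d)\<^sup>2 + 4 * pi * r * d" by (simp add: power2_eq_square algebra_simps)
  have moment: "norm (integral S (\<lambda>x. x - c)) \<le> 2 * r * (4 * pi * r * d)"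
  proof -
    have "integral S (\<lambda>x. x - c) = integral (?B \<union> (S - ?B)) (\<lambda>x. x - c)"
      using sub(1) by (simp add: Un_absorb1)
    also have "\<dots> = integral ?B (\<lambda>x. x - c) + integral (S - ?B) (\<lambda>x. x - c)"
      using borel bS by (intro Henstock_Kurzweil_Integration.integral_Un borel_integrable_on(1)) (auto intro: bounded_subset)
    also have "\<dots> = integral (S - ?B) (\<lambda>x. x - c)" by (simp add: ball_centroid)
    also have "norm \<dots> \<le> integral (S - ?B) (\<lambda>x. (2 * r) * 1)"
    proof (rule integral_norm_bound_integral)
      show "(\<lambda>x. x - c) integrable_on S - ?B"
        using borel bS by (intro borel_integrable_on(1)) (auto intro: bounded_subset)
      show "(\<lambda>x. (2 * r) * 1) integrable_on S - ?B"
        using mD by (intro integrable_on_mult_right) (simp add: lmeasurable_iff_integrable_on)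
      show "norm (x - c) \<le> (2 * r) * 1" if "x \<in> S - ?B" for x
        using subsetD[OF sub(2), of x] that d by (simp add: dist_norm norm_minus_commute)
    qed
    also have "\<dots> = 2 * r * measure lebesgue (S - ?B)"
      unfolding lmeasure_integral[OF mD] by (rule integral_mult_right)
    also have "\<dots> \<le> 2 * r * (4 * pi * r * d)"
      using d le sq diff by (intro mult_left_mono) auto
    finally show ?thesis .
  qed
  have int1: "((\<lambda>x. 1::real) has_integral measure lebesgue S) S"
    using mS by (simp add: lmeasure_integral lmeasurable_iff_integrable_on integrable_integral)
  have "((\<lambda>x. (x - c) + 1 *\<^sub>R c) has_integral integral S (\<lambda>x. x - c) + measure lebesgue S *\<^sub>R c) S"
    using borel bS by (intro has_integral_add integrable_integral borel_integrable_on(1) has_integral_scaleR_left int1)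
  then have "integral S (\<lambda>x. x) = integral S (\<lambda>x. x - c) + measure lebesgue S *\<^sub>R c"
    by (simp add: integral_unique)
  then have "integral S (\<lambda>x. x) - (pi * r\<^sup>2) *\<^sub>R c = integral S (\<lambda>x. x - c) + (measure lebesgue S - pi * r\<^sup>2) *\<^sub>R c"
    by (simp add: algebra_simps)
  then have "norm (integral S (\<lambda>x. x) - (pi * r\<^sup>2) *\<^sub>R c)
     \<le> norm (integral S (\<lambda>x. x - c)) + \<bar>measure lebesgue S - pi * r\<^sup>2\<bar> * norm c"
    by (metis norm_scaleR norm_triangle_ineq)
  also have "\<dots> \<le> 2 * r * (4 * pi * r * d) + (4 * pi * r * d) * norm c"
  proof (intro add_mono moment mult_right_mono)
    have "pi * (r - d)\<^sup>2 \<le> pi * r\<^sup>2" "pi * r\<^sup>2 \<le> pi * (r + d)\<^sup>2"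
      using d by (auto intro!: mult_left_mono power_mono)
    then show "\<bar>measure lebesgue S - pi * r\<^sup>2\<bar> \<le> 4 * pi * r * d" using le ge sq by linarith
  qed simp
  finally show ?thesis by (simp add: algebra_simps)
qed

text \<open>Points of \<open>\<real> / l\<int>\<close> are compared through their images on the unit circle.\<close>

lemma quotient_dist_le:
  assumes l: "l > 0"
  shows "quotient_dist l x y \<le> l / 4 * norm (exp (\<i> * complex_of_real (2 * pi / l * x)) - exp (\<i> * complex_of_real (2 * pi / l * y)))"
proof -
  define z where "z = 2 * pi / l * (x - y)"
  obtain n :: int where n: "\<bar>z - 2 * pi * of_int n\<bar> \<le> pi / 2 * norm (exp (\<i> * complex_of_real z) - 1)"
    using distance_to_multiples_of_2pi by blast
  have "quotient_dist l x y \<le> \<bar>x - y - of_int n * l\<bar>"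
    unfolding quotient_dist_def by (rule cINF_lower) (auto intro!: bdd_belowI[of _ 0])
  also have "x - y - of_int n * l = l / (2 * pi) * (z - 2 * pi * of_int n)"
    using l by (simp add: z_def field_simps)
  also have "\<bar>\<dots>\<bar> = l / (2 * pi) * \<bar>z - 2 * pi * of_int n\<bar>" using l by (simp add: abs_mult)
  also have "\<dots> \<le> l / (2 * pi) * (pi / 2 * norm (exp (\<i> * complex_of_real z) - 1))"
    using n l by (intro mult_left_mono) auto
  also have "\<dots> = l / 4 * norm (exp (\<i> * complex_of_real z) - 1)" by simp
  also have "norm (exp (\<i> * complex_of_real z) - 1)
     = norm (exp (\<i> * complex_of_real (2 * pi / l * x)) - exp (\<i> * complex_of_real (2 * pi / l * y)))"
  proof -
    have "\<i> * complex_of_real (2 * pi / l * x) = \<i> * complex_of_real z + \<i> * complex_of_real (2 * pi / l * y)"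
      by (simp add: z_def algebra_simps diff_divide_distrib)
    then have "exp (\<i> * complex_of_real (2 * pi / l * x)) - exp (\<i> * complex_of_real (2 * pi / l * y))
      = exp (\<i> * complex_of_real (2 * pi / l * y)) * (exp (\<i> * complex_of_real z) - 1)"
      by (simp only: exp_add) (simp add: algebra_simps)
    then show ?thesis by (simp add: norm_mult)
  qed
  finally show ?thesis .
qed

section \<open>Evolution equations\<close>

locale smooth_flow =
  fixes F :: "real \<Rightarrow> real \<Rightarrow> complex"
  assumes solution: "global_solution F"
begin

text \<open>
  All quantities are functions of the fixed parameter \<open>p\<close>, because time derivatives are taken at fixed
  \<open>p\<close>. The speed is \<open>v\<close>, the unit tangent \<open>T\<close>, and \<open>K j\<close> is the \<open>j\<close>-th derivative of the curvature by arc
  length, which is the derivative in \<open>p\<close> divided by \<open>v\<close>. The normal speed of the flow is \<open>V\<close>.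
\<close>

definition "F' p t = vector_derivative (\<lambda>x. F x t) (at p)"
definition "v p t = norm (F' p t)"
definition "T p t = of_real (inverse (v p t)) * F' p t"

primrec K :: "nat \<Rightarrow> real \<Rightarrow> real \<Rightarrow> real" where
  "K 0 = (\<lambda>p t. Im (cnj (T p t) * vector_derivative (\<lambda>x. T x t) (at p)) * inverse (v p t))"
| "K (Suc j) = (\<lambda>p t. vector_derivative (\<lambda>x. K j x t) (at p) * inverse (v p t))"

declare K.simps [simp del]

abbreviation "L t \<equiv> flow_length F t"

abbreviation "A t \<equiv> flow_area F t"

definition "V p t = K 0 p t - L t / (2 * A t)"

lemma F_smooth: "Cinf_family F" and F_per: "t \<ge> 0 \<Longrightarrow> F (p + 1) t = F p t"
  and F'_nz: "t \<ge> 0 \<Longrightarrow> F' p t \<noteq> 0"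
  using solution unfolding global_solution_def F'_def by (auto intro: Cinf_family_if_smooth_family)

lemma has_space_derivative_vector_derivative:
  assumes "Cinf_family u"
  shows "has_space_derivative u (\<lambda>p t. vector_derivative (\<lambda>x. u x t) (at p))"
    and "Cinf_family (\<lambda>p t. vector_derivative (\<lambda>x. u x t) (at p))"
proof -
  obtain a where "has_space_derivative u a" using Cinf_family_derivatives_exist(1)[OF assms] by blast
  then show *: "has_space_derivative u (\<lambda>p t. vector_derivative (\<lambda>x. u x t) (at p))"
    by (metis vector_derivative_at)
  show "Cinf_family (\<lambda>p t. vector_derivative (\<lambda>x. u x t) (at p))"
    by (rule Cinf_family_space_derivative[OF assms *])
qed

lemma F_space: "has_space_derivative F F'" and F'_smooth: "Cinf_family F'"
  using has_space_derivative_vector_derivative[OF F_smooth] by (simp_all add: F'_def[abs_def])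

lemma v_pos: "t \<ge> 0 \<Longrightarrow> v p t > 0" using F'_nz by (simp add: v_def)

lemma v_smooth: "Cinf_family v"
proof (rule Cinf_family_cong)
  show "Cinf_family (\<lambda>p t. sqrt (Re (F' p t) * Re (F' p t) + Im (F' p t) * Im (F' p t)))"
  proof (rule Cinf_family_sqrt)
    show "0 < Re (F' p t) * Re (F' p t) + Im (F' p t) * Im (F' p t)" if "t \<ge> 0" for p t
      using F'_nz[OF that, of p] by (auto simp: complex_eq_iff sum_squares_gt_zero_iff)
  qed (intro Cinf_family_add Cinf_family_mult Cinf_family_linear[OF bounded_linear_Re]
        Cinf_family_linear[OF bounded_linear_Im] F'_smooth)
qed (simp add: v_def cmod_def power2_eq_square)

lemma inverse_v_smooth: "Cinf_family (\<lambda>p t. inverse (v p t))"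
  using v_pos by (intro Cinf_family_inverse v_smooth) (metis less_irrefl)

lemma T_smooth: "Cinf_family T"
  unfolding T_def[abs_def]
  by (intro Cinf_family_mult Cinf_family_linear[OF bounded_linear_of_real] inverse_v_smooth F'_smooth)

lemma F'_eq: "t \<ge> 0 \<Longrightarrow> F' p t = of_real (v p t) * T p t"
  using v_pos[of t p] by (simp add: T_def)

lemma T_unit: "t \<ge> 0 \<Longrightarrow> norm (T p t) = 1"
  using v_pos[of t p] by (simp add: T_def norm_mult v_def norm_inverse)

lemma T_cnj: "t \<ge> 0 \<Longrightarrow> T p t * cnj (T p t) = 1"
  using T_unit[of t p] complex_norm_square[of "T p t"] by simp

lemma T_nz: "t \<ge> 0 \<Longrightarrow> T p t \<noteq> 0" using T_unit[of t p] by auto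

lemma K_smooth: "Cinf_family (K j)"
proof (induction j)
  case 0
  have "bounded_linear cnj" by (rule bounded_linear_cnj)
  then show ?case unfolding K.simps
    by (intro Cinf_family_mult Cinf_family_linear[OF bounded_linear_Im]
        Cinf_family_linear[where h=cnj] inverse_v_smooth T_smooth has_space_derivative_vector_derivative(2))
next
  case (Suc j)
  then show ?case unfolding K.simps
    by (intro Cinf_family_mult inverse_v_smooth has_space_derivative_vector_derivative(2))
qed

lemma K_space: "has_space_derivative (K j) (\<lambda>p t. v p t * K (Suc j) p t)"
proof (intro allI impI)
  fix p t :: real assume t: "t \<ge> 0"
  have "v p t * K (Suc j) p t = vector_derivative (\<lambda>x. K j x t) (at p)"
    using v_pos[OF t, of p] by (simp add: K.simps(2))
  then show "((\<lambda>x. K j x t) has_vector_derivative v p t * K (Suc j) p t) (at p)"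
    using has_space_derivative_vector_derivative(1)[OF K_smooth] t by simp
qed

text \<open>
  From \<open>|T| = 1\<close> the derivative of \<open>T\<close> is orthogonal to \<open>T\<close>; by definition its normal component is \<open>v\<close> times
  the curvature.
\<close>

lemma T_space: "has_space_derivative T (\<lambda>p t. \<i> * of_real (v p t * K 0 p t) * T p t)"
proof (intro allI impI)
  fix p t :: real assume t: "t \<ge> 0"
  define T' where "T' = vector_derivative (\<lambda>x. T x t) (at p)"
  have d: "((\<lambda>x. T x t) has_vector_derivative T') (at p)"
    using has_space_derivative_vector_derivative(1)[OF T_smooth] t by (simp add: T'_def)
  have "((\<lambda>x. T x t * cnj (T x t)) has_vector_derivative T p t * cnj T' + T' * cnj (T p t)) (at p)"
    by (intro has_vector_derivative_mult d has_vector_derivative_cnj)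
  then have "T p t * cnj T' + T' * cnj (T p t) = 0"
    using T_cnj[OF t] vector_derivative_unique_at[OF _ has_vector_derivative_const[of 1]] by simp
  then have "Re (cnj (T p t) * T') = 0" by (simp add: complex_eq_iff algebra_simps)
  then have c: "cnj (T p t) * T' = \<i> * of_real (Im (cnj (T p t) * T'))" by (simp add: complex_eq_iff)
  have "T' = (T p t * cnj (T p t)) * T'" by (simp add: T_cnj[OF t])
  also have "\<dots> = (cnj (T p t) * T') * T p t" by (simp add: mult_ac)
  also have "cnj (T p t) * T' = \<i> * of_real (v p t * K 0 p t)"
  proof -
    have "Im (cnj (T p t) * T') = v p t * K 0 p t"
      using v_pos[OF t, of p] by (simp add: K.simps(1) T'_def)
    then show ?thesis by (subst c) (simp only:)
  qed
  finally show "((\<lambda>x. T x t) has_vector_derivative \<i> * of_real (v p t * K 0 p t) * T p t) (at p)"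
    using d by simp
qed

lemma F'_per: "t \<ge> 0 \<Longrightarrow> F' (p + 1) t = F' p t"
  using periodic_vector_derivative[of "\<lambda>x. F x t" "\<lambda>x. F' x t"] F_space F_per by blast

lemma v_per: "t \<ge> 0 \<Longrightarrow> v (p + 1) t = v p t" and T_per: "t \<ge> 0 \<Longrightarrow> T (p + 1) t = T p t"
  by (simp_all add: v_def T_def F'_per)

lemma K_per: "t \<ge> 0 \<Longrightarrow> K j (p + 1) t = K j p t"
proof (induction j arbitrary: p)
  case 0
  have "\<i> * of_real (v (p + 1) t * K 0 (p + 1) t) * T (p + 1) t = \<i> * of_real (v p t * K 0 p t) * T p t"
    by (rule periodic_vector_derivative[of "\<lambda>x. T x t"]) (use T_space T_per 0 in auto)
  then show ?case using T_nz[OF 0, of p] v_pos[OF 0, of p] by (simp add: T_per[OF 0] v_per[OF 0])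
next
  case (Suc j)
  have "v (p + 1) t * K (Suc j) (p + 1) t = v p t * K (Suc j) p t"
    by (rule periodic_vector_derivative[of "\<lambda>x. K j x t"]) (use K_space Suc in auto)
  then show ?case using v_pos[OF Suc.prems, of p] by (simp add: v_per[OF Suc.prems])
qed

lemma slice_continuous: "Cinf_family u \<Longrightarrow> t \<ge> 0 \<Longrightarrow> continuous_on S (\<lambda>p. u p t)"
  using continuous_on_slice Cinf_family_continuous by blast

lemma immersed: "t \<ge> 0 \<Longrightarrow> immersed_closed_curve (\<lambda>p. F p t) (\<lambda>p. F' p t)"
  using F_space F'_nz F_per slice_continuous[OF F'_smooth]
  by unfold_locales auto

text \<open>The parameter of the point at arc length \<open>s\<close> from the base point.\<close>

definition "prm t = immersed_closed_curve.param (\<lambda>p. F p t)"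

lemma flow_curve_eq: "t \<ge> 0 \<Longrightarrow> flow_curve F t = (\<lambda>s. F (prm t s) t)"
  using immersed_closed_curve.param_def[OF immersed]
  by (auto simp: flow_curve_def arc_length_param_def prm_def)

lemma prm_compose_deriv:
  fixes u w :: "real \<Rightarrow> real \<Rightarrow> 'a::real_normed_vector"
  assumes t: "t \<ge> 0" and d: "\<And>p. ((\<lambda>x. u x t) has_vector_derivative v p t *\<^sub>R w p t) (at p)"
  shows "((\<lambda>s. u (prm t s) t) has_vector_derivative w (prm t s) t) (at s)"
  using immersed_closed_curve.compose_param_deriv[OF immersed[OF t], of "\<lambda>x. u x t" "\<lambda>x. w x t"] d
  by (simp add: prm_def v_def)

lemma flow_curve_deriv: "t \<ge> 0 \<Longrightarrow> (flow_curve F t has_vector_derivative T (prm t s) t) (at s)"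
  unfolding flow_curve_eq
  by (rule prm_compose_deriv) (use F_space in \<open>auto simp: scaleR_conv_of_real F'_eq[symmetric]\<close>)

lemma T_prm_deriv:
  "t \<ge> 0 \<Longrightarrow> ((\<lambda>s. T (prm t s) t) has_vector_derivative \<i> * of_real (K 0 (prm t s) t) * T (prm t s) t) (at s)"
  by (rule prm_compose_deriv) (use T_space in \<open>auto simp: scaleR_conv_of_real mult_ac\<close>)

lemma K_prm_deriv:
  "t \<ge> 0 \<Longrightarrow> ((\<lambda>s. K j (prm t s) t) has_vector_derivative K (Suc j) (prm t s) t) (at s)"
  by (rule prm_compose_deriv) (use K_space in auto)

lemma vector_derivative_flow_curve:
  "t \<ge> 0 \<Longrightarrow> vector_derivative (flow_curve F t) (at s) = T (prm t s) t"
  by (rule vector_derivative_at[OF flow_curve_deriv])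

lemma unit_normal_eq: "t \<ge> 0 \<Longrightarrow> unit_normal (flow_curve F t) s = \<i> * T (prm t s) t"
  by (simp add: unit_normal_def vector_derivative_flow_curve complex_eq_iff)

lemma curvature_vector_eq:
  "t \<ge> 0 \<Longrightarrow> curvature_vector (flow_curve F t) s = of_real (K 0 (prm t s) t) * (\<i> * T (prm t s) t)"
  using vector_derivative_at[OF T_prm_deriv] by (simp add: curvature_vector_def vector_derivative_flow_curve mult_ac)

lemma curvature_eq: "t \<ge> 0 \<Longrightarrow> curvature (flow_curve F t) s = K 0 (prm t s) t"
proof -
  assume t: "t \<ge> 0"
  have "(\<i> * T (prm t s) t) \<bullet> (\<i> * T (prm t s) t) = 1"
    using T_unit[OF t, of "prm t s"] by (simp add: dot_square_norm norm_mult)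
  then show ?thesis
    by (simp add: curvature_def curvature_vector_eq[OF t] unit_normal_eq[OF t] scaleR_conv_of_real[symmetric] del: of_real_mult)
qed

lemma arc_length_prm: "t \<ge> 0 \<Longrightarrow> prm t (arc_length (\<lambda>x. F x t) p) = p"
  unfolding prm_def using immersed_closed_curve.param_arc_length[OF immersed] by blast

lemma F_time: "has_time_derivative F (\<lambda>p t. of_real (V p t) * (\<i> * T p t))"
proof (intro allI impI)
  fix p t :: real assume t: "t \<ge> 0"
  have "((\<lambda>u. F p u) has_vector_derivative
           (let s = arc_length (\<lambda>x. F x t) p
            in curvature_vector (flow_curve F t) s -
               (L t / (2 * A t)) *\<^sub>R unit_normal (flow_curve F t) s)) (at t within {0..})"
    using solution t unfolding global_solution_def by blast
  then show "((\<lambda>u. F p u) has_vector_derivative of_real (V p t) * (\<i> * T p t)) (at t within {0..})"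
    by (simp add: Let_def curvature_vector_eq[OF t] unit_normal_eq[OF t] arc_length_prm[OF t] V_def
        scaleR_conv_of_real algebra_simps)
qed

text \<open>
  \<open>V\<close> is read off from the velocity of \<open>F\<close>, whose smoothness is known; its definition contains the length
  and the area, whose time derivatives are found only with the help of this lemma.
\<close>

lemma V_smooth: "Cinf_family V"
proof (rule Cinf_family_cong)
  show "Cinf_family (\<lambda>p t. Im ((of_real (V p t) * (\<i> * T p t)) * cnj (T p t)))"
    by (intro Cinf_family_linear[OF bounded_linear_Im] Cinf_family_mult
        Cinf_family_linear[OF bounded_linear_cnj] Cinf_family_time_derivative[OF F_smooth F_time] T_smooth)
  show "V p t = Im ((of_real (V p t) * (\<i> * T p t)) * cnj (T p t))" if "t \<ge> 0" for p t
    using T_cnj[OF that, of p] by (simp add: mult.assoc)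
qed

lemma V_space: "has_space_derivative V (\<lambda>p t. v p t * K 1 p t)"
proof (intro allI impI)
  fix p t :: real assume t: "t \<ge> 0"
  have "((\<lambda>x. K 0 x t - L t / (2 * A t)) has_vector_derivative v p t * K (Suc 0) p t - 0) (at p)"
    by (intro has_vector_derivative_diff K_space[rule_format] has_vector_derivative_const t)
  then show "((\<lambda>x. V x t) has_vector_derivative v p t * K 1 p t) (at p)" by (simp add: V_def)
qed

lemma F'_time: "has_time_derivative F' (\<lambda>p t. of_real (v p t) * (of_real (K 1 p t) * \<i> - of_real (V p t * K 0 p t)) * T p t)"
proof (rule mixed_derivatives_commute[OF F_space F_time])
  show c: "has_space_derivative (\<lambda>p t. of_real (V p t) * (\<i> * T p t))
     (\<lambda>p t. of_real (v p t) * (of_real (K 1 p t) * \<i> - of_real (V p t * K 0 p t)) * T p t)"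
  proof (intro allI impI)
    fix p t :: real assume t: "t \<ge> 0"
    have "((\<lambda>x. of_real (V x t) * (\<i> * T x t)) has_vector_derivative
      of_real (V p t) * (\<i> * (\<i> * of_real (v p t * K 0 p t) * T p t)) + of_real (v p t * K 1 p t) * (\<i> * T p t)) (at p)"
      by (intro has_vector_derivative_mult has_vector_derivative_mult_right has_vector_derivative_complex_of_real
          V_space[rule_format] T_space[rule_format] t)
    then show "((\<lambda>x. of_real (V x t) * (\<i> * T x t)) has_vector_derivative
      of_real (v p t) * (of_real (K 1 p t) * \<i> - of_real (V p t * K 0 p t)) * T p t) (at p)"
      by (simp add: algebra_simps)
  qed
  show "continuous_on (UNIV \<times> {0..}) (\<lambda>(p, t). F' p t)" by (rule Cinf_family_continuous[OF F'_smooth])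
  show "continuous_on (UNIV \<times> {0..}) (\<lambda>(p, t). of_real (V p t) * (\<i> * T p t))"
    by (rule Cinf_family_continuous[OF Cinf_family_time_derivative[OF F_smooth F_time]])
  show "continuous_on (UNIV \<times> {0..}) (\<lambda>(p, t). of_real (v p t) * (of_real (K 1 p t) * \<i> - of_real (V p t * K 0 p t)) * T p t)"
    by (rule Cinf_family_continuous[OF Cinf_family_space_derivative[OF
          Cinf_family_time_derivative[OF F_smooth F_time] c]])
qed

text \<open>Half the time derivative of \<open>v\<^sup>2 = F' \<bullet> F'\<close>, divided by \<open>v\<close>.\<close>

lemma v_time: "has_time_derivative v (\<lambda>p t. - (V p t * K 0 p t) * v p t)"
proof (intro allI impI)
  fix p t :: real assume t: "t \<ge> 0"
  obtain w where w: "has_time_derivative v w" using Cinf_family_derivatives_exist(2)[OF v_smooth] by blast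
  let ?F = "of_real (v p t) * (of_real (K 1 p t) * \<i> - of_real (V p t * K 0 p t)) * T p t"
  have d1: "((\<lambda>\<tau>. v p \<tau> * v p \<tau>) has_vector_derivative v p t * w p t + w p t * v p t) (at t within {0..})"
    by (intro has_vector_derivative_mult w[rule_format] t)
  have e: "(\<lambda>\<tau>. F' p \<tau> \<bullet> F' p \<tau>) = (\<lambda>\<tau>. v p \<tau> * v p \<tau>)"
    by (simp add: v_def dot_square_norm power2_eq_square)
  have "((\<lambda>\<tau>. F' p \<tau> \<bullet> F' p \<tau>) has_vector_derivative F' p t \<bullet> ?F + ?F \<bullet> F' p t) (at t within {0..})"
    by (intro bounded_bilinear.has_vector_derivative[OF bounded_bilinear_inner] F'_time[rule_format] t)
  from vector_derivative_unique_Ici[OF d1 this[unfolded e] t]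
  have "v p t * w p t + w p t * v p t = F' p t \<bullet> ?F + ?F \<bullet> F' p t" .
  moreover have "F' p t \<bullet> ?F = v p t * (v p t * (- (V p t * K 0 p t)))"
  proof -
    have "cnj (F' p t) * ?F = of_real (v p t * v p t) * (of_real (K 1 p t) * \<i> - of_real (V p t * K 0 p t)) * (T p t * cnj (T p t))"
      by (simp add: F'_eq[OF t] mult_ac)
    also have "Re \<dots> = v p t * (v p t * (- (V p t * K 0 p t)))" by (simp add: T_cnj[OF t])
    finally show ?thesis by (simp add: inner_eq_Re)
  qed
  moreover have "?F \<bullet> F' p t = F' p t \<bullet> ?F" by (rule inner_commute)
  moreover have "v p t * w p t + w p t * v p t = 2 * (v p t * w p t)" by simp
  ultimately have "v p t * w p t = v p t * (v p t * (- (V p t * K 0 p t)))" by linarith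
  then have "v p t * w p t = v p t * (- (V p t * K 0 p t) * v p t)" by (simp only: mult.commute)
  then have "w p t = - (V p t * K 0 p t) * v p t"
    using v_pos[OF t, of p] by (simp only: mult_cancel_left) simp
  then show "((\<lambda>\<tau>. v p \<tau>) has_vector_derivative - (V p t * K 0 p t) * v p t) (at t within {0..})"
    using w t by metis
qed

text \<open>Both sides of \<open>F' = v T\<close> are differentiated in time.\<close>

lemma T_time: "has_time_derivative T (\<lambda>p t. of_real (K 1 p t) * \<i> * T p t)"
proof (intro allI impI)
  fix p t :: real assume t: "t \<ge> 0"
  obtain w where w: "has_time_derivative T w" using Cinf_family_derivatives_exist(2)[OF T_smooth] by blast
  have "((\<lambda>\<tau>. of_real (v p \<tau>) * T p \<tau>) has_vector_derivative
      of_real (v p t) * w p t + of_real (- (V p t * K 0 p t) * v p t) * T p t) (at t within {0..})"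
    by (intro has_vector_derivative_mult has_vector_derivative_complex_of_real w[rule_format] v_time[rule_format] t)
  moreover have "((\<lambda>\<tau>. of_real (v p \<tau>) * T p \<tau>) has_vector_derivative
     of_real (v p t) * (of_real (K 1 p t) * \<i> - of_real (V p t * K 0 p t)) * T p t) (at t within {0..})"
    by (rule has_vector_derivative_transform[OF _ _ F'_time[rule_format, OF t]]) (use t F'_eq in auto)
  ultimately have "of_real (v p t) * w p t + of_real (- (V p t * K 0 p t) * v p t) * T p t
     = of_real (v p t) * (of_real (K 1 p t) * \<i> - of_real (V p t * K 0 p t)) * T p t"
    using vector_derivative_unique_Ici t by blast
  then have "of_real (v p t) * w p t = of_real (v p t) * (of_real (K 1 p t) * \<i> * T p t)"
    by (simp add: algebra_simps)
  then have "w p t = of_real (K 1 p t) * \<i> * T p t" using v_pos[OF t, of p] by simp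
  then show "((\<lambda>\<tau>. T p \<tau>) has_vector_derivative of_real (K 1 p t) * \<i> * T p t) (at t within {0..})"
    using w t by metis
qed

text \<open>The mixed derivative of \<open>T\<close> is computed in both orders.\<close>

lemma K0_time: "has_time_derivative (K 0) (\<lambda>p t. K 2 p t + (K 0 p t)\<^sup>2 * V p t)"
proof (intro allI impI)
  fix p t :: real assume t: "t \<ge> 0"
  obtain w where w: "has_time_derivative (K 0) w" using Cinf_family_derivatives_exist(2)[OF K_smooth] by blast
  define H where "H p t = of_real (K 1 p t) * \<i> * T p t" for p t
  define H' where "H' p t = of_real (K 1 p t) * \<i> * (\<i> * of_real (v p t * K 0 p t) * T p t)
      + of_real (v p t * K (Suc 1) p t) * \<i> * T p t" for p t
  have Ht: "has_time_derivative T H" using T_time by (simp add: H_def)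
  have H': "has_space_derivative H H'"
    unfolding H_def H'_def
    by (intro allI impI has_vector_derivative_mult has_vector_derivative_mult_left has_vector_derivative_complex_of_real
          K_space[rule_format] T_space[rule_format])
  have Hs: "Cinf_family H" by (rule Cinf_family_time_derivative[OF T_smooth Ht])
  have m: "has_time_derivative (\<lambda>p t. \<i> * of_real (v p t * K 0 p t) * T p t) H'"
    by (rule mixed_derivatives_commute[OF T_space Ht H'])
       (intro Cinf_family_continuous Hs Cinf_family_space_derivative[OF Hs H'] Cinf_family_space_derivative[OF T_smooth T_space])+
  have "((\<lambda>\<tau>. \<i> * of_real (v p \<tau> * K 0 p \<tau>) * T p \<tau>) has_vector_derivative
     \<i> * of_real (v p t * K 0 p t) * H p t
     + \<i> * of_real (v p t * w p t + - (V p t * K 0 p t) * v p t * K 0 p t) * T p t) (at t within {0..})"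
    by (intro has_vector_derivative_mult has_vector_derivative_mult_right has_vector_derivative_complex_of_real
        w[rule_format] v_time[rule_format] Ht[rule_format] t)
  then have "\<i> * of_real (v p t * K 0 p t) * H p t
     + \<i> * of_real (v p t * w p t + - (V p t * K 0 p t) * v p t * K 0 p t) * T p t = H' p t"
    using vector_derivative_unique_Ici m t by blast
  then have "\<i> * T p t * of_real (v p t * w p t) = \<i> * T p t * of_real (v p t * (K 2 p t + (K 0 p t)\<^sup>2 * V p t))"
    by (simp add: H_def H'_def numeral_2_eq_2 power2_eq_square algebra_simps)
  then have "w p t = K 2 p t + (K 0 p t)\<^sup>2 * V p t"
    using v_pos[OF t, of p] T_nz[OF t, of p] by (simp del: of_real_mult of_real_add)
  then show "((\<lambda>\<tau>. K 0 p \<tau>) has_vector_derivative K 2 p t + (K 0 p t)\<^sup>2 * V p t) (at t within {0..})"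
    using w t by metis
qed

text \<open>
  Time derivative and arc-length derivative have the commutator \<open>K 0 V\<close> times the arc-length derivative,
  because the speed changes at the rate \<open>- V K 0\<close>.
\<close>

lemma K_Suc_time:
  assumes b: "has_time_derivative (K j) b" and c: "has_space_derivative b (\<lambda>p t. v p t * c p t)"
  shows "has_time_derivative (K (Suc j)) (\<lambda>p t. c p t + K 0 p t * V p t * K (Suc j) p t)"
proof (intro allI impI)
  fix p t :: real assume t: "t \<ge> 0"
  obtain w where w: "has_time_derivative (K (Suc j)) w" using Cinf_family_derivatives_exist(2)[OF K_smooth] by blast
  have bs: "Cinf_family b" by (rule Cinf_family_time_derivative[OF K_smooth b])
  have m: "has_time_derivative (\<lambda>p t. v p t * K (Suc j) p t) (\<lambda>p t. v p t * c p t)"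
    by (rule mixed_derivatives_commute[OF K_space b c])
       (intro Cinf_family_continuous bs Cinf_family_space_derivative[OF bs c] Cinf_family_space_derivative[OF K_smooth K_space])+
  have "((\<lambda>\<tau>. v p \<tau> * K (Suc j) p \<tau>) has_vector_derivative
     v p t * w p t + - (V p t * K 0 p t) * v p t * K (Suc j) p t) (at t within {0..})"
    by (intro has_vector_derivative_mult w[rule_format] v_time[rule_format] t)
  then have "v p t * w p t + - (V p t * K 0 p t) * v p t * K (Suc j) p t = v p t * c p t"
    using vector_derivative_unique_Ici m t by blast
  then have "v p t * w p t = v p t * (c p t + K 0 p t * V p t * K (Suc j) p t)"
    by (simp add: algebra_simps)
  then have "w p t = c p t + K 0 p t * V p t * K (Suc j) p t" using v_pos[OF t, of p] by simp
  then show "((\<lambda>\<tau>. K (Suc j) p \<tau>) has_vector_derivative c p t + K 0 p t * V p t * K (Suc j) p t) (at t within {0..})"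
    using w t by metis
qed

section \<open>Integrals with respect to arc length\<close>

definition arc_integral :: "(real \<Rightarrow> real \<Rightarrow> 'a::euclidean_space) \<Rightarrow> real \<Rightarrow> 'a" where
  "arc_integral u t = integral {0..1} (\<lambda>p. v p t *\<^sub>R u p t)"

lemma arc_integral_eq:
  assumes "continuous_on UNIV (\<lambda>p. u p t)" "t \<ge> 0"
  shows "integral {0..L t} (\<lambda>s. u (prm t s) t) = arc_integral u t"
  using immersed_closed_curve.integral_param[OF immersed[OF assms(2)] assms(1)]
  by (simp add: arc_integral_def prm_def flow_length_def v_def)

text \<open>The length element shrinks at the rate \<open>V K 0\<close>.\<close>

lemma arc_integral_time:
  assumes u: "Cinf_family u" and d: "has_time_derivative u u'" and t: "t \<ge> 0"
  shows "(arc_integral u has_vector_derivative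
     arc_integral (\<lambda>p t. u' p t - (V p t * K 0 p t) *\<^sub>R u p t) t) (at t within {0..})"
proof -
  have u': "Cinf_family u'" by (rule Cinf_family_time_derivative[OF u d])
  have "((\<lambda>t. integral {0..1} (\<lambda>p. v p t *\<^sub>R u p t)) has_vector_derivative
      integral {0..1} (\<lambda>p. v p t *\<^sub>R u' p t + (- (V p t * K 0 p t) * v p t) *\<^sub>R u p t)) (at t within {0..})"
  proof (rule has_time_derivative_integral)
    show "has_time_derivative (\<lambda>p t. v p t *\<^sub>R u p t) (\<lambda>p t. v p t *\<^sub>R u' p t + (- (V p t * K 0 p t) * v p t) *\<^sub>R u p t)"
      by (intro allI impI bounded_bilinear.has_vector_derivative[OF bounded_bilinear_scaleR]
          v_time[rule_format] d[rule_format])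
    show "continuous_on (UNIV \<times> {0..}) (\<lambda>(p, t). v p t *\<^sub>R u p t)"
      using Cinf_family_continuous[OF u] Cinf_family_continuous[OF v_smooth]
      by (auto simp: split_beta intro!: continuous_intros)
    show "continuous_on (UNIV \<times> {0..}) (\<lambda>(p, t). v p t *\<^sub>R u' p t + (- (V p t * K 0 p t) * v p t) *\<^sub>R u p t)"
      using Cinf_family_continuous[OF u] Cinf_family_continuous[OF u'] Cinf_family_continuous[OF v_smooth]
        Cinf_family_continuous[OF V_smooth] Cinf_family_continuous[OF K_smooth[of 0]]
      by (auto simp: split_beta intro!: continuous_intros)
  qed (rule t)
  then show ?thesis
    by (simp add: arc_integral_def[abs_def] scaleR_diff_right algebra_simps)
qed

lemma arc_integral_derivative:
  fixes w w' :: "real \<Rightarrow> real \<Rightarrow> 'a::euclidean_space"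
  assumes d: "\<And>p. ((\<lambda>x. w x t) has_vector_derivative v p t *\<^sub>R w' p t) (at p)" and per: "w 1 t = w 0 t"
  shows "arc_integral w' t = 0"
proof -
  have "((\<lambda>p. v p t *\<^sub>R w' p t) has_integral w 1 t - w 0 t) {0..1}"
    by (intro fundamental_theorem_of_calculus d[THEN has_vector_derivative_at_within]) simp
  then show ?thesis by (simp add: arc_integral_def per integral_unique)
qed

lemma L_eq: "t \<ge> 0 \<Longrightarrow> L t = arc_integral (\<lambda>p t. 1) t"
  using vector_derivative_at[OF F_space[rule_format]]
  by (simp add: flow_length_def curve_length_def arc_integral_def v_def)

lemma A_eq: "t \<ge> 0 \<Longrightarrow> A t = arc_integral (\<lambda>p t. Im (cnj (F p t) * T p t)) t / 2"
proof -
  assume t: "t \<ge> 0"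
  have "A t = - (1/2) * integral {0..L t} (\<lambda>s. F (prm t s) t \<bullet> (\<i> * T (prm t s) t))"
    unfolding flow_area_def signed_area_def unit_normal_eq[OF t] by (simp add: flow_curve_eq[OF t])
  also have "integral {0..L t} (\<lambda>s. F (prm t s) t \<bullet> (\<i> * T (prm t s) t)) = arc_integral (\<lambda>p t. F p t \<bullet> (\<i> * T p t)) t"
    by (rule arc_integral_eq[where u="\<lambda>p t. F p t \<bullet> (\<i> * T p t)"])
       (intro continuous_intros slice_continuous[OF F_smooth t] slice_continuous[OF T_smooth t] t)+
  also have "(\<lambda>p t. F p t \<bullet> (\<i> * T p t)) = (\<lambda>p t. - Im (cnj (F p t) * T p t))"
    by (simp add: inner_complex_def fun_eq_iff)
  also have "arc_integral (\<lambda>p t. - Im (cnj (F p t) * T p t)) t = - arc_integral (\<lambda>p t. Im (cnj (F p t) * T p t)) t"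
    by (simp only: arc_integral_def scaleR_minus_right integral_neg)
  finally show ?thesis by simp
qed

lemma unit_speed: "t \<ge> 0 \<Longrightarrow>
    unit_speed_curve (flow_curve F t) (\<lambda>s. T (prm t s) t) (\<lambda>s. K 0 (prm t s) t) (L t)"
proof
  assume t: "t \<ge> 0"
  note im = immersed[OF t]
  show "L t > 0" using immersed_closed_curve.curve_length_pos[OF im] by (simp add: flow_length_def)
  have s: "prm t (s + L t) = prm t s + 1" for s
    using immersed_closed_curve.param_shift[OF im] by (simp add: prm_def flow_length_def)
  show "flow_curve F t (s + L t) = flow_curve F t s" for s
    by (simp add: flow_curve_eq[OF t] s F_per[OF t])
  show "T (prm t (s + L t)) t = T (prm t s) t" for s by (simp add: s T_per[OF t])
  show "continuous_on UNIV (\<lambda>s. K 0 (prm t s) t)"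
    by (rule continuous_on_vector_derivative[OF has_vector_derivative_at_within[OF K_prm_deriv[OF t]]])
qed (auto intro: flow_curve_deriv T_prm_deriv T_unit)

lemma arc_integral_add:
  assumes "continuous_on {0..1} (\<lambda>p. u p t)" "continuous_on {0..1} (\<lambda>p. w p t)" "t \<ge> 0"
  shows "arc_integral (\<lambda>p t. u p t + w p t) t = arc_integral u t + arc_integral w t"
  unfolding arc_integral_def scaleR_add_right
  by (intro integral_add integrable_continuous_real continuous_intros assms slice_continuous[OF v_smooth])

lemma arc_integral_diff:
  assumes "continuous_on {0..1} (\<lambda>p. u p t)" "continuous_on {0..1} (\<lambda>p. w p t)" "t \<ge> 0"
  shows "arc_integral (\<lambda>p t. u p t - w p t) t = arc_integral u t - arc_integral w t"
  unfolding arc_integral_def scaleR_diff_right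
  by (intro integral_diff integrable_continuous_real continuous_intros assms slice_continuous[OF v_smooth])

lemma arc_integral_cmult: "arc_integral (\<lambda>p t. c t * u p t :: real) t = c t * arc_integral u t"
  unfolding arc_integral_def by (simp add: mult.left_commute)

lemma arc_integral_const: "t \<ge> 0 \<Longrightarrow> arc_integral (\<lambda>p t. c t :: real) t = c t * L t"
  using arc_integral_cmult[of c "\<lambda>_ _. 1" t] by (simp add: L_eq)

lemma arc_integral_mono:
  fixes u w :: "real \<Rightarrow> real \<Rightarrow> real"
  assumes "continuous_on {0..1} (\<lambda>p. u p t)" "continuous_on {0..1} (\<lambda>p. w p t)" "t \<ge> 0"
    and "\<And>p. u p t \<le> w p t"
  shows "arc_integral u t \<le> arc_integral w t"
  unfolding arc_integral_def
  using assms(3,4) v_pos[OF assms(3)]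
  by (intro integral_le integrable_continuous_real continuous_intros assms(1,2) slice_continuous[OF v_smooth])
     (auto intro!: mult_left_mono less_imp_le)

lemma arc_integral_nonneg:
  fixes u :: "real \<Rightarrow> real \<Rightarrow> real"
  assumes "continuous_on {0..1} (\<lambda>p. u p t)" "t \<ge> 0" "\<And>p. u p t \<ge> 0"
  shows "arc_integral u t \<ge> 0"
  using arc_integral_mono[of "\<lambda>_ _. 0" t u] assms by (simp add: arc_integral_def)

lemma arc_integral_cauchy_schwarz:
  fixes u w :: "real \<Rightarrow> real \<Rightarrow> real"
  assumes "continuous_on {0..1} (\<lambda>p. u p t)" "continuous_on {0..1} (\<lambda>p. w p t)" "t \<ge> 0"
  shows "(arc_integral (\<lambda>p t. u p t * w p t) t)\<^sup>2
    \<le> arc_integral (\<lambda>p t. (u p t)\<^sup>2) t * arc_integral (\<lambda>p t. (w p t)\<^sup>2) t"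
  using integral_cauchy_schwarz[OF assms(1,2) slice_continuous[OF v_smooth assms(3)]]
    v_pos[OF assms(3)] by (simp add: arc_integral_def mult.commute[of "v _ _"] less_imp_le mult.assoc)

text \<open>Cauchy--Schwarz for the total variation over one period.\<close>

lemma oscillation_le:
  fixes u w :: "real \<Rightarrow> real \<Rightarrow> real"
  assumes t: "t \<ge> 0" and d: "\<And>p. ((\<lambda>x. u x t) has_vector_derivative v p t * w p t) (at p)"
    and per: "\<And>p. u (p + 1) t = u p t" and cw: "continuous_on {0..1} (\<lambda>p. w p t)"
  shows "(u p t - u q t)\<^sup>2 \<le> L t * arc_integral (\<lambda>p t. (w p t)\<^sup>2) t"
proof -
  have cv: "continuous_on S (\<lambda>p. v p t)" for S by (rule slice_continuous[OF v_smooth t])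
  define N where "N = arc_integral (\<lambda>p t. \<bar>w p t\<bar>) t"
  have N: "\<bar>u y t - u x t\<bar> \<le> N" if xy: "0 \<le> x" "x \<le> y" "y \<le> 1" for x y
  proof -
    have "((\<lambda>p. v p t * w p t) has_integral u y t - u x t) {x..y}"
      using xy by (intro fundamental_theorem_of_calculus d[THEN has_vector_derivative_at_within])
    then have "\<bar>u y t - u x t\<bar> = norm (integral {x..y} (\<lambda>p. v p t * w p t))" by (simp add: integral_unique)
    also have "\<dots> \<le> integral {x..y} (\<lambda>p. v p t * \<bar>w p t\<bar>)"
      using xy v_pos[OF t]
      by (intro integral_norm_bound_integral integrable_continuous_real continuous_intros cv continuous_on_subset[OF cw])
         (auto simp: abs_mult less_imp_le)
    also have "\<dots> \<le> N"
      unfolding N_def arc_integral_def real_scaleR_def using xy v_pos[OF t]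
      by (intro integral_subset_le integrable_continuous_real continuous_intros cv continuous_on_subset[OF cw])
         (auto simp: less_imp_le)
    finally show ?thesis .
  qed
  have f: "0 \<le> frac x" "frac x \<le> 1" for x :: real using frac_lt_1[of x] by (auto simp: less_imp_le)
  have "\<bar>u (frac p) t - u (frac q) t\<bar> \<le> N"
    using N[of "frac p" "frac q"] N[of "frac q" "frac p"] f by (cases "frac p \<le> frac q") auto
  then have "\<bar>u p t - u q t\<bar> \<le> N"
    using periodic_frac[where f="\<lambda>x. u x t", OF per] by simp
  then have "(u p t - u q t)\<^sup>2 \<le> N\<^sup>2" by (metis abs_ge_zero power2_abs power_mono)
  also have "\<dots> \<le> arc_integral (\<lambda>p t. (1::real)\<^sup>2) t * arc_integral (\<lambda>p t. \<bar>w p t\<bar>\<^sup>2) t"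
    using arc_integral_cauchy_schwarz[of "\<lambda>_ _. 1" t "\<lambda>p t. \<bar>w p t\<bar>"] t cw
    by (simp add: N_def continuous_intros)
  finally show ?thesis using t by (simp add: L_eq)
qed

lemma K_cont: "t \<ge> 0 \<Longrightarrow> continuous_on S (\<lambda>p. K j p t)"
  by (rule slice_continuous[OF K_smooth])

lemma V_cont: "t \<ge> 0 \<Longrightarrow> continuous_on S (\<lambda>p. V p t)"
  by (rule slice_continuous[OF V_smooth])

lemma L_pos: "t \<ge> 0 \<Longrightarrow> L t > 0"
  using unit_speed_curve.L_pos[OF unit_speed] .

lemma rotation_number_eq:
  "t \<ge> 0 \<Longrightarrow> rotation_number (L t) (flow_curve F t) = arc_integral (K 0) t / (2 * pi)"
proof -
  assume t: "t \<ge> 0"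
  have "curvature (flow_curve F t) = (\<lambda>s. K 0 (prm t s) t)" by (simp add: fun_eq_iff curvature_eq[OF t])
  moreover have "integral {0..L t} (\<lambda>s. K 0 (prm t s) t) = arc_integral (K 0) t"
    by (rule arc_integral_eq[where u="K 0", OF K_cont[OF t] t])
  ultimately show ?thesis by (simp add: rotation_number_def)
qed

text \<open>Every value of \<open>u\<close> differs from \<open>u p t\<close> by at most the oscillation, hence so does the mean.\<close>

lemma deviation_from_mean_le:
  fixes u w :: "real \<Rightarrow> real \<Rightarrow> real"
  assumes t: "t \<ge> 0" and d: "\<And>p. ((\<lambda>x. u x t) has_vector_derivative v p t * w p t) (at p)"
    and per: "\<And>p. u (p + 1) t = u p t" and cw: "continuous_on {0..1} (\<lambda>p. w p t)"
    and mean: "arc_integral u t = m * L t"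
  shows "(u p t - m)\<^sup>2 \<le> L t * arc_integral (\<lambda>p t. (w p t)\<^sup>2) t"
proof -
  define N where "N = sqrt (L t * arc_integral (\<lambda>p t. (w p t)\<^sup>2) t)"
  have cu: "continuous_on {0..1} (\<lambda>p. u p t)"
    by (rule continuous_on_vector_derivative[OF has_vector_derivative_at_within[OF d]])
  have N2: "N\<^sup>2 = L t * arc_integral (\<lambda>p t. (w p t)\<^sup>2) t"
    unfolding N_def using L_pos[OF t] arc_integral_nonneg[of "\<lambda>p t. (w p t)\<^sup>2"] t cw
    by (simp add: continuous_intros)
  have N: "\<bar>u p t - u q t\<bar> \<le> N" for q
  proof -
    have "sqrt ((u p t - u q t)\<^sup>2) \<le> N" unfolding N_def
      by (intro real_sqrt_le_mono oscillation_le[where u=u and w=w and t=t, OF t d per cw])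
    then show ?thesis by simp
  qed
  have le: "u q t \<le> u p t + N" "u p t - N \<le> u q t" for q using N[of q] by linarith+
  have "arc_integral u t \<le> arc_integral (\<lambda>_ _. u p t + N) t"
    by (intro arc_integral_mono cu t le continuous_on_const)
  then have "arc_integral u t \<le> (u p t + N) * L t"
    using arc_integral_const[OF t, of "\<lambda>_. u p t + N"] by simp
  moreover have "arc_integral (\<lambda>_ _. u p t - N) t \<le> arc_integral u t"
    by (intro arc_integral_mono cu t le continuous_on_const)
  then have "(u p t - N) * L t \<le> arc_integral u t"
    using arc_integral_const[OF t, of "\<lambda>_. u p t - N"] by simp
  ultimately have "\<bar>u p t - m\<bar> \<le> N" using L_pos[OF t] unfolding mean by (auto simp: abs_le_iff)
  then show ?thesis unfolding N2[symmetric] by (metis abs_ge_zero power2_abs power_mono)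
qed

text \<open>
  \<open>\<kappa>\<^sub>0\<close> is the curvature of the circle of the same length, and the mean curvature of a curve with rotation
  number 1. The deficit \<open>D\<close> and the energy \<open>E0\<close> vanish exactly on circles traversed once
  counterclockwise.
\<close>

definition "lam t = L t / (2 * A t)"
definition "\<kappa>\<^sub>0 t = 2 * pi / L t"
definition "D t = (L t)\<^sup>2 - 4 * pi * A t"
definition "E0 t = arc_integral (\<lambda>p t. (K 0 p t - \<kappa>\<^sub>0 t)\<^sup>2) t"
definition "E j t = arc_integral (\<lambda>p t. (K j p t)\<^sup>2) t"

lemma V_eq: "V p t = K 0 p t - lam t" by (simp add: V_def lam_def)

lemma area_eq: "t \<ge> 0 \<Longrightarrow>
   unit_speed_curve.area (flow_curve F t) (\<lambda>s. T (prm t s) t) (L t) = A t"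
proof -
  assume t: "t \<ge> 0"
  have "integral {0..L t} (\<lambda>s. Im (cnj (F (prm t s) t) * T (prm t s) t)) = arc_integral (\<lambda>p t. Im (cnj (F p t) * T p t)) t"
    by (rule arc_integral_eq[where u="\<lambda>p t. Im (cnj (F p t) * T p t)"])
       (intro continuous_intros slice_continuous[OF F_smooth t] slice_continuous[OF T_smooth t] t)+
  then show ?thesis
    unfolding unit_speed_curve.area_def[OF unit_speed[OF t]] A_eq[OF t]
    unfolding flow_curve_eq[OF t] by (simp only:)
qed

lemma D_nonneg: "t \<ge> 0 \<Longrightarrow> D t \<ge> 0"
  using unit_speed_curve.isoperimetric_inequality[OF unit_speed] by (simp add: D_def area_eq)

lemma D_le_E0: "t \<ge> 0 \<Longrightarrow> D t \<le> (L t) ^ 3 * E0 t"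
proof -
  assume t: "t \<ge> 0"
  have "integral {0..L t} (\<lambda>s. (K 0 (prm t s) t - \<kappa>\<^sub>0 t)\<^sup>2) = E0 t"
    unfolding E0_def by (rule arc_integral_eq[where u="\<lambda>p t. (K 0 p t - \<kappa>\<^sub>0 t)\<^sup>2"]) (intro continuous_intros K_cont t)+
  then show ?thesis
    using unit_speed_curve.isoperimetric_deficit_le[OF unit_speed[OF t]]
    by (simp add: D_def area_eq[OF t] unit_speed_curve.\<omega>_def[OF unit_speed[OF t]] \<kappa>\<^sub>0_def)
qed

end

section \<open>Length, area and isoperimetric deficit along the flow\<close>

locale area_flow = smooth_flow +
  assumes rotation_0: "arc_integral (K 0) 0 = 2 * pi" and A_0: "A 0 > 0"
begin

text \<open>In the evolution of the curvature measure the reaction terms cancel and an exact derivative remains.\<close>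

lemma rotation: "t \<ge> 0 \<Longrightarrow> arc_integral (K 0) t = 2 * pi"
proof -
  assume t: "t \<ge> 0"
  have "(arc_integral (K 0) has_vector_derivative 0) (at t within {0..})" if t: "t \<ge> 0" for t
  proof -
    have "(arc_integral (K 0) has_vector_derivative
      arc_integral (\<lambda>p t. K 2 p t + (K 0 p t)\<^sup>2 * V p t - (V p t * K 0 p t) *\<^sub>R K 0 p t) t) (at t within {0..})"
      by (rule arc_integral_time[OF K_smooth K0_time t])
    also have "(\<lambda>p t. K 2 p t + (K 0 p t)\<^sup>2 * V p t - (V p t * K 0 p t) *\<^sub>R K 0 p t) = K 2"
      by (simp add: power2_eq_square fun_eq_iff)
    also have "arc_integral (K 2) t = 0"
      by (rule arc_integral_derivative[where w="K 1"])
         (use K_space[of 1] K_per[OF t, of 1 0] t in \<open>auto simp: numeral_2_eq_2\<close>)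
    finally show ?thesis .
  qed
  then obtain c where "\<And>t. t \<in> {0..} \<Longrightarrow> arc_integral (K 0) t = c"
    using has_vector_derivative_zero_constant[of "{0::real..}" "arc_integral (K 0)"] by auto
  then show ?thesis using t rotation_0 by force
qed

lemma L_time: "t \<ge> 0 \<Longrightarrow> (flow_length F has_vector_derivative - arc_integral (\<lambda>p t. V p t * K 0 p t) t) (at t within {0..})"
proof -
  assume t: "t \<ge> 0"
  have "(arc_integral (\<lambda>p t. 1::real) has_vector_derivative
      arc_integral (\<lambda>p t. 0 - (V p t * K 0 p t) *\<^sub>R (1::real)) t) (at t within {0..})"
    by (rule arc_integral_time[OF Cinf_family_const _ t]) auto
  moreover have "arc_integral (\<lambda>p t. 0 - (V p t * K 0 p t) *\<^sub>R (1::real)) t = - arc_integral (\<lambda>p t. V p t * K 0 p t) t"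
    using arc_integral_cmult[of "\<lambda>_. -1" "\<lambda>p t. V p t * K 0 p t" t] by simp
  ultimately have "(arc_integral (\<lambda>p t. 1::real) has_vector_derivative
      - arc_integral (\<lambda>p t. V p t * K 0 p t) t) (at t within {0..})" by (simp only:)
  then show ?thesis by (rule has_vector_derivative_transform[rotated 2]) (use t in \<open>auto simp: L_eq\<close>)
qed

text \<open>
  Twice the area is the integral of \<open>u = Im (cnj F * T)\<close>. The integrand of its time derivative is \<open>- 2 V\<close>
  plus the exact derivative of \<open>w\<close>.
\<close>

lemma A_time: "t \<ge> 0 \<Longrightarrow> (flow_area F has_vector_derivative - arc_integral V t) (at t within {0..})"
proof -
  assume t: "t \<ge> 0"
  define u where "u p t = Im (cnj (F p t) * T p t)" for p t
  define u' where "u' p t = Im (cnj (F p t) * (of_real (K 1 p t) * \<i> * T p t) + cnj (of_real (V p t) * (\<i> * T p t)) * T p t)" for p t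
  define w where "w p t = V p t * Re (cnj (F p t) * T p t)" for p t
  define w' where "w' p t = K 1 p t * Re (cnj (F p t) * T p t) + V p t
      - V p t * K 0 p t * Im (cnj (F p t) * T p t)" for p t
  have us: "Cinf_family u" unfolding u_def
    by (intro Cinf_family_linear[OF bounded_linear_Im] Cinf_family_mult Cinf_family_linear[OF bounded_linear_cnj] F_smooth T_smooth)
  have ut: "has_time_derivative u u'" unfolding u_def u'_def
    by (intro allI impI bounded_linear.has_vector_derivative[OF bounded_linear_Im] has_vector_derivative_mult
         has_vector_derivative_cnj F_time[rule_format] T_time[rule_format])
  have eq: "u' p t - (V p t * K 0 p t) *\<^sub>R u p t = w' p t - 2 * V p t" if "t \<ge> 0" for p t
  proof -
    have "cnj (of_real (V p t) * (\<i> * T p t)) * T p t = - of_real (V p t) * \<i> * (T p t * cnj (T p t))"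
      by (simp add: mult_ac)
    then have "cnj (of_real (V p t) * (\<i> * T p t)) * T p t = - of_real (V p t) * \<i>" by (simp add: T_cnj[OF that])
    moreover have "cnj (F p t) * (of_real (K 1 p t) * \<i> * T p t) = of_real (K 1 p t) * \<i> * (cnj (F p t) * T p t)"
      by (simp add: mult_ac)
    moreover have "Im (of_real a * \<i> * z + - of_real b * \<i>) = a * Re z - b" for a b z by simp
    ultimately have "u' p t = K 1 p t * Re (cnj (F p t) * T p t) - V p t" unfolding u'_def by (simp only:)
    then show ?thesis by (simp add: w'_def u_def)
  qed
  have wd: "((\<lambda>x. w x t) has_vector_derivative v p t *\<^sub>R w' p t) (at p)" for p
  proof -
    have "((\<lambda>x. w x t) has_vector_derivative
       V p t * Re (cnj (F p t) * (\<i> * of_real (v p t * K 0 p t) * T p t) + cnj (F' p t) * T p t)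
       + v p t * K 1 p t * Re (cnj (F p t) * T p t)) (at p)"
      unfolding w_def
      by (intro has_vector_derivative_mult bounded_linear.has_vector_derivative[OF bounded_linear_Re]
        has_vector_derivative_cnj F_space[rule_format] T_space[rule_format] V_space[rule_format] t)
    moreover have "cnj (F' p t) * T p t = of_real (v p t) * (T p t * cnj (T p t))"
      by (simp add: F'_eq[OF t] mult_ac)
    then have "cnj (F' p t) * T p t = of_real (v p t)" by (simp add: T_cnj[OF t])
    moreover have "cnj (F p t) * (\<i> * of_real (v p t * K 0 p t) * T p t) = \<i> * of_real (v p t * K 0 p t) * (cnj (F p t) * T p t)"
      by (simp add: mult_ac)
    moreover have "Re (\<i> * of_real a * z + of_real b) = b - a * Im z" for a b z by simp
    ultimately have "((\<lambda>x. w x t) has_vector_derivative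
       V p t * (v p t - v p t * K 0 p t * Im (cnj (F p t) * T p t)) + v p t * K 1 p t * Re (cnj (F p t) * T p t)) (at p)"
      by (simp only:)
    then show ?thesis unfolding w'_def real_scaleR_def by (rule has_vector_derivative_eq_rhs) (simp add: algebra_simps)
  qed
  have w0: "arc_integral w' t = 0"
    by (rule arc_integral_derivative[where w=w and w'=w' and t=t, OF wd]) (use F_per[OF t, of 0] T_per[OF t, of 0] K_per[OF t, of 0 0] in \<open>simp add: w_def V_def\<close>)
  have cw: "continuous_on {0..1} (\<lambda>p. w' p t)" unfolding w'_def
    by (intro continuous_intros K_cont V_cont slice_continuous[OF F_smooth t] slice_continuous[OF T_smooth t] t)
  have "(arc_integral u has_vector_derivative arc_integral (\<lambda>p t. u' p t - (V p t * K 0 p t) *\<^sub>R u p t) t) (at t within {0..})"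
    by (rule arc_integral_time[OF us ut t])
  moreover have "arc_integral (\<lambda>p t. u' p t - (V p t * K 0 p t) *\<^sub>R u p t) t = - 2 * arc_integral V t"
  proof -
    have "arc_integral (\<lambda>p t. u' p t - (V p t * K 0 p t) *\<^sub>R u p t) t = arc_integral (\<lambda>p t. w' p t - 2 * V p t) t"
      unfolding arc_integral_def by (simp only: eq[OF t])
    also have "\<dots> = arc_integral w' t - arc_integral (\<lambda>p t. 2 * V p t) t"
      by (rule arc_integral_diff[where u=w' and w="\<lambda>p t. 2 * V p t" and t=t])
         (intro cw continuous_intros V_cont t)+
    finally show ?thesis using w0 arc_integral_cmult[of "\<lambda>_. 2" V t] by simp
  qed
  ultimately have "((\<lambda>t. arc_integral u t * (1/2)) has_vector_derivative (- 2 * arc_integral V t) * (1/2)) (at t within {0..})"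
    by (intro has_vector_derivative_mult_left) simp
  then have "((\<lambda>t. arc_integral u t * (1/2)) has_vector_derivative - arc_integral V t) (at t within {0..})" by simp
  then show ?thesis
    by (rule has_vector_derivative_transform[rotated 2]) (use t in \<open>auto simp: A_eq u_def[abs_def]\<close>)
qed

lemma V_K0_integral: "t \<ge> 0 \<Longrightarrow> arc_integral (\<lambda>p t. V p t * K 0 p t) t = E 0 t - lam t * (2 * pi)"
proof -
  assume t: "t \<ge> 0"
  have "arc_integral (\<lambda>p t. V p t * K 0 p t) t = arc_integral (\<lambda>p t. (K 0 p t)\<^sup>2 - lam t * K 0 p t) t"
    by (simp add: V_eq power2_eq_square algebra_simps)
  also have "\<dots> = E 0 t - arc_integral (\<lambda>p t. lam t * K 0 p t) t" unfolding E_def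
    by (rule arc_integral_diff[where u="\<lambda>p t. (K 0 p t)\<^sup>2" and w="\<lambda>p t. lam t * K 0 p t" and t=t])
       (intro continuous_intros K_cont t)+
  finally show ?thesis by (simp only: arc_integral_cmult rotation[OF t])
qed

lemma V_integral: "t \<ge> 0 \<Longrightarrow> arc_integral V t = 2 * pi - lam t * L t"
proof -
  assume t: "t \<ge> 0"
  have "arc_integral V t = arc_integral (\<lambda>p t. K 0 p t - lam t) t"
    by (simp add: V_eq[abs_def])
  also have "\<dots> = arc_integral (K 0) t - arc_integral (\<lambda>p t. lam t) t"
    by (rule arc_integral_diff[where u="K 0" and w="\<lambda>p t. lam t" and t=t])
       (intro continuous_intros K_cont t)+
  finally show ?thesis by (simp only: arc_integral_const[OF t] rotation[OF t])
qed

lemma E0_eq: "t \<ge> 0 \<Longrightarrow> E0 t = E 0 t - 4 * pi\<^sup>2 / L t"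
proof -
  assume t: "t \<ge> 0"
  have "E0 t = arc_integral (\<lambda>p t. ((K 0 p t)\<^sup>2 - (2 * \<kappa>\<^sub>0 t) * K 0 p t) + (\<kappa>\<^sub>0 t)\<^sup>2) t"
    unfolding E0_def by (simp add: power2_diff algebra_simps)
  also have "\<dots> = arc_integral (\<lambda>p t. (K 0 p t)\<^sup>2 - (2 * \<kappa>\<^sub>0 t) * K 0 p t) t + arc_integral (\<lambda>p t. (\<kappa>\<^sub>0 t)\<^sup>2) t"
    by (rule arc_integral_add[where u="\<lambda>p t. (K 0 p t)\<^sup>2 - (2 * \<kappa>\<^sub>0 t) * K 0 p t" and w="\<lambda>p t. (\<kappa>\<^sub>0 t)\<^sup>2" and t=t])
       (intro continuous_intros K_cont t)+
  also have "arc_integral (\<lambda>p t. (K 0 p t)\<^sup>2 - (2 * \<kappa>\<^sub>0 t) * K 0 p t) t = E 0 t - arc_integral (\<lambda>p t. (2 * \<kappa>\<^sub>0 t) * K 0 p t) t"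
    unfolding E_def
    by (rule arc_integral_diff[where u="\<lambda>p t. (K 0 p t)\<^sup>2" and w="\<lambda>p t. (2 * \<kappa>\<^sub>0 t) * K 0 p t" and t=t])
       (intro continuous_intros K_cont t)+
  finally have "E0 t = E 0 t - 2 * \<kappa>\<^sub>0 t * (2 * pi) + (\<kappa>\<^sub>0 t)\<^sup>2 * L t"
    by (simp only: arc_integral_cmult[of "\<lambda>t. 2 * \<kappa>\<^sub>0 t"] arc_integral_const[OF t] rotation[OF t])
  then show ?thesis using L_pos[OF t] by (simp add: \<kappa>\<^sub>0_def power2_eq_square field_simps)
qed

lemma E0_nonneg: "t \<ge> 0 \<Longrightarrow> E0 t \<ge> 0" and E_nonneg: "t \<ge> 0 \<Longrightarrow> E j t \<ge> 0"
  unfolding E0_def E_def by (intro arc_integral_nonneg continuous_intros K_cont; simp)+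

text \<open>
  The contributions of \<open>lam\<close> cancel: what remains is \<open>- 2 L\<close> times the integral of
  the squared curvature minus its value \<open>4 \<pi>\<^sup>2 / L\<close> on the circle.
\<close>

lemma D_time: "t \<ge> 0 \<Longrightarrow> (D has_vector_derivative - 2 * L t * E0 t) (at t within {0..})"
proof -
  assume t: "t \<ge> 0"
  have L': "(flow_length F has_real_derivative - (E 0 t - lam t * (2 * pi))) (at t within {0..})"
    using L_time[OF t] by (simp add: V_K0_integral[OF t] has_real_derivative_iff_has_vector_derivative)
  have A': "(flow_area F has_real_derivative - (2 * pi - lam t * L t)) (at t within {0..})"
    using A_time[OF t] by (simp add: V_integral[OF t] has_real_derivative_iff_has_vector_derivative)
  have "(D has_real_derivative 2 * L t * - (E 0 t - lam t * (2 * pi)) - 4 * pi * - (2 * pi - lam t * L t)) (at t within {0..})"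
    unfolding D_def[abs_def] by (rule derivative_eq_intros L' A' refl | simp)+
  also have "2 * L t * - (E 0 t - lam t * (2 * pi)) - 4 * pi * - (2 * pi - lam t * L t) = - 2 * L t * E0 t"
    using L_pos[OF t] by (simp add: E0_eq[OF t] field_simps power2_eq_square)
  finally show ?thesis by (simp add: has_real_derivative_iff_has_vector_derivative)
qed

lemma A_cont: "continuous_on {0..} (flow_area F)"
  by (rule continuous_on_Ici_if_derivative[OF A_time])

text \<open>
  The derivative of \<open>A\<^sup>2\<close> is \<open>D\<close>, which is nonnegative by the isoperimetric inequality. Hence \<open>A\<close> never returns
  to zero.
\<close>

lemma A_pos: "t \<ge> 0 \<Longrightarrow> A t > 0" and A_ge: "t \<ge> 0 \<Longrightarrow> A t \<ge> A 0"
proof -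
  \<comment> \<open>The derivative \<open>2 A A'\<close> of \<open>A\<^sup>2\<close> is zero at a time with \<open>A = 0\<close>,
    where \<open>lam\<close> is zero by convention.\<close>
  define g where "g t = (if A t = 0 then 0 else D t)" for t
  have d: "((\<lambda>t. - (A t)\<^sup>2) has_vector_derivative - g t) (at t within {0..})" if t: "t \<ge> 0" for t
  proof -
    have A': "(flow_area F has_real_derivative - (2 * pi - lam t * L t)) (at t within {0..})"
      using A_time[OF t] by (simp add: V_integral[OF t] has_real_derivative_iff_has_vector_derivative)
    have "((\<lambda>t. - (A t)\<^sup>2) has_real_derivative - (2 * A t * - (2 * pi - lam t * L t))) (at t within {0..})"
      by (rule derivative_eq_intros A' refl | simp)+
    also have "2 * A t * - (2 * pi - lam t * L t) = g t"
      by (simp add: g_def lam_def D_def field_simps power2_eq_square)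
    finally show ?thesis by (simp add: has_real_derivative_iff_has_vector_derivative)
  qed
  have sq: "(A 0)\<^sup>2 \<le> (A t)\<^sup>2" if t: "t \<ge> 0" for t
  proof -
    have "- (A t)\<^sup>2 \<le> - (A 0)\<^sup>2"
      by (rule nonincreasing_if_derivative_nonpos[where f="\<lambda>t. - (A t)\<^sup>2" and f'="\<lambda>t. - g t"])
         (use t d D_nonneg in \<open>auto simp: g_def\<close>)
    then show ?thesis by simp
  qed
  show pos: "A t > 0" if t: "t \<ge> 0" for t
  proof (rule ccontr)
    assume "\<not> A t > 0"
    then obtain x where "0 \<le> x" "x \<le> t" "A x = 0"
      using IVT2'[of "flow_area F" t 0 0] A_0 t continuous_on_subset[OF A_cont, of "{0..t}"] by auto
    then show False using sq[of x] A_0 by simp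
  qed
  show "A t \<ge> A 0" if t: "t \<ge> 0" for t
    using sq[OF t] pos[OF t] A_0 by (simp add: power2_le_iff_abs_le)
qed

lemma A_time': "t \<ge> 0 \<Longrightarrow> (flow_area F has_vector_derivative D t / (2 * A t)) (at t within {0..})"
proof -
  assume t: "t \<ge> 0"
  have "- arc_integral V t = D t / (2 * A t)"
    using A_pos[OF t] by (simp add: V_integral[OF t] lam_def D_def field_simps power2_eq_square)
  then show ?thesis using A_time[OF t] by simp
qed

lemma D_le_D0:
  assumes t: "t \<ge> 0"
  shows "D t \<le> D 0"
proof (rule nonincreasing_if_derivative_nonpos[where f=D and f'="\<lambda>t. - 2 * L t * E0 t"])
  show "- 2 * L x * E0 x \<le> 0" if "0 < x" "x < t" for x
    using mult_nonneg_nonneg[of "L x" "E0 x"] L_pos[of x] E0_nonneg[of x] that by simp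
qed (use t D_time in auto)

text \<open>
  By monotonicity of \<open>D\<close> and \<open>A\<close> the ratio \<open>L\<^sup>2 / A\<close> is at most a constant \<open>c\<close>, so that the area grows at the
  rate \<open>D / (2 A) \<le> c D / (2 L\<^sup>2)\<close>. By the reverse isoperimetric inequality this is at most
  \<open>c L E0 / 2\<close>, which is the rate of decrease of \<open>c D / 4\<close>.
\<close>

lemma A_bounded: "\<exists>B. \<forall>t\<ge>0. A t \<le> B"
proof -
  define c where "c = D 0 / A 0 + 4 * pi"
  have c: "c > 0" unfolding c_def using D_nonneg[of 0] A_0 by (intro add_nonneg_pos) auto
  have L2: "(L t)\<^sup>2 \<le> c * A t" if t: "t \<ge> 0" for t
  proof -
    have "D 0 * 1 \<le> D 0 * (A t / A 0)" using A_ge[OF t] A_0 D_nonneg[of 0] by (intro mult_left_mono) auto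
    then show ?thesis using D_le_D0[OF t] unfolding D_def[of t] c_def by (simp add: distrib_right)
  qed
  have "D t + 4 / c * A t \<le> D 0 + 4 / c * A 0" if t: "t \<ge> 0" for t
  proof (rule nonincreasing_if_derivative_nonpos[where f="\<lambda>t. D t + 4 / c * A t"
        and f'="\<lambda>t. - 2 * L t * E0 t + 4 / c * (D t / (2 * A t))"])
    fix x :: real assume "0 \<le> x" "x \<le> t"
    then show "((\<lambda>t. D t + 4 / c * A t) has_vector_derivative
       - 2 * L x * E0 x + 4 / c * (D x / (2 * A x))) (at x within {0..})"
      by (intro has_vector_derivative_add D_time has_vector_derivative_mult_right A_time')
  next
    fix x :: real assume "0 < x" "x < t"
    then have x: "x \<ge> 0" by simp
    have "2 / (c * A x) * D x \<le> 2 / (L x)\<^sup>2 * D x"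
      using L2[OF x] L_pos[OF x] A_pos[OF x] c D_nonneg[OF x]
      by (intro mult_right_mono divide_left_mono) auto
    also have "\<dots> \<le> 2 / (L x)\<^sup>2 * ((L x) ^ 3 * E0 x)"
      by (intro mult_left_mono D_le_E0 x) simp
    also have "\<dots> = 2 * L x * E0 x" using L_pos[OF x] by (simp add: power2_eq_square power3_eq_cube)
    finally show "- 2 * L x * E0 x + 4 / c * (D x / (2 * A x)) \<le> 0" by simp
  qed (use t in auto)
  then have le: "4 / c * A t \<le> D 0 + 4 / c * A 0" if "t \<ge> 0" for t using that D_nonneg[OF that] by fastforce
  have "A t \<le> c / 4 * (D 0 + 4 / c * A 0)" if "t \<ge> 0" for t
  proof -
    have "c / 4 * (4 / c * A t) \<le> c / 4 * (D 0 + 4 / c * A 0)" using le[OF that] c by (intro mult_left_mono) auto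
    then show ?thesis using c by simp
  qed
  then show ?thesis by blast
qed

definition "Lmin = sqrt (4 * pi * A 0)"

lemma Lmin_pos: "Lmin > 0" using A_0 by (simp add: Lmin_def)

lemma L_ge: "t \<ge> 0 \<Longrightarrow> L t \<ge> Lmin"
  unfolding Lmin_def using D_nonneg[of t] A_ge[of t] L_pos[of t]
  by (intro real_le_lsqrt) (auto simp: D_def intro: order_trans[of _ "4 * pi * A t"])

lemma L_bounded: "\<exists>B>0. \<forall>t\<ge>0. L t \<le> B"
proof -
  obtain B where B: "\<And>t. t \<ge> 0 \<Longrightarrow> A t \<le> B" using A_bounded by blast
  have "L t \<le> D 0 + 4 * pi * B + 1" if t: "t \<ge> 0" for t
  proof -
    have "(L t)\<^sup>2 \<le> D 0 + 4 * pi * B" 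
    proof -
      have "4 * pi * A t \<le> 4 * pi * B" using B[OF t] by (intro mult_left_mono) auto
      then show ?thesis using D_le_D0[OF t] unfolding D_def[of t] by linarith
    qed
    moreover have "L t \<le> (L t)\<^sup>2 + 1" using sum_power2_ge_zero[of "L t - 1/2" 0] by (simp add: power2_eq_square algebra_simps)
    ultimately show ?thesis by linarith
  qed
  then show ?thesis using L_pos[of 0] by (meson less_le_trans order_refl)
qed

definition "Lmax = (SOME B. B > 0 \<and> (\<forall>t\<ge>0. L t \<le> B))"

lemma Lmax_pos: "Lmax > 0" and L_le: "t \<ge> 0 \<Longrightarrow> L t \<le> Lmax"
  using someI_ex[OF L_bounded[simplified Bex_def]] unfolding Lmax_def by blast+

text \<open>The flow differs from the flow with velocity \<open>(\<kappa> - \<kappa>\<^sub>0) \<nu>\<close> by a term of the size of the deficit.\<close>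

lemma lam_minus_\<kappa>\<^sub>0: "t \<ge> 0 \<Longrightarrow> lam t - \<kappa>\<^sub>0 t = D t / (2 * A t * L t)"
  using A_pos[of t] L_pos[of t] by (simp add: lam_def \<kappa>\<^sub>0_def D_def field_simps power2_eq_square)

lemma lam_bounds: "t \<ge> 0 \<Longrightarrow> 0 \<le> lam t - \<kappa>\<^sub>0 t" "t \<ge> 0 \<Longrightarrow> lam t - \<kappa>\<^sub>0 t \<le> D t / (2 * A 0 * Lmin)"
proof -
  assume t: "t \<ge> 0"
  show "0 \<le> lam t - \<kappa>\<^sub>0 t" using A_pos[OF t] L_pos[OF t] D_nonneg[OF t] by (simp add: lam_minus_\<kappa>\<^sub>0[OF t])
  have "2 * A 0 * Lmin \<le> 2 * A t * L t"
    using A_ge[OF t] L_ge[OF t] A_0 Lmin_pos by (intro mult_mono) auto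
  then show "lam t - \<kappa>\<^sub>0 t \<le> D t / (2 * A 0 * Lmin)"
    unfolding lam_minus_\<kappa>\<^sub>0[OF t] using A_0 Lmin_pos D_nonneg[OF t] A_pos[OF t] L_pos[OF t]
    by (intro divide_left_mono) auto
qed

definition "kmax = 2 * pi / Lmin"

lemma \<kappa>\<^sub>0_bounds: "t \<ge> 0 \<Longrightarrow> 0 < \<kappa>\<^sub>0 t" "t \<ge> 0 \<Longrightarrow> \<kappa>\<^sub>0 t \<le> kmax"
  using L_ge[of t] L_pos[of t] Lmin_pos by (auto simp: \<kappa>\<^sub>0_def kmax_def intro!: divide_left_mono)

lemma kmax_pos: "kmax > 0" using Lmin_pos by (simp add: kmax_def)

lemma K0_deviation_le: "t \<ge> 0 \<Longrightarrow> (K 0 p t - \<kappa>\<^sub>0 t)\<^sup>2 \<le> Lmax * E 1 t"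
proof -
  assume t: "t \<ge> 0"
  have "(K 0 p t - \<kappa>\<^sub>0 t)\<^sup>2 \<le> L t * E 1 t" unfolding E_def
  proof (rule deviation_from_mean_le[where u="K 0" and w="K 1", OF t])
    show "arc_integral (K 0) t = \<kappa>\<^sub>0 t * L t" using L_pos[OF t] by (simp add: rotation[OF t] \<kappa>\<^sub>0_def)
  qed (use K_space[of 0] K_per K_cont t in auto)
  also have "\<dots> \<le> Lmax * E 1 t" by (intro mult_right_mono L_le E_nonneg t)
  finally show ?thesis .
qed

lemma K_Suc_le: "t \<ge> 0 \<Longrightarrow> (K (Suc j) p t)\<^sup>2 \<le> Lmax * E (Suc (Suc j)) t"
proof -
  assume t: "t \<ge> 0"
  have "(K (Suc j) p t - 0)\<^sup>2 \<le> L t * E (Suc (Suc j)) t" unfolding E_def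
  proof (rule deviation_from_mean_le[where u="K (Suc j)" and w="K (Suc (Suc j))", OF t])
    have "arc_integral (K (Suc j)) t = 0"
      by (rule arc_integral_derivative[where w="K j" and w'="K (Suc j)" and t=t])
         (use K_space[of j] K_per[OF t, of j 0] t in auto)
    then show "arc_integral (K (Suc j)) t = 0 * L t" by simp
  qed (use K_space[of "Suc j"] K_per K_cont t in auto)
  also have "\<dots> \<le> Lmax * E (Suc (Suc j)) t" by (intro mult_right_mono L_le E_nonneg t)
  finally show ?thesis by simp
qed

section \<open>Exponential decay of the deficit\<close>

text \<open>Together with Cauchy--Schwarz this makes the sequence \<open>E0, E 1, E 2, \<dots>\<close> logarithmically convex.\<close>

lemma integral_by_parts:
  assumes t: "t \<ge> 0"
  shows "arc_integral (\<lambda>p t. (K j p t - c t) * K (Suc (Suc j)) p t) t = - E (Suc j) t"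
proof -
  have "arc_integral (\<lambda>p t. (K j p t - c t) * K (Suc (Suc j)) p t + (K (Suc j) p t)\<^sup>2) t = 0"
  proof (rule arc_integral_derivative[where w="\<lambda>p t. (K j p t - c t) * K (Suc j) p t" and t=t])
    fix p
    have "((\<lambda>x. (K j x t - c t) * K (Suc j) x t) has_vector_derivative
       (K j p t - c t) * (v p t * K (Suc (Suc j)) p t) + (v p t * K (Suc j) p t - 0) * K (Suc j) p t) (at p)"
      by (intro has_vector_derivative_mult has_vector_derivative_diff has_vector_derivative_const K_space[rule_format] t)
    then show "((\<lambda>x. (K j x t - c t) * K (Suc j) x t) has_vector_derivative
       v p t *\<^sub>R ((K j p t - c t) * K (Suc (Suc j)) p t + (K (Suc j) p t)\<^sup>2)) (at p)"
      by (rule has_vector_derivative_eq_rhs) (simp add: power2_eq_square algebra_simps)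
  qed (use K_per[OF t, of _ 0] in simp)
  moreover have "arc_integral (\<lambda>p t. (K j p t - c t) * K (Suc (Suc j)) p t + (K (Suc j) p t)\<^sup>2) t
     = arc_integral (\<lambda>p t. (K j p t - c t) * K (Suc (Suc j)) p t) t + E (Suc j) t" unfolding E_def
    by (rule arc_integral_add[where u="\<lambda>p t. (K j p t - c t) * K (Suc (Suc j)) p t" and w="\<lambda>p t. (K (Suc j) p t)\<^sup>2" and t=t])
       (intro continuous_intros K_cont t)+
  ultimately show ?thesis by simp
qed

lemma E1_interpolation: "t \<ge> 0 \<Longrightarrow> (E 1 t)\<^sup>2 \<le> E0 t * E 2 t"
proof -
  assume t: "t \<ge> 0"
  have "(arc_integral (\<lambda>p t. (K 0 p t - \<kappa>\<^sub>0 t) * K 2 p t) t)\<^sup>2 \<le> E0 t * E 2 t"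
    unfolding E0_def E_def
    by (rule arc_integral_cauchy_schwarz[where u="\<lambda>p t. K 0 p t - \<kappa>\<^sub>0 t"]) (intro continuous_intros K_cont t)+
  then show ?thesis using integral_by_parts[OF t, of 0 \<kappa>\<^sub>0] by (simp add: numeral_2_eq_2)
qed

lemma E_interpolation: "t \<ge> 0 \<Longrightarrow> (E (Suc j) t)\<^sup>2 \<le> E j t * E (Suc (Suc j)) t"
proof -
  assume t: "t \<ge> 0"
  have "(arc_integral (\<lambda>p t. K j p t * K (Suc (Suc j)) p t) t)\<^sup>2 \<le> E j t * E (Suc (Suc j)) t"
    unfolding E_def
    by (rule arc_integral_cauchy_schwarz[where u="K j"]) (intro continuous_intros K_cont t)+
  then show ?thesis using integral_by_parts[OF t, of j "\<lambda>_. 0"] by simp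
qed

lemma E_time:
  assumes b: "has_time_derivative (K j) b" and t: "t \<ge> 0"
  shows "(E j has_vector_derivative arc_integral (\<lambda>p t. 2 * K j p t * b p t - V p t * K 0 p t * (K j p t)\<^sup>2) t) (at t within {0..})"
proof -
  have "Cinf_family (\<lambda>p t. K j p t * K j p t)" by (intro Cinf_family_mult K_smooth)
  moreover have "has_time_derivative (\<lambda>p t. K j p t * K j p t) (\<lambda>p t. K j p t * b p t + b p t * K j p t)"
    by (intro allI impI has_vector_derivative_mult b[rule_format])
  ultimately have "(arc_integral (\<lambda>p t. K j p t * K j p t) has_vector_derivative
     arc_integral (\<lambda>p t. K j p t * b p t + b p t * K j p t - (V p t * K 0 p t) *\<^sub>R (K j p t * K j p t)) t) (at t within {0..})"
    by (rule arc_integral_time[OF _ _ t])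
  then show ?thesis by (simp add: E_def[abs_def] power2_eq_square algebra_simps)
qed

text \<open>
  For a curve with rotation number 1, \<open>E0 = E 0 - 4 \<pi>\<^sup>2 / L\<close>. Diffusion yields \<open>- 2 E 1\<close>; the term
  \<open>\<kappa>\<^sub>0\<^sup>2\<close> in the reaction comes from the change of the length.
\<close>

lemma E0_time:
  assumes t: "t \<ge> 0"
  shows "(E0 has_vector_derivative - 2 * E 1 t
     + arc_integral (\<lambda>p t. ((K 0 p t)\<^sup>2 - (\<kappa>\<^sub>0 t)\<^sup>2) * K 0 p t * V p t) t) (at t within {0..})"
proof -
  let ?c = "arc_integral (\<lambda>p t. 2 * K 0 p t * (K 2 p t + (K 0 p t)\<^sup>2 * V p t) - V p t * K 0 p t * (K 0 p t)\<^sup>2) t"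
  let ?l = "arc_integral (\<lambda>p t. V p t * K 0 p t) t"
  have e: "(E 0 has_real_derivative ?c) (at t within {0..})"
    using E_time[OF K0_time t] by (simp add: has_real_derivative_iff_has_vector_derivative)
  have l: "(flow_length F has_real_derivative - ?l) (at t within {0..})"
    using L_time[OF t] by (simp add: has_real_derivative_iff_has_vector_derivative)
  have "((\<lambda>t. E 0 t - 4 * pi\<^sup>2 * inverse (L t)) has_real_derivative ?c - 4 * pi\<^sup>2 * - (inverse (L t) * - ?l * inverse (L t))) (at t within {0..})"
    using L_pos[OF t] by (intro DERIV_diff DERIV_cmult DERIV_inverse' e l) auto
  also have "?c - 4 * pi\<^sup>2 * - (inverse (L t) * - ?l * inverse (L t)) = - 2 * E 1 t
     + arc_integral (\<lambda>p t. ((K 0 p t)\<^sup>2 - (\<kappa>\<^sub>0 t)\<^sup>2) * K 0 p t * V p t) t"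
  proof -
    have "?c = arc_integral (\<lambda>p t. 2 * ((K 0 p t - 0) * K 2 p t) + (K 0 p t)\<^sup>2 * K 0 p t * V p t) t"
      by (simp add: power2_eq_square algebra_simps)
    also have "\<dots> = arc_integral (\<lambda>p t. 2 * ((K 0 p t - 0) * K 2 p t)) t + arc_integral (\<lambda>p t. (K 0 p t)\<^sup>2 * K 0 p t * V p t) t"
      by (rule arc_integral_add[where u="\<lambda>p t. 2 * ((K 0 p t - 0) * K 2 p t)" and w="\<lambda>p t. (K 0 p t)\<^sup>2 * K 0 p t * V p t" and t=t])
         (intro continuous_intros K_cont V_cont t)+
    also have "arc_integral (\<lambda>p t. 2 * ((K 0 p t - 0) * K 2 p t)) t = - 2 * E 1 t"
      using integral_by_parts[OF t, of 0 "\<lambda>_. 0"] arc_integral_cmult[of "\<lambda>_. 2" "\<lambda>p t. (K 0 p t - 0) * K 2 p t" t]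
      by (simp add: numeral_2_eq_2)
    finally have c: "?c = - 2 * E 1 t + arc_integral (\<lambda>p t. (K 0 p t)\<^sup>2 * K 0 p t * V p t) t" .
    have "arc_integral (\<lambda>p t. ((K 0 p t)\<^sup>2 - (\<kappa>\<^sub>0 t)\<^sup>2) * K 0 p t * V p t) t
       = arc_integral (\<lambda>p t. (K 0 p t)\<^sup>2 * K 0 p t * V p t - (\<kappa>\<^sub>0 t)\<^sup>2 * (V p t * K 0 p t)) t"
      by (simp add: algebra_simps)
    also have "\<dots> = arc_integral (\<lambda>p t. (K 0 p t)\<^sup>2 * K 0 p t * V p t) t - arc_integral (\<lambda>p t. (\<kappa>\<^sub>0 t)\<^sup>2 * (V p t * K 0 p t)) t"
      by (rule arc_integral_diff[where u="\<lambda>p t. (K 0 p t)\<^sup>2 * K 0 p t * V p t" and w="\<lambda>p t. (\<kappa>\<^sub>0 t)\<^sup>2 * (V p t * K 0 p t)" and t=t])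
         (intro continuous_intros K_cont V_cont t)+
    also have "arc_integral (\<lambda>p t. (\<kappa>\<^sub>0 t)\<^sup>2 * (V p t * K 0 p t)) t = (\<kappa>\<^sub>0 t)\<^sup>2 * ?l"
      by (rule arc_integral_cmult)
    finally have d: "arc_integral (\<lambda>p t. ((K 0 p t)\<^sup>2 - (\<kappa>\<^sub>0 t)\<^sup>2) * K 0 p t * V p t) t
      = arc_integral (\<lambda>p t. (K 0 p t)\<^sup>2 * K 0 p t * V p t) t - (\<kappa>\<^sub>0 t)\<^sup>2 * ?l" .
    have "4 * pi\<^sup>2 * - (inverse (L t) * - l * inverse (L t)) = (\<kappa>\<^sub>0 t)\<^sup>2 * l" for l
      by (simp add: \<kappa>\<^sub>0_def power_divide power2_eq_square inverse_eq_divide)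
    then show ?thesis unfolding c d by simp
  qed
  finally have "((\<lambda>t. E 0 t - 4 * pi\<^sup>2 * inverse (L t)) has_vector_derivative - 2 * E 1 t
     + arc_integral (\<lambda>p t. ((K 0 p t)\<^sup>2 - (\<kappa>\<^sub>0 t)\<^sup>2) * K 0 p t * V p t) t) (at t within {0..})"
    by (simp add: has_real_derivative_iff_has_vector_derivative)
  then show ?thesis
    by (rule has_vector_derivative_transform[rotated 2]) (use t in \<open>auto simp: E0_eq inverse_eq_divide\<close>)
qed

text \<open>
  With \<open>x = \<kappa> - \<kappa>\<^sub>0\<close>, \<open>k = \<kappa>\<^sub>0\<close> and \<open>m = lam - \<kappa>\<^sub>0\<close> the left side is the integrand of the reaction. The
  factors \<open>x + 2 k\<close> and \<open>x + k\<close> are bounded in terms of \<open>x\<close>, whereas \<open>x (x - m)\<close> is quadratically small.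
\<close>

lemma reaction_pointwise_bound:
  fixes x k m c :: real
  assumes "0 < k" "k \<le> c"
  shows "((x + k)\<^sup>2 - k\<^sup>2) * (x + k) * (x - m) \<le> 2 * (2 + 8 * c\<^sup>2) * (1 + x\<^sup>2) * (x\<^sup>2 + m\<^sup>2)"
proof -
  have kc: "k\<^sup>2 \<le> c\<^sup>2" using assms by (intro power_mono) auto
  have "\<bar>(x + 2 * k) * (x + k)\<bar> \<le> (\<bar>x\<bar> + 2 * k) * (\<bar>x\<bar> + 2 * k)"
    unfolding abs_mult using assms by (intro mult_mono) auto
  also have "\<dots> \<le> 2 * x\<^sup>2 + 8 * k\<^sup>2"
    using sum_power2_ge_zero[of "\<bar>x\<bar> - 2 * k" 0] by (simp add: power2_eq_square algebra_simps)
  also have "\<dots> \<le> (2 + 8 * c\<^sup>2) * (1 + x\<^sup>2)"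
  proof -
    have "0 \<le> c\<^sup>2 * x\<^sup>2" by simp
    moreover have "(2 + 8 * c\<^sup>2) * (1 + x\<^sup>2) = 2 + 2 * x\<^sup>2 + 8 * c\<^sup>2 + 8 * (c\<^sup>2 * x\<^sup>2)" by (simp add: algebra_simps)
    ultimately show ?thesis using kc by linarith
  qed
  finally have a: "\<bar>(x + 2 * k) * (x + k)\<bar> \<le> (2 + 8 * c\<^sup>2) * (1 + x\<^sup>2)" .
  have b: "\<bar>x * (x - m)\<bar> \<le> 2 * (x\<^sup>2 + m\<^sup>2)"
  proof -
    have "2 * (x\<^sup>2 + m\<^sup>2) - x * (x - m) = (x + m / 2)\<^sup>2 + 7 / 4 * m\<^sup>2"
      by (simp add: power2_eq_square field_simps)
    moreover have "0 \<le> (x + m / 2)\<^sup>2 + 7 / 4 * m\<^sup>2" by simp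
    ultimately have "x * (x - m) \<le> 2 * (x\<^sup>2 + m\<^sup>2)" by linarith
    moreover have "2 * (x\<^sup>2 + m\<^sup>2) - - (x * (x - m)) = (x - m / 2)\<^sup>2 + 2 * x\<^sup>2 + 7 / 4 * m\<^sup>2"
      by (simp add: power2_eq_square field_simps)
    moreover have "0 \<le> (x - m / 2)\<^sup>2 + 2 * x\<^sup>2 + 7 / 4 * m\<^sup>2" by simp
    ultimately have "x * (x - m) \<le> 2 * (x\<^sup>2 + m\<^sup>2)" "- (x * (x - m)) \<le> 2 * (x\<^sup>2 + m\<^sup>2)" by linarith+
    then show ?thesis by (rule abs_leI)
  qed
  have "((x + k)\<^sup>2 - k\<^sup>2) * (x + k) * (x - m) = ((x + 2 * k) * (x + k)) * (x * (x - m))"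
    by (simp add: power2_eq_square algebra_simps)
  also have "\<dots> \<le> \<bar>(x + 2 * k) * (x + k)\<bar> * \<bar>x * (x - m)\<bar>" by (metis abs_ge_self abs_mult)
  also have "\<dots> \<le> ((2 + 8 * c\<^sup>2) * (1 + x\<^sup>2)) * (2 * (x\<^sup>2 + m\<^sup>2))"
    by (intro mult_mono a b) auto
  finally show ?thesis by (simp only: mult_ac)
qed

text \<open>
  The supremum of \<open>(\<kappa> - \<kappa>\<^sub>0)\<^sup>2\<close> is estimated by \<open>E 1\<close> and \<open>(lam - \<kappa>\<^sub>0)\<^sup>2\<close> by \<open>D\<close>. This leaves a term in
  \<open>E 1 * (E0 + D)\<close>, which diffusion dominates as soon as \<open>E0 + D\<close> is small.
\<close>

lemma reaction_bound:
  "\<exists>C>0. \<forall>t\<ge>0. arc_integral (\<lambda>p t. ((K 0 p t)\<^sup>2 - (\<kappa>\<^sub>0 t)\<^sup>2) * K 0 p t * V p t) t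
      \<le> C * (1 + E 1 t) * (E0 t + D t)"
proof -
  define C3 where "C3 = 2 * (2 + 8 * kmax\<^sup>2)"
  define C4 where "C4 = Lmax * (D 0 / (2 * A 0 * Lmin)\<^sup>2)"
  have C3: "C3 > 0" unfolding C3_def by (auto intro: add_pos_nonneg)
  have C4: "C4 \<ge> 0" unfolding C4_def using Lmax_pos D_nonneg[of 0] by auto
  define C where "C = C3 * (1 + Lmax) * (1 + C4)"
  have C: "C > 0" unfolding C_def using C3 C4 Lmax_pos by simp
  have "arc_integral (\<lambda>p t. ((K 0 p t)\<^sup>2 - (\<kappa>\<^sub>0 t)\<^sup>2) * K 0 p t * V p t) t \<le> C * (1 + E 1 t) * (E0 t + D t)"
    if t: "t \<ge> 0" for t
  proof -
    define m where "m t = lam t - \<kappa>\<^sub>0 t" for t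
    have pw: "((K 0 p t)\<^sup>2 - (\<kappa>\<^sub>0 t)\<^sup>2) * K 0 p t * V p t
        \<le> (C3 * (1 + Lmax * E 1 t)) * ((K 0 p t - \<kappa>\<^sub>0 t)\<^sup>2 + (m t)\<^sup>2)" for p
    proof -
      let ?x = "K 0 p t - \<kappa>\<^sub>0 t"
      have "((K 0 p t)\<^sup>2 - (\<kappa>\<^sub>0 t)\<^sup>2) * K 0 p t * V p t = ((?x + \<kappa>\<^sub>0 t)\<^sup>2 - (\<kappa>\<^sub>0 t)\<^sup>2) * (?x + \<kappa>\<^sub>0 t) * (?x - m t)"
        by (simp add: V_eq m_def)
      also have "\<dots> \<le> C3 * (1 + ?x\<^sup>2) * (?x\<^sup>2 + (m t)\<^sup>2)"
        unfolding C3_def by (rule reaction_pointwise_bound[OF \<kappa>\<^sub>0_bounds[OF t]])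
      also have "\<dots> \<le> C3 * (1 + Lmax * E 1 t) * (?x\<^sup>2 + (m t)\<^sup>2)"
        using K0_deviation_le[OF t, of p] C3 by (intro mult_right_mono mult_left_mono) auto
      finally show ?thesis .
    qed
    have "arc_integral (\<lambda>p t. ((K 0 p t)\<^sup>2 - (\<kappa>\<^sub>0 t)\<^sup>2) * K 0 p t * V p t) t
       \<le> arc_integral (\<lambda>p t. (C3 * (1 + Lmax * E 1 t)) * ((K 0 p t - \<kappa>\<^sub>0 t)\<^sup>2 + (m t)\<^sup>2)) t"
      by (rule arc_integral_mono[where t=t and u="\<lambda>p t. ((K 0 p t)\<^sup>2 - (\<kappa>\<^sub>0 t)\<^sup>2) * K 0 p t * V p t"
           and w="\<lambda>p t. (C3 * (1 + Lmax * E 1 t)) * ((K 0 p t - \<kappa>\<^sub>0 t)\<^sup>2 + (m t)\<^sup>2)"])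
         (intro continuous_intros K_cont V_cont t pw)+
    also have "\<dots> = (C3 * (1 + Lmax * E 1 t)) * arc_integral (\<lambda>p t. (K 0 p t - \<kappa>\<^sub>0 t)\<^sup>2 + (m t)\<^sup>2) t"
      by (rule arc_integral_cmult)
    also have "arc_integral (\<lambda>p t. (K 0 p t - \<kappa>\<^sub>0 t)\<^sup>2 + (m t)\<^sup>2) t = E0 t + arc_integral (\<lambda>p t. (m t)\<^sup>2) t"
      unfolding E0_def
      by (rule arc_integral_add[where t=t and u="\<lambda>p t. (K 0 p t - \<kappa>\<^sub>0 t)\<^sup>2" and w="\<lambda>p t. (m t)\<^sup>2"])
         (intro continuous_intros K_cont t)+
    also have "arc_integral (\<lambda>p t. (m t)\<^sup>2) t = (m t)\<^sup>2 * L t" by (rule arc_integral_const[OF t])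
    also have "(C3 * (1 + Lmax * E 1 t)) * (E0 t + (m t)\<^sup>2 * L t) \<le> (C3 * ((1 + Lmax) * (1 + E 1 t))) * ((1 + C4) * (E0 t + D t))"
    proof (intro mult_mono)
      show "1 + Lmax * E 1 t \<le> (1 + Lmax) * (1 + E 1 t)"
        using Lmax_pos E_nonneg[OF t, of 1] by (simp add: algebra_simps)
      have "(m t)\<^sup>2 \<le> (D t / (2 * A 0 * Lmin))\<^sup>2"
        unfolding m_def using lam_bounds[OF t] by (intro power_mono) auto
      also have "\<dots> = D t * (D t / (2 * A 0 * Lmin)\<^sup>2)" by (simp add: power2_eq_square)
      also have "\<dots> \<le> D t * (D 0 / (2 * A 0 * Lmin)\<^sup>2)"
        using D_nonneg[OF t] D_le_D0[OF t] by (intro mult_left_mono divide_right_mono) auto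
      finally have "(m t)\<^sup>2 * L t \<le> (D t * (D 0 / (2 * A 0 * Lmin)\<^sup>2)) * Lmax"
        using L_le[OF t] L_pos[OF t] D_nonneg[OF t] D_nonneg[of 0] by (intro mult_mono) auto
      also have "\<dots> = C4 * D t" by (simp add: C4_def)
      finally have mL: "(m t)\<^sup>2 * L t \<le> C4 * D t" .
      show "E0 t + (m t)\<^sup>2 * L t \<le> (1 + C4) * (E0 t + D t)"
      proof -
        have "0 \<le> C4 * E0 t" using C4 E0_nonneg[OF t] by simp
        moreover have "(1 + C4) * (E0 t + D t) = E0 t + D t + C4 * E0 t + C4 * D t" by (simp add: algebra_simps)
        ultimately show ?thesis using D_nonneg[OF t] mL by linarith
      qed
    qed (use C3 C4 Lmax_pos E_nonneg[OF t, of 1] E0_nonneg[OF t] L_pos[OF t] in auto)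
    finally show ?thesis by (simp add: C_def mult_ac)
  qed
  then show ?thesis using C by blast
qed

text \<open>
  A Lyapunov function is \<open>H = E0 + N D\<close>. Once \<open>H < 1 / C\<close>, diffusion absorbs the part of the reaction that
  contains \<open>E 1\<close>, and for large \<open>N\<close> the decrease \<open>- 2 N L E0\<close> of \<open>N D\<close> absorbs the rest, since \<open>D\<close> is at most a
  multiple of \<open>E0\<close>. This gives \<open>H' \<le> - \<epsilon> H\<close>. That \<open>H\<close> gets small at some time follows from
  \<open>D' = - 2 L E0\<close>: otherwise \<open>E0\<close> would be bounded below and \<open>D\<close> would become negative.
\<close>

lemma E0_D_exp_decay: "exp_decay E0" "exp_decay D"
proof -
  define G where "G t = arc_integral (\<lambda>p t. ((K 0 p t)\<^sup>2 - (\<kappa>\<^sub>0 t)\<^sup>2) * K 0 p t * V p t) t" for t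
  obtain C where C: "C > 0" "\<And>t. t \<ge> 0 \<Longrightarrow> G t \<le> C * (1 + E 1 t) * (E0 t + D t)"
    using reaction_bound unfolding G_def by blast
  define C2 where "C2 = Lmax ^ 3"
  have C2: "C2 > 0" using Lmax_pos by (simp add: C2_def)
  have DE: "D t \<le> C2 * E0 t" if t: "t \<ge> 0" for t
  proof -
    have "(L t) ^ 3 \<le> C2" unfolding C2_def using L_le[OF t] L_pos[OF t] by (intro power_mono) auto
    then show ?thesis using D_le_E0[OF t] E0_nonneg[OF t] by (meson mult_right_mono order_trans)
  qed
  \<comment> \<open>The decrease of \<open>N D\<close> must beat \<open>C (E0 + D)\<close> and leave \<open>- E0\<close>.\<close>
  define N where "N = max 1 ((C * (1 + C2) + 1) / (2 * Lmin))"
  have N: "N \<ge> 1" "C * (1 + C2) + 1 \<le> 2 * N * Lmin"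
  proof -
    show "N \<ge> 1" by (simp add: N_def)
    have "(C * (1 + C2) + 1) / (2 * Lmin) \<le> N" by (simp add: N_def)
    then show "C * (1 + C2) + 1 \<le> 2 * N * Lmin" using Lmin_pos by (simp add: field_simps)
  qed
  define H where "H t = E0 t + N * D t" for t
  define H' where "H' t = (- 2 * E 1 t + G t) + N * (- 2 * L t * E0 t)" for t
  \<comment> \<open>\<open>1 + N C2\<close> bounds \<open>H / E0\<close>.\<close>
  define \<epsilon> where "\<epsilon> = 1 / (1 + N * C2)"
  have eps: "\<epsilon> > 0" unfolding \<epsilon>_def using N C2 by (simp add: add_pos_pos)
  have Hd: "(H has_vector_derivative H' t) (at t within {0..})" if "t \<ge> 0" for t
    unfolding H_def[abs_def] H'_def G_def
    by (intro has_vector_derivative_add has_vector_derivative_mult_right E0_time D_time that)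
  have HE: "\<epsilon> * H t \<le> E0 t" if t: "t \<ge> 0" for t
  proof -
    have "N * D t \<le> N * (C2 * E0 t)" using DE[OF t] N by (intro mult_left_mono) auto
    then have "H t \<le> (1 + N * C2) * E0 t" by (simp add: H_def algebra_simps)
    moreover have "1 + N * C2 > 0" using N C2 by (simp add: add_pos_pos)
    ultimately show ?thesis by (simp add: \<epsilon>_def field_simps)
  qed
  have HD: "E0 t + D t \<le> H t" if t: "t \<ge> 0" for t
    unfolding H_def using N mult_right_mono[of 1 N "D t"] D_nonneg[OF t] by simp
  have H'le: "H' t \<le> - (\<epsilon> * H t)" if t: "t \<ge> 0" and small: "H t < 1 / C" for t
  proof -
    have "C * (E0 t + D t) \<le> C * H t" using HD[OF t] C by (intro mult_left_mono) auto
    also have "\<dots> \<le> 1" using small C by (simp add: field_simps)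
    finally have "E 1 t * (C * (E0 t + D t)) \<le> E 1 t * 1"
      using E_nonneg[OF t] by (intro mult_left_mono) auto
    then have "C * (1 + E 1 t) * (E0 t + D t) \<le> E 1 t + C * (E0 t + D t)" by (simp add: algebra_simps)
    then have g: "G t \<le> E 1 t + C * (E0 t + D t)" using C(2)[OF t] by linarith
    have "C * D t \<le> C * (C2 * E0 t)" using DE[OF t] C by (intro mult_left_mono) auto
    then have "C * (E0 t + D t) + E0 t \<le> (C * (1 + C2) + 1) * E0 t" by (simp add: algebra_simps)
    also have "\<dots> \<le> (2 * N * Lmin) * E0 t" using N E0_nonneg[OF t] by (intro mult_right_mono) auto
    also have "\<dots> \<le> (2 * N * L t) * E0 t"
      using N L_ge[OF t] E0_nonneg[OF t] by (intro mult_right_mono mult_left_mono) auto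
    finally have "C * (E0 t + D t) + E0 t \<le> N * (2 * L t * E0 t)" by (simp add: mult_ac)
    then have "H' t \<le> - E0 t" unfolding H'_def using g E_nonneg[OF t, of 1] by simp
    then show ?thesis using HE[OF t] by linarith
  qed
  have "\<exists>s\<ge>0. H s < 1 / C"
  proof (rule ccontr)
    assume "\<not> ?thesis"
    then have big: "H t \<ge> 1 / C" if "t \<ge> 0" for t using that by (meson not_le)
    define a where "a = 2 * Lmin * (\<epsilon> * (1 / C))"
    have a: "a > 0" using Lmin_pos eps C by (simp add: a_def)
    have E0_big: "\<epsilon> * (1 / C) \<le> E0 t" if "t \<ge> 0" for t
      using mult_left_mono[OF big[OF that], of \<epsilon>] eps HE[OF that] by linarith
    \<comment> \<open>A time at which \<open>D\<close> would be negative.\<close>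
    define t where "t = (D 0 + 1) / a"
    have t: "t \<ge> 0" using a D_nonneg[of 0] by (simp add: t_def)
    have "D t + a * t \<le> D 0 + a * 0"
    proof (rule nonincreasing_if_derivative_nonpos[where f="\<lambda>t. D t + a * t" and f'="\<lambda>t. - 2 * L t * E0 t + a * 1"])
      fix x assume "0 \<le> x" "x \<le> t"
      then show "((\<lambda>t. D t + a * t) has_vector_derivative - 2 * L x * E0 x + a * 1) (at x within {0..})"
        by (intro has_vector_derivative_add D_time has_vector_derivative_mult_right has_vector_derivative_id)
    next
      fix x assume "0 < x" "x < t"
      then have x: "x \<ge> 0" by simp
      have "Lmin * (\<epsilon> * (1 / C)) \<le> L x * E0 x"
        using L_ge[OF x] E0_big[OF x] Lmin_pos eps C L_pos[OF x] by (intro mult_mono) auto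
      then show "- 2 * L x * E0 x + a * 1 \<le> 0" by (simp add: a_def)
    qed (use t in auto)
    moreover have "a * t = D 0 + 1" using a by (simp add: t_def)
    ultimately show False using D_nonneg[OF t] by simp
  qed
  then obtain s where s: "s \<ge> 0" "H s < 1 / C" by blast
  have small: "H t < 1 / C" if "t \<ge> s" for t
  proof (rule stays_below_threshold[where f=H and f'=H' and a=s, OF Hd])
    fix x assume x: "s \<le> x" "H x < 1 / C"
    have "0 \<le> H x" using HD[of x] E0_nonneg[of x] D_nonneg[of x] x s by auto
    then have "0 \<le> \<epsilon> * H x" using eps by simp
    moreover have "H' x \<le> - (\<epsilon> * H x)" using x s by (intro H'le) auto
    ultimately show "H' x \<le> 0" by linarith
  qed (use s that in auto)
  have "H t * exp (\<epsilon> * t) \<le> H s * exp (\<epsilon> * s)" if t: "t \<ge> s" for t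
  proof (rule nonincreasing_if_derivative_nonpos[where f="\<lambda>t. H t * exp (\<epsilon> * t)"
        and f'="\<lambda>t. H t * (\<epsilon> * exp (\<epsilon> * t)) + H' t * exp (\<epsilon> * t)"])
    fix x assume "s \<le> x" "x \<le> t"
    then show "((\<lambda>t. H t * exp (\<epsilon> * t)) has_vector_derivative H x * (\<epsilon> * exp (\<epsilon> * x)) + H' x * exp (\<epsilon> * x)) (at x within {0..})"
      using s by (intro has_vector_derivative_mult Hd)
        (auto simp: has_real_derivative_iff_has_vector_derivative[symmetric] intro!: derivative_eq_intros)
  next
    fix x assume x: "s < x" "x < t"
    then have "H' x + \<epsilon> * H x \<le> 0" using H'le[of x] small[of x] s by auto
    then have "(H' x + \<epsilon> * H x) * exp (\<epsilon> * x) \<le> 0" by (intro mult_nonpos_nonneg) auto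
    then show "H x * (\<epsilon> * exp (\<epsilon> * x)) + H' x * exp (\<epsilon> * x) \<le> 0" by (simp add: algebra_simps)
  qed (use s t in auto)
  then have "H t \<le> (H s * exp (\<epsilon> * s)) * exp (- \<epsilon> * t)" if "t \<ge> s" for t
  proof -
    assume *: "\<And>t. s \<le> t \<Longrightarrow> H t * exp (\<epsilon> * t) \<le> H s * exp (\<epsilon> * s)"
    have "H t = (H t * exp (\<epsilon> * t)) * exp (- \<epsilon> * t)" by (simp add: mult.assoc exp_add[symmetric])
    also have "\<dots> \<le> (H s * exp (\<epsilon> * s)) * exp (- \<epsilon> * t)" by (intro mult_right_mono *[OF that]) auto
    finally show ?thesis .
  qed
  moreover have "continuous_on {0..} H" by (rule continuous_on_Ici_if_derivative[OF Hd])
  ultimately have dec: "exp_decay H" using eps by (intro exp_decay_extend)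
  show "exp_decay E0" using dec by (rule exp_decay_mono) (use HD D_nonneg in fastforce)
  show "exp_decay D" using dec by (rule exp_decay_mono) (use HD E0_nonneg in fastforce)
qed

section \<open>Bounds and decay for all derivatives of the curvature\<close>

text \<open>
  Polynomials in \<open>lam\<close> and the curvature derivatives of order less than \<open>n\<close>, with constant coefficients.
  They record which derivatives occur in the lower order terms of an evolution equation.
\<close>

inductive_set curvature_poly :: "nat \<Rightarrow> (real \<Rightarrow> real \<Rightarrow> real) set" for n where
  const: "(\<lambda>p t. c) \<in> curvature_poly n"
| lam: "(\<lambda>p t. lam t) \<in> curvature_poly n"
| K: "j < n \<Longrightarrow> K j \<in> curvature_poly n"
| add: "q \<in> curvature_poly n \<Longrightarrow> r \<in> curvature_poly n \<Longrightarrow> (\<lambda>p t. q p t + r p t) \<in> curvature_poly n"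
| mult: "q \<in> curvature_poly n \<Longrightarrow> r \<in> curvature_poly n \<Longrightarrow> (\<lambda>p t. q p t * r p t) \<in> curvature_poly n"

lemma curvature_poly_mono: "q \<in> curvature_poly n \<Longrightarrow> n \<le> m \<Longrightarrow> q \<in> curvature_poly m"
  by (induction rule: curvature_poly.induct) (auto intro: curvature_poly.intros)

lemma curvature_poly_K0_V: "(\<lambda>p t. K 0 p t * V p t) \<in> curvature_poly (Suc 0)"
proof -
  have "(\<lambda>p t. K 0 p t * (K 0 p t + (-1) * lam t)) \<in> curvature_poly (Suc 0)"
    by (intro curvature_poly.intros) auto
  then show ?thesis by (simp add: V_eq)
qed

lemma curvature_poly_space_derivative:
  "q \<in> curvature_poly n \<Longrightarrow> \<exists>q'\<in>curvature_poly (Suc n). has_space_derivative q (\<lambda>p t. v p t * q' p t)"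
proof (induction rule: curvature_poly.induct)
  case (const c)
  show ?case by (intro bexI[of _ "\<lambda>p t. 0"] curvature_poly.const) auto
next
  case lam
  show ?case by (intro bexI[of _ "\<lambda>p t. 0"] curvature_poly.const) auto
next
  case (K j)
  then show ?case by (intro bexI[of _ "K (Suc j)"] curvature_poly.K K_space) auto
next
  case (add q r)
  then obtain q' r' where h: "q' \<in> curvature_poly (Suc n)" "r' \<in> curvature_poly (Suc n)"
    "has_space_derivative q (\<lambda>p t. v p t * q' p t)" "has_space_derivative r (\<lambda>p t. v p t * r' p t)" by blast
  have "has_space_derivative (\<lambda>p t. q p t + r p t) (\<lambda>p t. v p t * (q' p t + r' p t))"
    unfolding distrib_left by (intro allI impI has_vector_derivative_add h(3,4)[rule_format])
  then show ?case using h by (intro bexI[of _ "\<lambda>p t. q' p t + r' p t"] curvature_poly.add)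
next
  case (mult q r)
  then obtain q' r' where h: "q' \<in> curvature_poly (Suc n)" "r' \<in> curvature_poly (Suc n)"
    "has_space_derivative q (\<lambda>p t. v p t * q' p t)" "has_space_derivative r (\<lambda>p t. v p t * r' p t)" by blast
  have "has_space_derivative (\<lambda>p t. q p t * r p t) (\<lambda>p t. q p t * (v p t * r' p t) + (v p t * q' p t) * r p t)"
    by (intro allI impI has_vector_derivative_mult h(3,4)[rule_format])
  then have "has_space_derivative (\<lambda>p t. q p t * r p t) (\<lambda>p t. v p t * (q p t * r' p t + q' p t * r p t))"
    by (simp add: algebra_simps)
  then show ?case using h mult.hyps curvature_poly_mono[of _ n "Suc n"]
    by (intro bexI[of _ "\<lambda>p t. q p t * r' p t + q' p t * r p t"] curvature_poly.intros) auto
qed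

lemma K1_time: "has_time_derivative (K 1) (\<lambda>p t. K 3 p t + (3 * (K 0 p t * V p t) + K 0 p t * K 0 p t) * K 1 p t)"
proof -
  let ?c = "\<lambda>p t. K 3 p t + (2 * (K 0 p t * V p t) + K 0 p t * K 0 p t) * K 1 p t"
  have "has_space_derivative (\<lambda>p t. K 2 p t + (K 0 p t * K 0 p t) * V p t)
    (\<lambda>p t. v p t * K (Suc 2) p t + ((K 0 p t * K 0 p t) * (v p t * K 1 p t)
       + (K 0 p t * (v p t * K (Suc 0) p t) + (v p t * K (Suc 0) p t) * K 0 p t) * V p t))"
    by (intro allI impI has_vector_derivative_add has_vector_derivative_mult K_space[rule_format] V_space[rule_format])
  then have "has_space_derivative (\<lambda>p t. K 2 p t + (K 0 p t)\<^sup>2 * V p t) (\<lambda>p t. v p t * ?c p t)"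
    by (simp add: numeral_3_eq_3 numeral_2_eq_2 algebra_simps)
  from K_Suc_time[OF K0_time this] show ?thesis by (simp add: algebra_simps)
qed

text \<open>
  Beyond diffusion, the evolution of \<open>K (j + 1)\<close> is linear in \<open>K (j + 1)\<close> itself, with a coefficient that
  contains only the curvature and \<open>lam\<close>, and otherwise of lower order. Both the arc-length derivative
  and the commutator preserve this form.
\<close>

lemma K_time:
  "\<exists>a\<in>curvature_poly (Suc 0). \<exists>R\<in>curvature_poly (Suc j).
     has_time_derivative (K (Suc j)) (\<lambda>p t. K (Suc (Suc (Suc j))) p t + (a p t * K (Suc j) p t + R p t))"
proof (induction j)
  case 0
  have "(\<lambda>p t. 3 * (K 0 p t * V p t) + K 0 p t * K 0 p t) \<in> curvature_poly (Suc 0)"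
    by (intro curvature_poly.add curvature_poly.mult[OF curvature_poly.const] curvature_poly_K0_V
        curvature_poly.mult[OF curvature_poly.K curvature_poly.K]) auto
  then show ?case using K1_time
    by (intro bexI[of _ "\<lambda>p t. 3 * (K 0 p t * V p t) + K 0 p t * K 0 p t"] bexI[of _ "\<lambda>p t. 0"] curvature_poly.const)
       (simp_all add: numeral_3_eq_3)
next
  case (Suc j)
  then obtain a R where h: "a \<in> curvature_poly (Suc 0)" "R \<in> curvature_poly (Suc j)"
    "has_time_derivative (K (Suc j)) (\<lambda>p t. K (Suc (Suc (Suc j))) p t + (a p t * K (Suc j) p t + R p t))" by blast
  obtain a' where a': "a' \<in> curvature_poly (Suc (Suc 0))" "has_space_derivative a (\<lambda>p t. v p t * a' p t)"
    using curvature_poly_space_derivative[OF h(1)] by blast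
  obtain R' where R': "R' \<in> curvature_poly (Suc (Suc j))" "has_space_derivative R (\<lambda>p t. v p t * R' p t)"
    using curvature_poly_space_derivative[OF h(2)] by blast
  let ?c = "\<lambda>p t. K (Suc (Suc (Suc (Suc j)))) p t + (a p t * K (Suc (Suc j)) p t + (a' p t * K (Suc j) p t + R' p t))"
  have "has_space_derivative (\<lambda>p t. K (Suc (Suc (Suc j))) p t + (a p t * K (Suc j) p t + R p t))
     (\<lambda>p t. v p t * K (Suc (Suc (Suc (Suc j)))) p t + ((a p t * (v p t * K (Suc (Suc j)) p t)
        + (v p t * a' p t) * K (Suc j) p t) + v p t * R' p t))"
    by (intro allI impI has_vector_derivative_add has_vector_derivative_mult K_space[rule_format]
        a'(2)[rule_format] R'(2)[rule_format])
  then have "has_space_derivative (\<lambda>p t. K (Suc (Suc (Suc j))) p t + (a p t * K (Suc j) p t + R p t)) (\<lambda>p t. v p t * ?c p t)"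
    by (simp add: algebra_simps)
  from K_Suc_time[OF h(3) this]
  have t1: "has_time_derivative (K (Suc (Suc j))) (\<lambda>p t. K (Suc (Suc (Suc (Suc j)))) p t
      + ((a p t + K 0 p t * V p t) * K (Suc (Suc j)) p t + (a' p t * K (Suc j) p t + R' p t)))"
    by (simp add: algebra_simps)
  have a1: "(\<lambda>p t. a p t + K 0 p t * V p t) \<in> curvature_poly (Suc 0)"
    by (intro curvature_poly.add h(1) curvature_poly_K0_V)
  have r1: "(\<lambda>p t. a' p t * K (Suc j) p t + R' p t) \<in> curvature_poly (Suc (Suc j))"
    by (intro curvature_poly.add curvature_poly.mult curvature_poly.K R'(1) curvature_poly_mono[OF a'(1)]) auto
  show ?case
    by (intro bexI[of _ "\<lambda>p t. a p t + K 0 p t * V p t"] bexI[of _ "\<lambda>p t. a' p t * K (Suc j) p t + R' p t"] t1 a1 r1)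
qed

lemma K_time_lower_order:
  "\<exists>q\<in>curvature_poly (Suc j). has_time_derivative (K j) (\<lambda>p t. K (Suc (Suc j)) p t + q p t)"
proof (cases j)
  case 0
  have "(\<lambda>p t. K 0 p t * (K 0 p t * V p t)) \<in> curvature_poly (Suc 0)"
    by (intro curvature_poly.mult[OF curvature_poly.K curvature_poly_K0_V]) simp
  then show ?thesis using K0_time 0
    by (intro bexI[of _ "\<lambda>p t. K 0 p t * (K 0 p t * V p t)"]) (simp_all add: numeral_2_eq_2 power2_eq_square mult.assoc)
next
  case (Suc i)
  obtain a R where h: "a \<in> curvature_poly (Suc 0)" "R \<in> curvature_poly (Suc i)"
    "has_time_derivative (K (Suc i)) (\<lambda>p t. K (Suc (Suc (Suc i))) p t + (a p t * K (Suc i) p t + R p t))"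
    using K_time[of i] by blast
  then show ?thesis unfolding Suc
    by (intro bexI[of _ "\<lambda>p t. a p t * K (Suc i) p t + R p t"] curvature_poly.add curvature_poly.mult curvature_poly.K
        curvature_poly_mono[OF h(1)] curvature_poly_mono[OF h(2)]) auto
qed

definition uniformly_bounded :: "(real \<Rightarrow> real \<Rightarrow> 'a::real_normed_vector) \<Rightarrow> bool" where
  "uniformly_bounded q \<longleftrightarrow> (\<exists>B. \<forall>p. \<forall>t\<ge>0. norm (q p t) \<le> B)"

lemma lam_bounded: "\<exists>B>0. \<forall>t\<ge>0. \<bar>lam t\<bar> \<le> B"
proof -
  have "\<bar>lam t\<bar> \<le> kmax + D 0 / (2 * A 0 * Lmin)" if t: "t \<ge> 0" for t
  proof -
    have "D t / (2 * A 0 * Lmin) \<le> D 0 / (2 * A 0 * Lmin)"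
      using D_le_D0[OF t] A_0 Lmin_pos by (intro divide_right_mono) auto
    then show ?thesis using lam_bounds[OF t] \<kappa>\<^sub>0_bounds[OF t] by linarith
  qed
  moreover have "0 < kmax + D 0 / (2 * A 0 * Lmin)"
    using kmax_pos D_nonneg[of 0] A_0 Lmin_pos by (intro add_pos_nonneg) auto
  ultimately show ?thesis by blast
qed

lemma curvature_poly_bounded:
  "q \<in> curvature_poly n \<Longrightarrow> (\<And>j. j < n \<Longrightarrow> uniformly_bounded (K j)) \<Longrightarrow> uniformly_bounded q"
proof (induction rule: curvature_poly.induct)
  case (const c) then show ?case unfolding uniformly_bounded_def by auto
next
  case lam then show ?case unfolding uniformly_bounded_def using lam_bounded by auto
next
  case (K j) then show ?case by simp
next
  case (add q r)
  then obtain B C where "\<And>p t. t \<ge> 0 \<Longrightarrow> norm (q p t) \<le> B" "\<And>p t. t \<ge> 0 \<Longrightarrow> norm (r p t) \<le> C"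
    unfolding uniformly_bounded_def by blast
  then show ?case unfolding uniformly_bounded_def
    by (intro exI[of _ "B + C"] allI impI) (rule order_trans[OF norm_triangle_ineq add_mono], auto)
next
  case (mult q r)
  then obtain B C where "\<And>p t. t \<ge> 0 \<Longrightarrow> norm (q p t) \<le> B" "\<And>p t. t \<ge> 0 \<Longrightarrow> norm (r p t) \<le> C"
    unfolding uniformly_bounded_def by blast
  then show ?case unfolding uniformly_bounded_def
    by (intro exI[of _ "B * C"]) (auto simp: abs_mult intro!: mult_mono intro: order_trans[OF abs_ge_zero])
qed

text \<open>
  The derivative of \<open>E 1\<close> is at most \<open>- 2 E 2 + C (1 + E 1) E 1\<close>, and by interpolation
  \<open>(E 1)\<^sup>2 \<le> E0 E 2\<close>. As \<open>E0 \<le> 1 / C\<close> eventually, \<open>E 1\<close> cannot increase while it is at least 1.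
\<close>

lemma E1_bounded: "\<exists>B>0. \<forall>t\<ge>0. E 1 t \<le> B"
proof -
  obtain l where l: "l > 0" "\<And>t. t \<ge> 0 \<Longrightarrow> \<bar>lam t\<bar> \<le> l" using lam_bounded by blast
  \<comment> \<open>From \<open>5 \<kappa> V + 2 \<kappa>\<^sup>2 \<le> 10 \<kappa>\<^sup>2 + 5 lam\<^sup>2\<close>, with
    \<open>\<kappa>\<^sup>2\<close> estimated by \<open>E 1\<close> and \<open>\<kappa>\<^sub>0\<close>.\<close>
  define C where "C = 20 * Lmax + 20 * kmax\<^sup>2 + 5 * l\<^sup>2"
  have C: "C > 0" unfolding C_def using Lmax_pos by (intro add_pos_nonneg) auto
  define G where "G t = arc_integral (\<lambda>p t. (5 * (K 0 p t * V p t) + 2 * (K 0 p t)\<^sup>2) * (K 1 p t)\<^sup>2) t" for t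
  have d: "(E 1 has_vector_derivative - 2 * E 2 t + G t) (at t within {0..})" if t: "t \<ge> 0" for t
  proof -
    let ?b = "\<lambda>p t. K 3 p t + (3 * (K 0 p t * V p t) + K 0 p t * K 0 p t) * K 1 p t"
    have "arc_integral (\<lambda>p t. 2 * K 1 p t * ?b p t - V p t * K 0 p t * (K 1 p t)\<^sup>2) t
       = arc_integral (\<lambda>p t. 2 * ((K 1 p t - 0) * K (Suc (Suc 1)) p t) + (5 * (K 0 p t * V p t) + 2 * (K 0 p t)\<^sup>2) * (K 1 p t)\<^sup>2) t"
      by (simp add: numeral_3_eq_3 power2_eq_square algebra_simps)
    also have "\<dots> = arc_integral (\<lambda>p t. 2 * ((K 1 p t - 0) * K (Suc (Suc 1)) p t)) t + G t" unfolding G_def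
      by (rule arc_integral_add[where t=t and u="\<lambda>p t. 2 * ((K 1 p t - 0) * K (Suc (Suc 1)) p t)"
           and w="\<lambda>p t. (5 * (K 0 p t * V p t) + 2 * (K 0 p t)\<^sup>2) * (K 1 p t)\<^sup>2"])
         (intro continuous_intros K_cont V_cont t)+
    also have "arc_integral (\<lambda>p t. 2 * ((K 1 p t - 0) * K (Suc (Suc 1)) p t)) t = - 2 * E 2 t"
      using integral_by_parts[OF t, of 1 "\<lambda>_. 0"]
        arc_integral_cmult[of "\<lambda>_. 2" "\<lambda>p t. (K 1 p t - 0) * K (Suc (Suc 1)) p t" t]
      by (simp add: numeral_2_eq_2)
    finally show ?thesis using E_time[OF K1_time t] by simp
  qed
  have G: "G t \<le> C * (1 + E 1 t) * E 1 t" if t: "t \<ge> 0" for t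
  proof -
    have pw: "(5 * (K 0 p t * V p t) + 2 * (K 0 p t)\<^sup>2) * (K 1 p t)\<^sup>2 \<le> (C * (1 + E 1 t)) * (K 1 p t)\<^sup>2" for p
    proof (rule mult_right_mono)
      have "5 * (K 0 p t * V p t) + 2 * (K 0 p t)\<^sup>2 = 7 * (K 0 p t)\<^sup>2 - 5 * (K 0 p t * lam t)"
        by (simp add: V_eq power2_eq_square algebra_simps)
      also have "\<dots> \<le> 7 * (K 0 p t)\<^sup>2 + 3 * (K 0 p t)\<^sup>2 + 5 * (lam t)\<^sup>2"
      proof -
        have "3 * (K 0 p t)\<^sup>2 + 5 * (lam t)\<^sup>2 + 5 * (K 0 p t * lam t)
           = 5 / 2 * (K 0 p t + lam t)\<^sup>2 + (1 / 2 * (K 0 p t)\<^sup>2 + 5 / 2 * (lam t)\<^sup>2)"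
          by (simp add: power2_eq_square field_simps)
        moreover have "\<dots> \<ge> 0" by simp
        ultimately show ?thesis by linarith
      qed
      finally have "5 * (K 0 p t * V p t) + 2 * (K 0 p t)\<^sup>2 \<le> 10 * (K 0 p t)\<^sup>2 + 5 * (lam t)\<^sup>2" by simp
      moreover have "(lam t)\<^sup>2 \<le> l\<^sup>2" using l(2)[OF t] l(1) by (simp add: abs_le_square_iff[symmetric])
      moreover have "(K 0 p t)\<^sup>2 \<le> 2 * (K 0 p t - \<kappa>\<^sub>0 t)\<^sup>2 + 2 * (\<kappa>\<^sub>0 t)\<^sup>2"
        using sum_power2_ge_zero[of "K 0 p t - 2 * \<kappa>\<^sub>0 t" 0] by (simp add: power2_eq_square algebra_simps)
      ultimately have "5 * (K 0 p t * V p t) + 2 * (K 0 p t)\<^sup>2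
        \<le> 20 * (K 0 p t - \<kappa>\<^sub>0 t)\<^sup>2 + 20 * (\<kappa>\<^sub>0 t)\<^sup>2 + 5 * l\<^sup>2" by linarith
      also have "\<dots> \<le> 20 * (Lmax * E 1 t) + 20 * kmax\<^sup>2 + 5 * l\<^sup>2"
      proof -
        have "(\<kappa>\<^sub>0 t)\<^sup>2 \<le> kmax\<^sup>2" using \<kappa>\<^sub>0_bounds[OF t] by (intro power_mono) auto
        then show ?thesis using K0_deviation_le[OF t, of p] by linarith
      qed
      also have "\<dots> \<le> C * (1 + E 1 t)"
      proof -
        have "0 \<le> (20 * kmax\<^sup>2 + 5 * l\<^sup>2) * E 1 t" using E_nonneg[OF t] by simp
        then show ?thesis using Lmax_pos unfolding C_def by (simp add: algebra_simps)
      qed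
      finally show "5 * (K 0 p t * V p t) + 2 * (K 0 p t)\<^sup>2 \<le> C * (1 + E 1 t)" .
    qed simp
    have "G t \<le> arc_integral (\<lambda>p t. (C * (1 + E 1 t)) * (K 1 p t)\<^sup>2) t" unfolding G_def
      by (rule arc_integral_mono[where t=t and u="\<lambda>p t. (5 * (K 0 p t * V p t) + 2 * (K 0 p t)\<^sup>2) * (K 1 p t)\<^sup>2"
            and w="\<lambda>p t. (C * (1 + E 1 t)) * (K 1 p t)\<^sup>2"])
         (intro continuous_intros K_cont V_cont t pw)+
    also have "\<dots> = C * (1 + E 1 t) * E 1 t" unfolding E_def[of 1] by (rule arc_integral_cmult)
    finally show ?thesis .
  qed
  obtain s where s: "s \<ge> 0" "\<And>t. t \<ge> s \<Longrightarrow> E0 t \<le> 1 / C"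
    using exp_decay_small[OF E0_D_exp_decay(1), of "1 / C"] C by auto
  have "bounded (E 1 ` {0..s})"
    by (intro compact_imp_bounded compact_continuous_image continuous_on_subset[OF continuous_on_Ici_if_derivative[OF d]]) auto
  then obtain B where "\<forall>x\<in>E 1 ` {0..s}. norm x \<le> B" unfolding bounded_iff by blast
  then have "\<bar>E 1 t\<bar> \<le> B" if "0 \<le> t" "t \<le> s" for t using that by simp
  then have B: "E 1 t \<le> B" if "0 \<le> t" "t \<le> s" for t using that by (meson abs_ge_self order_trans)
  have "E 1 t \<le> max B 1" if t: "t \<ge> 0" for t
  proof (cases "t \<le> s")
    case False
    show ?thesis
    proof (rule stays_below_barrier[where f="E 1" and a=s and B=1, OF d])
      fix x assume x: "s \<le> x" "1 \<le> E 1 x"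
      then have x0: "x \<ge> 0" using s by simp
      have "C * (E 1 x)\<^sup>2 \<le> C * (E0 x * E 2 x)" using E1_interpolation[OF x0] C by (intro mult_left_mono) auto
      also have "\<dots> \<le> C * (1 / C * E 2 x)"
        using s(2)[OF x(1)] E_nonneg[OF x0] C by (intro mult_left_mono mult_right_mono) auto
      finally have "C * (E 1 x)\<^sup>2 \<le> E 2 x" using C by simp
      moreover have "C * (1 + E 1 x) * E 1 x \<le> C * (E 1 x + E 1 x) * E 1 x"
        using x C by (intro mult_right_mono mult_left_mono) auto
      ultimately show "- 2 * E 2 x + G x \<le> 0" using G[OF x0] by (simp add: power2_eq_square algebra_simps)
    qed (use s False B[of s] in auto)
  qed (use B[of t] t in auto)
  then show ?thesis by (intro exI[of _ "max B 1"]) auto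
qed

lemma K0_bounded: "uniformly_bounded (K 0)"
proof -
  obtain B where B: "B > 0" "\<And>t. t \<ge> 0 \<Longrightarrow> E 1 t \<le> B" using E1_bounded by blast
  have "norm (K 0 p t) \<le> kmax + sqrt (Lmax * B)" if t: "t \<ge> 0" for p t
  proof -
    have "(K 0 p t - \<kappa>\<^sub>0 t)\<^sup>2 \<le> Lmax * B"
      by (rule order_trans[OF K0_deviation_le[OF t] mult_left_mono[OF B(2)[OF t]]]) (use Lmax_pos in simp)
    then have "sqrt ((K 0 p t - \<kappa>\<^sub>0 t)\<^sup>2) \<le> sqrt (Lmax * B)" by (rule real_sqrt_le_mono)
    then show ?thesis using \<kappa>\<^sub>0_bounds[OF t] by simp
  qed
  then show ?thesis unfolding uniformly_bounded_def by blast
qed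

lemma initially_bounded: "\<exists>B. \<forall>p. \<bar>K j p 0\<bar> \<le> B"
proof -
  have "bounded ((\<lambda>p. K j p 0) ` {0..1})"
    by (intro compact_imp_bounded compact_continuous_image K_cont) auto
  then obtain B where B: "\<forall>x\<in>(\<lambda>p. K j p 0) ` {0..1}. norm x \<le> B" unfolding bounded_iff by blast
  have "\<bar>K j p 0\<bar> \<le> B" for p
  proof -
    have "frac p \<in> {0..1}" using frac_lt_1[of p] by (auto simp: less_imp_le)
    then have "norm (K j (frac p) 0) \<le> B" using B by blast
    then show ?thesis using periodic_frac[where f="\<lambda>p. K j p 0" and x=p, OF K_per[OF order_refl]] by simp
  qed
  then show ?thesis by blast
qed

text \<open>
  Bernstein's method. In the evolution of \<open>(K (i + 1))\<^sup>2\<close> the dangerous term is \<open>2 a (K (i + 1))\<^sup>2\<close>. The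
  evolution of \<open>N (K i)\<^sup>2\<close> contains \<open>- 2 N (K (i + 1))\<^sup>2\<close> from diffusion, so that for \<open>N > |a|\<close> the
  sum \<open>W\<close> satisfies \<open>W\<^sub>t \<le> W2 - W + C\<close>, to which the maximum principle applies.
\<close>

lemma K_bounded_step:
  assumes jt: "has_time_derivative (K (Suc i)) (\<lambda>p t. K (Suc (Suc (Suc i))) p t + (a p t * K (Suc i) p t + R p t))"
    and it: "has_time_derivative (K i) (\<lambda>p t. K (Suc (Suc i)) p t + q p t)"
    and bounds: "uniformly_bounded a" "uniformly_bounded R" "uniformly_bounded q" "uniformly_bounded (K i)"
  shows "uniformly_bounded (K (Suc i))"
proof -
  from bounds obtain Ba BR Bq Bi where Ba: "\<And>p t. t \<ge> 0 \<Longrightarrow> \<bar>a p t\<bar> \<le> Ba"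
    and BR: "\<And>p t. t \<ge> 0 \<Longrightarrow> \<bar>R p t\<bar> \<le> BR" and Bq: "\<And>p t. t \<ge> 0 \<Longrightarrow> \<bar>q p t\<bar> \<le> Bq"
    and Bi: "\<And>p t. t \<ge> 0 \<Longrightarrow> \<bar>K i p t\<bar> \<le> Bi"
    unfolding uniformly_bounded_def real_norm_def by metis
  have Ba0: "Ba \<ge> 0" using Ba[of 0 0] abs_ge_zero[of "a 0 0"] by linarith
  \<comment> \<open>The excess 1 over the bound of \<open>a\<close> pays for \<open>- W\<close> and for the mixed term with
    \<open>R\<close>.\<close>
  define N where "N = Ba + 1"
  define W where "W p t = K (Suc i) p t * K (Suc i) p t + N * (K i p t * K i p t)" for p t
  define Wt where "Wt p t = (K (Suc i) p t * (K (Suc (Suc (Suc i))) p t + (a p t * K (Suc i) p t + R p t))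
      + (K (Suc (Suc (Suc i))) p t + (a p t * K (Suc i) p t + R p t)) * K (Suc i) p t)
      + N * (K i p t * (K (Suc (Suc i)) p t + q p t) + (K (Suc (Suc i)) p t + q p t) * K i p t)" for p t
  define W1 where "W1 p t = 2 * (K (Suc i) p t * K (Suc (Suc i)) p t) + 2 * N * (K i p t * K (Suc i) p t)" for p t
  define W2 where "W2 p t = 2 * (K (Suc (Suc i)) p t)\<^sup>2 + 2 * (K (Suc i) p t * K (Suc (Suc (Suc i))) p t)
      + 2 * N * ((K (Suc i) p t)\<^sup>2 + K i p t * K (Suc (Suc i)) p t)" for p t
  define C where "C = BR\<^sup>2 + 2 * N * (Bi * Bq) + N * Bi\<^sup>2"
  obtain B1 where B1: "\<And>p. \<bar>K (Suc i) p 0\<bar> \<le> B1" using initially_bounded by blast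
  define M where "M = max C (B1\<^sup>2 + N * Bi\<^sup>2)"
  have N0: "N > 0" using Ba0 by (simp add: N_def)
  have Wle: "W p t \<le> M" if t: "t \<ge> 0" for p t
  proof (rule parabolic_maximum_principle[of W Wt v W1 W2 C])
    show "continuous_on (UNIV \<times> {0..}) (\<lambda>(p, t). W p t)"
      unfolding W_def by (intro Cinf_family_continuous Cinf_family_add Cinf_family_mult Cinf_family_const K_smooth)
    show "W (p + 1) t = W p t" if "t \<ge> 0" for p t by (simp add: W_def K_per[OF that])
    show "((\<lambda>\<tau>. W p \<tau>) has_real_derivative Wt p t) (at t within {0..})" if "t \<ge> 0" for p t
      unfolding W_def Wt_def has_real_derivative_iff_has_vector_derivative
      by (intro has_vector_derivative_add has_vector_derivative_mult has_vector_derivative_mult_right jt[rule_format] it[rule_format] that)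
    show "((\<lambda>x. W x t) has_real_derivative v p t * W1 p t) (at p)" if "t \<ge> 0" for p t
    proof -
      have "((\<lambda>x. W x t) has_vector_derivative
          (K (Suc i) p t * (v p t * K (Suc (Suc i)) p t) + (v p t * K (Suc (Suc i)) p t) * K (Suc i) p t)
          + N * (K i p t * (v p t * K (Suc i) p t) + (v p t * K (Suc i) p t) * K i p t)) (at p)"
        unfolding W_def by (intro has_vector_derivative_add has_vector_derivative_mult has_vector_derivative_mult_right K_space[rule_format] that)
      then show ?thesis unfolding W1_def has_real_derivative_iff_has_vector_derivative
        by (rule has_vector_derivative_eq_rhs) (simp add: algebra_simps)
    qed
    show "((\<lambda>x. W1 x t) has_real_derivative v p t * W2 p t) (at p)" if "t \<ge> 0" for p t
    proof -
      have "((\<lambda>x. W1 x t) has_vector_derivative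
          2 * (K (Suc i) p t * (v p t * K (Suc (Suc (Suc i))) p t) + (v p t * K (Suc (Suc i)) p t) * K (Suc (Suc i)) p t)
          + 2 * N * (K i p t * (v p t * K (Suc (Suc i)) p t) + (v p t * K (Suc i) p t) * K (Suc i) p t)) (at p)"
        unfolding W1_def by (intro has_vector_derivative_add has_vector_derivative_mult has_vector_derivative_mult_right K_space[rule_format] that)
      then show ?thesis unfolding W2_def has_real_derivative_iff_has_vector_derivative
        by (rule has_vector_derivative_eq_rhs) (simp add: power2_eq_square algebra_simps)
    qed
    show "Wt p t \<le> W2 p t - W p t + C" if t: "t \<ge> 0" for p t
    proof -
      let ?x = "K (Suc i) p t"
      have e: "Wt p t = W2 p t - 2 * (K (Suc (Suc i)) p t)\<^sup>2 - 2 * N * ?x\<^sup>2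
          + 2 * (a p t * ?x\<^sup>2) + 2 * (?x * R p t) + 2 * N * (K i p t * q p t)"
        by (simp add: Wt_def W2_def power2_eq_square algebra_simps)
      have 1: "a p t * ?x\<^sup>2 \<le> Ba * ?x\<^sup>2" using Ba[OF t, of p] by (intro mult_right_mono) auto
      have 2: "2 * (?x * R p t) \<le> ?x\<^sup>2 + BR\<^sup>2"
      proof -
        have "2 * (?x * R p t) \<le> ?x\<^sup>2 + (R p t)\<^sup>2"
          using sum_power2_ge_zero[of "?x - R p t" 0] by (simp add: power2_eq_square algebra_simps)
        moreover have "(R p t)\<^sup>2 \<le> BR\<^sup>2" using BR[OF t, of p] by (simp add: abs_le_square_iff[symmetric])
        ultimately show ?thesis by linarith
      qed
      have 3: "N * (K i p t * q p t) \<le> N * (Bi * Bq)"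
      proof (rule mult_left_mono)
        have "K i p t * q p t \<le> \<bar>K i p t\<bar> * \<bar>q p t\<bar>" by (metis abs_ge_self abs_mult)
        also have "\<dots> \<le> Bi * Bq" using Bi[OF t, of p] Bq[OF t, of p] by (intro mult_mono) auto
        finally show "K i p t * q p t \<le> Bi * Bq" .
      qed (use N0 in simp)
      have 4: "N * (K i p t)\<^sup>2 \<le> N * Bi\<^sup>2"
        using Bi[OF t, of p] N0 by (intro mult_left_mono) (auto simp: abs_le_square_iff[symmetric])
      have 5: "W p t = ?x\<^sup>2 + N * (K i p t)\<^sup>2" by (simp add: W_def power2_eq_square)
      have 6: "N * ?x\<^sup>2 = Ba * ?x\<^sup>2 + ?x\<^sup>2" by (simp add: N_def algebra_simps)
      have 7: "0 \<le> (K (Suc (Suc i)) p t)\<^sup>2" by simp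
      show ?thesis unfolding e C_def using 1 2 3 4 5 6 7 by linarith
    qed
    show "W p 0 \<le> M" for p
    proof -
      have "(K (Suc i) p 0)\<^sup>2 \<le> B1\<^sup>2" using B1[of p] by (simp add: abs_le_square_iff[symmetric])
      moreover have "N * (K i p 0)\<^sup>2 \<le> N * Bi\<^sup>2"
        using Bi[of 0 p] N0 by (intro mult_left_mono) (auto simp: abs_le_square_iff[symmetric])
      ultimately show ?thesis by (simp add: W_def M_def power2_eq_square)
    qed
    show "v p t > 0" if "t \<ge> 0" for p t by (rule v_pos[OF that])
    show "C \<le> M" by (simp add: M_def)
    show "t \<ge> 0" by (rule t)
  qed
  have "norm (K (Suc i) p t) \<le> sqrt M" if t: "t \<ge> 0" for p t
  proof -
    have "0 \<le> N * (K i p t * K i p t)" using N0 by simp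
    then have "(K (Suc i) p t)\<^sup>2 \<le> M" using Wle[OF t, of p] by (simp add: W_def power2_eq_square)
    then have "sqrt ((K (Suc i) p t)\<^sup>2) \<le> sqrt M" by (rule real_sqrt_le_mono)
    then show ?thesis by simp
  qed
  then show ?thesis unfolding uniformly_bounded_def by blast
qed

lemma K_bounded: "uniformly_bounded (K j)"
proof (induction j rule: less_induct)
  case (less j)
  show ?case
  proof (cases j)
    case 0 then show ?thesis using K0_bounded by simp
  next
    case (Suc i)
    obtain a R where h: "a \<in> curvature_poly (Suc 0)" "R \<in> curvature_poly (Suc i)"
      and jt: "has_time_derivative (K (Suc i)) (\<lambda>p t. K (Suc (Suc (Suc i))) p t + (a p t * K (Suc i) p t + R p t))"
      using K_time[of i] by blast
    obtain q where q: "q \<in> curvature_poly (Suc i)" and it: "has_time_derivative (K i) (\<lambda>p t. K (Suc (Suc i)) p t + q p t)"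
      using K_time_lower_order[of i] by blast
    have lower: "uniformly_bounded (K k)" if "k < Suc i" for k using less that Suc by auto
    show ?thesis unfolding Suc
      by (rule K_bounded_step[OF jt it curvature_poly_bounded[OF h(1)] curvature_poly_bounded[OF h(2)]
            curvature_poly_bounded[OF q]]) (use lower in auto)
  qed
qed

lemma curvature_poly_uniformly_bounded: "q \<in> curvature_poly n \<Longrightarrow> uniformly_bounded q"
  using curvature_poly_bounded K_bounded by blast

lemma E_bounded: "\<exists>B>0. \<forall>t\<ge>0. E j t \<le> B"
proof -
  obtain B where B: "\<And>p t. t \<ge> 0 \<Longrightarrow> \<bar>K j p t\<bar> \<le> B" using K_bounded[of j] unfolding uniformly_bounded_def by auto
  have "E j t \<le> B\<^sup>2 * Lmax + 1" if t: "t \<ge> 0" for t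
  proof -
    have sq: "(K j p t)\<^sup>2 \<le> B\<^sup>2" for p using power_mono[OF B[OF t, of p], of 2] by simp
    have "E j t \<le> arc_integral (\<lambda>p t. B\<^sup>2) t" unfolding E_def
      by (rule arc_integral_mono[where t=t and u="\<lambda>p t. (K j p t)\<^sup>2" and w="\<lambda>p t. B\<^sup>2"])
         (intro continuous_intros K_cont t sq)+
    also have "\<dots> = B\<^sup>2 * L t" by (rule arc_integral_const[OF t])
    also have "\<dots> \<le> B\<^sup>2 * Lmax" by (intro mult_left_mono L_le t) auto
    finally show ?thesis by simp
  qed
  moreover have "B\<^sup>2 * Lmax + 1 > 0" using Lmax_pos by (intro add_nonneg_pos) auto
  ultimately show ?thesis by blast
qed

text \<open>By interpolation each energy is at most the geometric mean of a decaying one and a bounded one.\<close>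

lemma E_exp_decay: "exp_decay (E (Suc j))"
proof (induction j)
  case 0
  obtain B where B: "B > 0" "\<And>t. t \<ge> 0 \<Longrightarrow> E 2 t \<le> B" using E_bounded by blast
  have "exp_decay (\<lambda>t. (E 1 t)\<^sup>2)"
  proof (rule exp_decay_mono[OF exp_decay_cmult[OF E0_D_exp_decay(1), of B]])
    fix t :: real assume t: "t \<ge> 0"
    have "E0 t * E 2 t \<le> E0 t * B" using B(2)[OF t] E0_nonneg[OF t] by (intro mult_left_mono)
    then show "(E 1 t)\<^sup>2 \<le> B * E0 t" using E1_interpolation[OF t] by (simp add: mult.commute)
  qed (use B in simp)
  then show ?case by (simp add: exp_decay_if_sq)
next
  case (Suc j)
  obtain B where B: "B > 0" "\<And>t. t \<ge> 0 \<Longrightarrow> E (Suc (Suc (Suc j))) t \<le> B" using E_bounded by blast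
  have "exp_decay (\<lambda>t. (E (Suc (Suc j)) t)\<^sup>2)"
  proof (rule exp_decay_mono[OF exp_decay_cmult[OF Suc.IH, of B]])
    fix t :: real assume t: "t \<ge> 0"
    have "E (Suc j) t * E (Suc (Suc (Suc j))) t \<le> E (Suc j) t * B"
      using B(2)[OF t] E_nonneg[OF t] by (intro mult_left_mono)
    then show "(E (Suc (Suc j)) t)\<^sup>2 \<le> B * E (Suc j) t" using E_interpolation[OF t, of "Suc j"] by (simp add: mult.commute)
  qed (use B in simp)
  then show ?case by (rule exp_decay_if_sq)
qed

lemma K0_exp_decay: "\<exists>e. exp_decay e \<and> (\<forall>p. \<forall>t\<ge>0. \<bar>K 0 p t - \<kappa>\<^sub>0 t\<bar> \<le> e t)"
proof (intro exI conjI allI impI)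
  show "exp_decay (\<lambda>t. sqrt (Lmax * E (Suc 0) t))"
    by (intro exp_decay_sqrt exp_decay_cmult E_exp_decay) (use Lmax_pos in simp)
  show "\<bar>K 0 p t - \<kappa>\<^sub>0 t\<bar> \<le> sqrt (Lmax * E (Suc 0) t)" if "t \<ge> 0" for p t
    using real_sqrt_le_mono[OF K0_deviation_le[OF that, of p]] by simp
qed

lemma K1_exp_decay: "\<exists>e. exp_decay e \<and> (\<forall>p. \<forall>t\<ge>0. \<bar>K 1 p t\<bar> \<le> e t)"
proof (intro exI conjI allI impI)
  show "exp_decay (\<lambda>t. sqrt (Lmax * E (Suc (Suc 0)) t))"
    by (intro exp_decay_sqrt exp_decay_cmult E_exp_decay) (use Lmax_pos in simp)
  show "\<bar>K 1 p t\<bar> \<le> sqrt (Lmax * E (Suc (Suc 0)) t)" if "t \<ge> 0" for p t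
    using real_sqrt_le_mono[OF K_Suc_le[OF that, of 0 p]] by simp
qed

section \<open>Limits of length, area, centre and base tangent\<close>

lemma arc_integral_norm_le:
  fixes u :: "real \<Rightarrow> real \<Rightarrow> 'a::euclidean_space"
  assumes "continuous_on {0..1} (\<lambda>p. u p t)" "t \<ge> 0" "\<And>p. norm (u p t) \<le> B"
  shows "norm (arc_integral u t) \<le> B * L t"
proof -
  have "norm (arc_integral u t) \<le> arc_integral (\<lambda>p t. B) t"
    unfolding arc_integral_def
    using assms v_pos[OF assms(2)]
    by (intro integral_norm_bound_integral integrable_continuous_real continuous_intros slice_continuous[OF v_smooth])
       (auto simp: less_imp_le mult_left_mono)
  then show ?thesis using arc_integral_const[OF assms(2), of "\<lambda>_. B"] by simp
qed

lemma V_exp_decay: "\<exists>e. exp_decay e \<and> (\<forall>p. \<forall>t\<ge>0. \<bar>V p t\<bar> \<le> e t)"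
proof -
  obtain e where e: "exp_decay e" "\<And>p t. t \<ge> 0 \<Longrightarrow> \<bar>K 0 p t - \<kappa>\<^sub>0 t\<bar> \<le> e t" using K0_exp_decay by blast
  have "exp_decay (\<lambda>t. e t + 1 / (2 * A 0 * Lmin) * D t)"
    by (intro exp_decay_add e exp_decay_cmult E0_D_exp_decay) (use A_0 Lmin_pos in simp)
  moreover have "\<bar>V p t\<bar> \<le> e t + 1 / (2 * A 0 * Lmin) * D t" if t: "t \<ge> 0" for p t
    using e(2)[OF t, of p] lam_bounds[OF t] unfolding V_eq by simp
  ultimately show ?thesis by blast
qed

definition "Linf = limit_length F"

lemma VK_integral_le:
  assumes t: "t \<ge> 0" and e: "\<And>p. \<bar>V p t\<bar> \<le> e" and B: "\<And>p. \<bar>K 0 p t\<bar> \<le> B"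
  shows "\<bar>arc_integral (\<lambda>p t. V p t * K 0 p t) t\<bar> \<le> e * B * Lmax"
proof -
  have e0: "e \<ge> 0" "B \<ge> 0" using e[of 0] B[of 0] abs_ge_zero order_trans by blast+
  have "norm (arc_integral (\<lambda>p t. V p t * K 0 p t) t) \<le> (e * B) * L t"
    by (rule arc_integral_norm_le[where u="\<lambda>p t. V p t * K 0 p t"])
       (use t e B e0 in \<open>auto simp: abs_mult intro!: continuous_intros K_cont V_cont mult_mono\<close>)
  also have "\<dots> \<le> (e * B) * Lmax" using e0 L_le[OF t] by (intro mult_left_mono) auto
  finally show ?thesis by simp
qed

text \<open>The length changes at a rate bounded by a multiple of the normal speed, which decays exponentially.\<close>

lemma L_limit: "exp_decay (\<lambda>t. \<bar>L t - Linf\<bar>)" "Linf \<ge> Lmin" "Linf \<le> Lmax"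
proof -
  obtain e where e: "exp_decay e" "\<And>p t. t \<ge> 0 \<Longrightarrow> \<bar>V p t\<bar> \<le> e t" using V_exp_decay by blast
  obtain B where B: "\<And>p t. t \<ge> 0 \<Longrightarrow> \<bar>K 0 p t\<bar> \<le> B" using K0_bounded unfolding uniformly_bounded_def by auto
  have B0: "B \<ge> 0" using B[of 0 0] abs_ge_zero order_trans by blast
  have "norm (- arc_integral (\<lambda>p t. V p t * K 0 p t) t) \<le> (B * Lmax) * e t" if t: "t \<ge> 0" for t
    using VK_integral_le[OF t e(2)[OF t] B[OF t]] by (simp add: mult_ac)
  then obtain l where l: "(flow_length F \<longlongrightarrow> l) at_top" "exp_decay (\<lambda>t. norm (L t - l))"
    using exp_decay_limit[OF L_time _ exp_decay_cmult[OF e(1), of "B * Lmax"]] B0 Lmax_pos by auto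
  have "Linf = l" unfolding Linf_def limit_length_def by (rule tendsto_Lim[OF _ l(1)]) simp
  then show "exp_decay (\<lambda>t. \<bar>L t - Linf\<bar>)" using l(2) by simp
  have ev: "eventually (\<lambda>t. Lmin \<le> L t) at_top" "eventually (\<lambda>t. L t \<le> Lmax) at_top"
    by (rule eventually_mono[OF eventually_ge_at_top[of 0]], erule L_ge)
       (rule eventually_mono[OF eventually_ge_at_top[of 0]], erule L_le)
  show "Linf \<ge> Lmin" unfolding \<open>Linf = l\<close> by (rule tendsto_lowerbound[OF l(1) ev(1)]) simp
  show "Linf \<le> Lmax" unfolding \<open>Linf = l\<close> by (rule tendsto_upperbound[OF l(1) ev(2)]) simp
qed

lemma Linf_pos: "Linf > 0" using L_limit Lmin_pos by simp

text \<open>\<open>4 \<pi> A = L\<^sup>2 - D\<close>, and the deficit decays.\<close>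

lemma A_limit: "exp_decay (\<lambda>t. \<bar>A t - Linf\<^sup>2 / (4 * pi)\<bar>)"
proof (rule exp_decay_mono)
  show "exp_decay (\<lambda>t. 1 / (4 * pi) * (2 * Lmax * \<bar>L t - Linf\<bar> + D t))"
    by (intro exp_decay_cmult exp_decay_add L_limit E0_D_exp_decay) (use Lmax_pos in auto)
  fix t :: real assume t: "t \<ge> 0"
  have "\<bar>(L t)\<^sup>2 - Linf\<^sup>2\<bar> = \<bar>L t + Linf\<bar> * \<bar>L t - Linf\<bar>"
    by (simp add: abs_mult[symmetric] power2_eq_square algebra_simps)
  also have "\<dots> \<le> (2 * Lmax) * \<bar>L t - Linf\<bar>"
    using L_le[OF t] L_pos[OF t] Linf_pos L_limit(3) by (intro mult_right_mono) auto
  finally have "\<bar>(L t)\<^sup>2 - D t - Linf\<^sup>2\<bar> \<le> 2 * Lmax * \<bar>L t - Linf\<bar> + D t"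
    using D_nonneg[OF t] by linarith
  moreover have "A t - Linf\<^sup>2 / (4 * pi) = ((L t)\<^sup>2 - D t - Linf\<^sup>2) / (4 * pi)"
    by (simp add: D_def field_simps)
  ultimately show "\<bar>A t - Linf\<^sup>2 / (4 * pi)\<bar> \<le> 1 / (4 * pi) * (2 * Lmax * \<bar>L t - Linf\<bar> + D t)"
    by (simp add: divide_right_mono)
qed

text \<open>Every point travels a finite distance, because the normal speed is integrable in time.\<close>

lemma F_bounded: "uniformly_bounded F"
proof -
  obtain e where e: "exp_decay e" "\<And>p t. t \<ge> 0 \<Longrightarrow> \<bar>V p t\<bar> \<le> e t" using V_exp_decay by blast
  then obtain C \<gamma> where *: "C > 0" "\<gamma> > 0" "\<And>t. t \<ge> 0 \<Longrightarrow> e t \<le> C * exp (- \<gamma> * t)"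
    unfolding exp_decay_def by blast
  have inc: "norm (F p t - F p 0) \<le> 2 * (C / \<gamma>)" if t: "t \<ge> 0" for p t
  proof -
    have "norm (of_real (V p t) * (\<i> * T p t)) \<le> C * exp (- \<gamma> * t)" if "t \<ge> 0" for t
      using e(2)[OF that, of p] *(3)[OF that] by (simp add: norm_mult T_unit[OF that])
    then obtain l where l: "\<And>t. t \<ge> 0 \<Longrightarrow> norm (F p t - l) \<le> C / \<gamma> * exp (- \<gamma> * t)"
      using exponential_limit[of "F p" "\<lambda>t. of_real (V p t) * (\<i> * T p t)" C \<gamma>] F_time * by auto
    have "C / \<gamma> * exp (- \<gamma> * t) \<le> C / \<gamma> * 1" using * t by (intro mult_left_mono) auto
    then have "norm (F p t - l) \<le> C / \<gamma>" using l[OF t] by simp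
    moreover have "norm (F p 0 - l) \<le> C / \<gamma>" using l[of 0] by simp
    moreover have "norm (F p t - F p 0) \<le> norm (F p t - l) + norm (F p 0 - l)" by (metis norm_minus_commute norm_triangle_sub dist_norm dist_triangle2)
    ultimately show ?thesis by linarith
  qed
  have "bounded ((\<lambda>p. F p 0) ` {0..1})"
    by (intro compact_imp_bounded compact_continuous_image slice_continuous[OF F_smooth]) auto
  then obtain B where B: "\<forall>x\<in>(\<lambda>p. F p 0) ` {0..1}. norm x \<le> B" unfolding bounded_iff by blast
  have "norm (F p 0) \<le> B" for p
  proof -
    have "frac p \<in> {0..1}" using frac_lt_1[of p] by (auto simp: less_imp_le)
    then have "norm (F (frac p) 0) \<le> B" using B by blast
    then show ?thesis using periodic_frac[where f="\<lambda>p. F p 0" and x=p, OF F_per[OF order_refl]] by simp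
  qed
  moreover have "norm (F p t) \<le> norm (F p 0) + norm (F p t - F p 0)" for p t by (rule norm_triangle_sub)
  ultimately have "norm (F p t) \<le> B + 2 * (C / \<gamma>)" if "t \<ge> 0" for p t
    using inc[OF that, of p] by (meson add_mono order_trans)
  then show ?thesis unfolding uniformly_bounded_def by blast
qed

lemma flow_center_eq: "t \<ge> 0 \<Longrightarrow> flow_center F t = unit_speed_curve.mean (flow_curve F t) (L t)"
proof -
  assume t: "t \<ge> 0"
  have "integral {0..L t} (\<lambda>s. flow_curve F t s * (1 / of_real (sqrt (L t)))) = integral {0..L t} (flow_curve F t) * (1 / of_real (sqrt (L t)))"
    by (rule integral_mult_left)
  then have "flow_center F t = (1 / sqrt (L t)) *\<^sub>R (integral {0..L t} (flow_curve F t) * (1 / of_real (sqrt (L t))))"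
    unfolding flow_center_def flow_coeff_def fourier_coeff_def complex_surj
    by (simp only: fourier_basis_def) (simp del: complex_surj)
  also have "\<dots> = (1 / L t) *\<^sub>R integral {0..L t} (flow_curve F t)"
    by (rule scaleR_inverse_sqrt_twice[OF L_pos[OF t]])
  finally show ?thesis by (simp add: unit_speed_curve.mean_def[OF unit_speed[OF t]])
qed

lemma flow_center_arc: "t \<ge> 0 \<Longrightarrow> flow_center F t = inverse (L t) *\<^sub>R arc_integral F t"
proof -
  assume t: "t \<ge> 0"
  have "flow_center F t = (1 / L t) *\<^sub>R integral {0..L t} (flow_curve F t)"
    unfolding flow_center_eq[OF t] by (rule unit_speed_curve.mean_def[OF unit_speed[OF t]])
  also have "integral {0..L t} (flow_curve F t) = arc_integral F t"
    using arc_integral_eq[where u=F, OF slice_continuous[OF F_smooth t] t] by (simp add: flow_curve_eq[OF t])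
  finally show ?thesis by (simp add: inverse_eq_divide)
qed

lemma flow_center_limit: "\<exists>c. exp_decay (\<lambda>t. norm (flow_center F t - c))"
proof -
  obtain e where e: "exp_decay e" "\<And>p t. t \<ge> 0 \<Longrightarrow> \<bar>V p t\<bar> \<le> e t" using V_exp_decay by blast
  obtain B where B: "\<And>p t. t \<ge> 0 \<Longrightarrow> \<bar>K 0 p t\<bar> \<le> B" using K0_bounded unfolding uniformly_bounded_def by auto
  obtain BF where BF: "\<And>p t. t \<ge> 0 \<Longrightarrow> norm (F p t) \<le> BF" using F_bounded unfolding uniformly_bounded_def by auto
  have B0: "B \<ge> 0" using B[of 0 0] abs_ge_zero order_trans by blast
  have BF0: "BF \<ge> 0" using BF[of 0 0] norm_ge_zero order_trans by blast
  define IF where "IF t = arc_integral (\<lambda>p t. of_real (V p t) * (\<i> * T p t) - (V p t * K 0 p t) *\<^sub>R F p t) t" for t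
  define l where "l t = arc_integral (\<lambda>p t. V p t * K 0 p t) t" for t
  define c' where "c' t = inverse (L t) *\<^sub>R IF t + (- (inverse (L t) * - l t * inverse (L t))) *\<^sub>R arc_integral F t" for t
  have d: "(flow_center F has_vector_derivative c' t) (at t within {0..})" if t: "t \<ge> 0" for t
  proof -
    have "(flow_length F has_real_derivative - l t) (at t within {0..})"
      using L_time[OF t] by (simp add: l_def has_real_derivative_iff_has_vector_derivative)
    then have "((\<lambda>t. inverse (L t)) has_vector_derivative - (inverse (L t) * - l t * inverse (L t))) (at t within {0..})"
      using DERIV_inverse'[of "flow_length F" "- l t" t "{0..}"] L_pos[OF t] by (simp add: has_real_derivative_iff_has_vector_derivative)
    then have "((\<lambda>t. inverse (L t) *\<^sub>R arc_integral F t) has_vector_derivative c' t) (at t within {0..})"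
      unfolding c'_def IF_def
      by (intro bounded_bilinear.has_vector_derivative[OF bounded_bilinear_scaleR] arc_integral_time[OF F_smooth F_time t])
    then show ?thesis
      by (rule has_vector_derivative_transform[rotated 2]) (use t in \<open>auto simp: flow_center_arc\<close>)
  qed
  define C where "C = inverse Lmin * ((1 + B * BF) * Lmax) + (inverse Lmin * (B * Lmax) * inverse Lmin) * (BF * Lmax)"
  have C0: "C \<ge> 0" unfolding C_def using B0 BF0 Lmin_pos Lmax_pos by (intro add_nonneg_nonneg mult_nonneg_nonneg) auto
  have "norm (c' t) \<le> C * e t" if t: "t \<ge> 0" for t
  proof -
    have e0: "e t \<ge> 0" using e(2)[OF t, of 0] by linarith
    have iL: "inverse (L t) \<le> inverse Lmin" "0 \<le> inverse (L t)"
      using L_ge[OF t] Lmin_pos L_pos[OF t] by (auto intro: le_imp_inverse_le)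
    have l: "\<bar>l t\<bar> \<le> e t * B * Lmax" unfolding l_def by (rule VK_integral_le[OF t e(2)[OF t] B[OF t]])
    have "norm (of_real (V p t) * (\<i> * T p t) - (V p t * K 0 p t) *\<^sub>R F p t) \<le> e t + e t * B * BF" for p
    proof -
      have "norm (of_real (V p t) * (\<i> * T p t) - (V p t * K 0 p t) *\<^sub>R F p t) \<le> \<bar>V p t\<bar> + \<bar>V p t\<bar> * \<bar>K 0 p t\<bar> * norm (F p t)"
        by (rule order_trans[OF norm_triangle_ineq4]) (simp add: norm_mult T_unit[OF t] abs_mult)
      also have "\<dots> \<le> e t + e t * B * BF"
        using e(2)[OF t, of p] B[OF t, of p] BF[OF t, of p] e0 B0 by (intro add_mono mult_mono) auto
      finally show ?thesis .
    qed
    then have "norm (IF t) \<le> (e t + e t * B * BF) * L t" unfolding IF_def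
      by (intro arc_integral_norm_le[where u="\<lambda>p t. of_real (V p t) * (\<i> * T p t) - (V p t * K 0 p t) *\<^sub>R F p t"] t
          continuous_intros K_cont V_cont slice_continuous[OF F_smooth t] slice_continuous[OF T_smooth t])
    also have "\<dots> \<le> (e t + e t * B * BF) * Lmax"
      using e0 B0 BF0 L_le[OF t] by (intro mult_left_mono) auto
    finally have IF: "norm (IF t) \<le> (e t + e t * B * BF) * Lmax" .
    have "norm (arc_integral F t) \<le> BF * L t"
      by (intro arc_integral_norm_le[where u=F] slice_continuous[OF F_smooth t] t BF)
    also have "\<dots> \<le> BF * Lmax" using BF0 L_le[OF t] by (intro mult_left_mono) auto
    finally have AF: "norm (arc_integral F t) \<le> BF * Lmax" .
    have "norm (c' t) \<le> inverse (L t) * norm (IF t) + (inverse (L t) * \<bar>l t\<bar> * inverse (L t)) * norm (arc_integral F t)"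
      unfolding c'_def using iL(2) L_pos[OF t] by (intro order_trans[OF norm_triangle_ineq]) (simp add: abs_mult)
    also have "\<dots> \<le> inverse Lmin * ((e t + e t * B * BF) * Lmax) + (inverse Lmin * (e t * B * Lmax) * inverse Lmin) * (BF * Lmax)"
      using iL l IF AF e0 B0 BF0 Lmax_pos Lmin_pos by (intro add_mono mult_mono) auto
    also have "\<dots> = C * e t" by (simp add: C_def algebra_simps)
    finally show ?thesis .
  qed
  then show ?thesis using exp_decay_limit[OF d _ exp_decay_cmult[OF e(1) C0]] by blast
qed

text \<open>
  The tangent at the base point turns at the rate \<open>K 1\<close>, which decays. This fixes the limit of the phase of
  the first Fourier coefficient.
\<close>

lemma T_base_limit: "\<exists>l. norm l = 1 \<and> exp_decay (\<lambda>t. norm (T 0 t - l))"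
proof -
  obtain e where e: "exp_decay e" "\<And>p t. t \<ge> 0 \<Longrightarrow> \<bar>K 1 p t\<bar> \<le> e t" using K1_exp_decay by blast
  have "norm (of_real (K 1 0 t) * \<i> * T 0 t) \<le> e t" if t: "t \<ge> 0" for t
    using e(2)[OF t, of 0] by (simp add: norm_mult T_unit[OF t])
  then obtain l where l: "(T 0 \<longlongrightarrow> l) at_top" "exp_decay (\<lambda>t. norm (T 0 t - l))"
    using exp_decay_limit[of "T 0" "\<lambda>t. of_real (K 1 0 t) * \<i> * T 0 t", OF _ _ e(1)] T_time by blast
  have "((\<lambda>t. norm (T 0 t)) \<longlongrightarrow> norm l) at_top" by (intro tendsto_intros l)
  moreover have "((\<lambda>t. norm (T 0 t)) \<longlongrightarrow> 1) at_top"
    by (rule tendsto_eventually) (use T_unit in \<open>auto intro: eventually_mono[OF eventually_ge_at_top[of 0]]\<close>)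
  ultimately have "norm l = 1" by (intro tendsto_unique[OF _ _ _]) auto
  then show ?thesis using l by blast
qed

text \<open>
  The total deviation of the curvature from its mean, which controls the distance of the curve from a
  circle.
\<close>

definition "dev t = unit_speed_curve.deviation (\<lambda>s. K 0 (prm t s) t) (L t)"

lemma \<omega>_eq: "t \<ge> 0 \<Longrightarrow> unit_speed_curve.\<omega> (L t) = \<kappa>\<^sub>0 t"
  by (simp add: unit_speed_curve.\<omega>_def[OF unit_speed] \<kappa>\<^sub>0_def)

lemma dev_exp_decay: "exp_decay dev"
proof -
  obtain e where e: "exp_decay e" "\<And>p t. t \<ge> 0 \<Longrightarrow> \<bar>K 0 p t - \<kappa>\<^sub>0 t\<bar> \<le> e t" using K0_exp_decay by blast
  show ?thesis
  proof (rule exp_decay_mono[OF exp_decay_cmult[OF e(1), of Lmax]])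
    fix t :: real assume t: "t \<ge> 0"
    have "dev t \<le> L t * e t" unfolding dev_def
      by (rule unit_speed_curve.deviation_le[OF unit_speed[OF t]]) (use e(2)[OF t] in \<open>simp add: \<omega>_eq[OF t]\<close>)
    also have "\<dots> \<le> Lmax * e t" using L_le[OF t] e(2)[OF t, of 0] by (intro mult_right_mono) auto
    finally show "dev t \<le> Lmax * e t" .
  qed (use Lmax_pos in simp)
qed

lemma dev_nonneg: "t \<ge> 0 \<Longrightarrow> dev t \<ge> 0"
  unfolding dev_def by (rule unit_speed_curve.deviation_nonneg[OF unit_speed])

lemma inverse_\<kappa>\<^sub>0: "t \<ge> 0 \<Longrightarrow> 1 / \<kappa>\<^sub>0 t = L t / (2 * pi)" "t \<ge> 0 \<Longrightarrow> 1 / \<kappa>\<^sub>0 t \<le> Lmax / (2 * pi)"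
  using L_le[of t] by (auto simp: \<kappa>\<^sub>0_def divide_right_mono)

lemma dev_div_exp_decay: "exp_decay (\<lambda>t. dev t / \<kappa>\<^sub>0 t)"
proof (rule exp_decay_mono[OF exp_decay_cmult[OF dev_exp_decay, of "Lmax / (2 * pi)"]])
  show "dev t / \<kappa>\<^sub>0 t \<le> Lmax / (2 * pi) * dev t" if "t \<ge> 0" for t
    using mult_right_mono[OF inverse_\<kappa>\<^sub>0(2)[OF that] dev_nonneg[OF that]] by simp
qed (use Lmax_pos in simp)

lemma prm_0: "t \<ge> 0 \<Longrightarrow> prm t 0 = 0"
  using immersed_closed_curve.param_0[OF immersed] by (simp add: prm_def)

lemma first_coefficient:
  assumes t: "t \<ge> 0"
  shows "norm ((1 / sqrt (L t)) *\<^sub>R flow_coeff F 1 t - T 0 t / (\<i> * of_real (\<kappa>\<^sub>0 t))) \<le> dev t / \<kappa>\<^sub>0 t"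
proof -
  let ?e = "\<lambda>s. exp (- \<i> * of_real (\<kappa>\<^sub>0 t * s))"
  have "flow_coeff F 1 t = integral {0..L t} (\<lambda>s. flow_curve F t s * ?e s * (1 / of_real (sqrt (L t))))"
    unfolding flow_coeff_def fourier_coeff_def fourier_basis_def
    by (rule arg_cong[where f="integral _"]) (simp add: fun_eq_iff exp_cnj \<kappa>\<^sub>0_def mult_ac)
  also have "\<dots> = integral {0..L t} (\<lambda>s. flow_curve F t s * ?e s) * (1 / of_real (sqrt (L t)))"
    by (rule integral_mult_left)
  finally have e: "flow_coeff F 1 t = integral {0..L t} (\<lambda>s. flow_curve F t s * ?e s) * (1 / of_real (sqrt (L t)))" .
  have "(1 / sqrt (L t)) *\<^sub>R flow_coeff F 1 t = (1 / L t) *\<^sub>R integral {0..L t} (\<lambda>s. flow_curve F t s * ?e s)"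
    unfolding e by (rule scaleR_inverse_sqrt_twice[OF L_pos[OF t]])
  then show ?thesis
    using unit_speed_curve.first_coefficient_close[OF unit_speed[OF t]]
    by (simp only: \<omega>_eq[OF t] prm_0[OF t] dev_def)
qed

section \<open>Derivatives of the curve in arc length\<close>

primrec tangent_deriv :: "nat \<Rightarrow> real \<Rightarrow> real \<Rightarrow> complex" where
  "tangent_deriv 0 = T"
| "tangent_deriv (Suc m) = (\<lambda>p t. of_real (inverse (v p t)) * vector_derivative (\<lambda>x. tangent_deriv m x t) (at p))"

text \<open>
  In the moving frame \<open>T\<close>, \<open>i T\<close> the components are polynomials in the curvature derivatives, which are
  known to be bounded.
\<close>

lemma tangent_deriv_form: "\<exists>n. \<exists>P\<in>curvature_poly n. \<exists>Q\<in>curvature_poly n. has_space_derivative (tangent_deriv m) (\<lambda>p t. of_real (v p t) * tangent_deriv (Suc m) p t)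
    \<and> (\<forall>p. \<forall>t\<ge>0. tangent_deriv m p t = T p t * (of_real (P p t) + \<i> * of_real (Q p t)))"
proof (induction m)
  have step: "has_space_derivative (tangent_deriv m) (\<lambda>p t. of_real (v p t) * tangent_deriv (Suc m) p t)
     \<and> (\<forall>p. \<forall>t\<ge>0. tangent_deriv (Suc m) p t = T p t * (of_real (P' p t + (-1) * (K 0 p t * Q p t)) + \<i> * of_real (Q' p t + K 0 p t * P p t)))"
    if f: "\<And>p t. t \<ge> 0 \<Longrightarrow> tangent_deriv m p t = T p t * (of_real (P p t) + \<i> * of_real (Q p t))"
      and P': "has_space_derivative P (\<lambda>p t. v p t * P' p t)" and Q': "has_space_derivative Q (\<lambda>p t. v p t * Q' p t)"
    for m P Q P' Q'
  proof (intro conjI allI impI)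
    fix p t :: real assume t: "t \<ge> 0"
    define z where "z = T p t * (of_real (P' p t + (-1) * (K 0 p t * Q p t)) + \<i> * of_real (Q' p t + K 0 p t * P p t))"
    have "((\<lambda>x. T x t * (of_real (P x t) + \<i> * of_real (Q x t))) has_vector_derivative
       T p t * (of_real (v p t * P' p t) + \<i> * of_real (v p t * Q' p t))
       + (\<i> * of_real (v p t * K 0 p t) * T p t) * (of_real (P p t) + \<i> * of_real (Q p t))) (at p)"
      by (intro has_vector_derivative_mult has_vector_derivative_add has_vector_derivative_mult_right
          has_vector_derivative_complex_of_real T_space[rule_format] P'[rule_format] Q'[rule_format] t)
    also have "T p t * (of_real (v p t * P' p t) + \<i> * of_real (v p t * Q' p t))
       + (\<i> * of_real (v p t * K 0 p t) * T p t) * (of_real (P p t) + \<i> * of_real (Q p t)) = of_real (v p t) * z"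
      by (simp add: z_def algebra_simps)
    finally have d: "((\<lambda>x. tangent_deriv m x t) has_vector_derivative of_real (v p t) * z) (at p)" by (simp add: f[OF t])
    then have z: "tangent_deriv (Suc m) p t = z"
      using v_pos[OF t, of p] by (simp add: vector_derivative_at[OF d])
    then show "tangent_deriv (Suc m) p t = T p t * (of_real (P' p t + (-1) * (K 0 p t * Q p t)) + \<i> * of_real (Q' p t + K 0 p t * P p t))"
      by (simp only: z_def)
    show "((\<lambda>x. tangent_deriv m x t) has_vector_derivative of_real (v p t) * tangent_deriv (Suc m) p t) (at p)" using d z by simp
  qed
  {
    case 0
    have "has_space_derivative (\<lambda>p t. 1::real) (\<lambda>p t. v p t * 0)" "has_space_derivative (\<lambda>p t. 0::real) (\<lambda>p t. v p t * 0)"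
      by simp_all
    moreover have "tangent_deriv 0 p t = T p t * (of_real 1 + \<i> * of_real 0)" for p t by simp
    ultimately have "has_space_derivative (tangent_deriv 0) (\<lambda>p t. of_real (v p t) * tangent_deriv (Suc 0) p t)"
      by (intro conjunct1[OF step[of 0 "\<lambda>p t. 1" "\<lambda>p t. 0" "\<lambda>p t. 0" "\<lambda>p t. 0"]])
    then show ?case
      by (intro exI[of _ 0] bexI[of _ "\<lambda>p t. 1"] bexI[of _ "\<lambda>p t. 0"] curvature_poly.const conjI) simp_all
  next
    case (Suc m)
    then obtain n P Q where h: "P \<in> curvature_poly n" "Q \<in> curvature_poly n"
      "\<And>p t. t \<ge> 0 \<Longrightarrow> tangent_deriv m p t = T p t * (of_real (P p t) + \<i> * of_real (Q p t))" by blast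
    obtain P' where P': "P' \<in> curvature_poly (Suc n)" "has_space_derivative P (\<lambda>p t. v p t * P' p t)"
      using curvature_poly_space_derivative[OF h(1)] by blast
    obtain Q' where Q': "Q' \<in> curvature_poly (Suc n)" "has_space_derivative Q (\<lambda>p t. v p t * Q' p t)"
      using curvature_poly_space_derivative[OF h(2)] by blast
    let ?P = "\<lambda>p t. P' p t + (-1) * (K 0 p t * Q p t)" and ?Q = "\<lambda>p t. Q' p t + K 0 p t * P p t"
    have PQ: "?P \<in> curvature_poly (Suc n)" "?Q \<in> curvature_poly (Suc n)"
      by (intro curvature_poly.intros(4,5) curvature_poly.const curvature_poly.K P'(1) Q'(1)
          curvature_poly_mono[OF h(1)] curvature_poly_mono[OF h(2)]; simp)+
    have f: "tangent_deriv (Suc m) p t = T p t * (of_real (?P p t) + \<i> * of_real (?Q p t))" if "t \<ge> 0" for p t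
      using step[OF h(3) P'(2) Q'(2)] that by blast
    obtain P'' where P'': "has_space_derivative ?P (\<lambda>p t. v p t * P'' p t)"
      using curvature_poly_space_derivative[OF PQ(1)] by blast
    obtain Q'' where Q'': "has_space_derivative ?Q (\<lambda>p t. v p t * Q'' p t)"
      using curvature_poly_space_derivative[OF PQ(2)] by blast
    have "has_space_derivative (tangent_deriv (Suc m)) (\<lambda>p t. of_real (v p t) * tangent_deriv (Suc (Suc m)) p t)"
      using step[of "Suc m" ?P ?Q, OF f P'' Q''] by blast
    then show ?case
      by (intro exI[of _ "Suc n"] bexI[of _ ?P] bexI[of _ ?Q] conjI PQ) (use f in simp_all)
  }
qed

lemma tangent_deriv_space: "has_space_derivative (tangent_deriv m) (\<lambda>p t. of_real (v p t) * tangent_deriv (Suc m) p t)"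
  using tangent_deriv_form by blast

lemma tangent_deriv_bounded: "uniformly_bounded (tangent_deriv m)"
proof -
  obtain n P Q where h: "P \<in> curvature_poly n" "Q \<in> curvature_poly n"
    "\<And>p t. t \<ge> 0 \<Longrightarrow> tangent_deriv m p t = T p t * (of_real (P p t) + \<i> * of_real (Q p t))" using tangent_deriv_form by blast
  obtain B C where "\<And>p t. t \<ge> 0 \<Longrightarrow> \<bar>P p t\<bar> \<le> B" "\<And>p t. t \<ge> 0 \<Longrightarrow> \<bar>Q p t\<bar> \<le> C"
    using curvature_poly_uniformly_bounded[OF h(1)] curvature_poly_uniformly_bounded[OF h(2)]
    unfolding uniformly_bounded_def real_norm_def by metis
  then have "norm (tangent_deriv m p t) \<le> B + C" if "t \<ge> 0" for p t
    using that norm_triangle_ineq[of "of_real (P p t)" "\<i> * of_real (Q p t)"]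
    by (simp add: h(3) norm_mult T_unit) (meson add_mono order_trans)
  then show ?thesis unfolding uniformly_bounded_def by blast
qed

text \<open>The \<open>j\<close>-th derivative of the curve by arc length; the first is the tangent, which shifts the index.\<close>

definition "arc_deriv j t s = (case j of 0 \<Rightarrow> flow_curve F t s | Suc m \<Rightarrow> tangent_deriv m (prm t s) t)"

lemma arc_deriv_derivative:
  "t \<ge> 0 \<Longrightarrow> (arc_deriv j t has_vector_derivative arc_deriv (Suc j) t s) (at s)"
proof (cases j)
  case 0
  assume "t \<ge> 0" with 0 show ?thesis using flow_curve_deriv[of t s] by (simp add: arc_deriv_def[abs_def])
next
  case (Suc m)
  assume t: "t \<ge> 0"
  have "((\<lambda>s. tangent_deriv m (prm t s) t) has_vector_derivative tangent_deriv (Suc m) (prm t s) t) (at s)"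
    by (rule prm_compose_deriv[OF t]) (use tangent_deriv_space t in \<open>auto simp: scaleR_conv_of_real\<close>)
  then show ?thesis by (simp add: arc_deriv_def[abs_def] Suc del: tangent_deriv.simps)
qed

end

section \<open>The first Fourier coefficient and the normalized curve\<close>

locale fourier_flow = area_flow +
  fixes r \<sigma> :: "real \<Rightarrow> real"
  assumes r_nonneg: "\<And>t. t \<ge> 0 \<Longrightarrow> r t \<ge> 0"
    and coeff: "\<And>t. t \<ge> 0 \<Longrightarrow> flow_coeff F 1 t = complex_of_real (sqrt (L t) * r t) *
             exp (\<i> * complex_of_real (2 * pi * \<sigma> t / L t))"
begin

definition "phase t = exp (\<i> * complex_of_real (\<kappa>\<^sub>0 t * \<sigma> t))"

lemma norm_phase: "norm (phase t) = 1" by (simp add: phase_def)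

text \<open>
  Divided by the square root of the length, the first Fourier coefficient is \<open>r\<close> times \<open>phase\<close>, and it is
  close to \<open>T 0 / (i\<kappa>\<^sub>0)\<close>. Comparing absolute values gives \<open>r\<close>, and then the phase follows.
\<close>

lemma coeff_close:
  assumes t: "t \<ge> 0"
  shows "norm (of_real (r t) * phase t - T 0 t / (\<i> * of_real (\<kappa>\<^sub>0 t))) \<le> dev t / \<kappa>\<^sub>0 t"
proof -
  have "(1 / sqrt (L t)) *\<^sub>R flow_coeff F 1 t = of_real (r t) * phase t"
    using L_pos[OF t] unfolding coeff[OF t] by (simp add: scaleR_conv_of_real phase_def \<kappa>\<^sub>0_def mult_ac)
  then show ?thesis using first_coefficient[OF t] by simp
qed

lemma r_close:
  assumes t: "t \<ge> 0"
  shows "\<bar>r t - 1 / \<kappa>\<^sub>0 t\<bar> \<le> dev t / \<kappa>\<^sub>0 t"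
proof -
  have "norm (of_real (r t) * phase t) = r t" using r_nonneg[OF t] by (simp add: norm_mult norm_phase)
  moreover have "norm (T 0 t / (\<i> * of_real (\<kappa>\<^sub>0 t))) = 1 / \<kappa>\<^sub>0 t"
    using \<kappa>\<^sub>0_bounds[OF t] by (simp add: norm_divide norm_mult T_unit[OF t])
  ultimately show ?thesis
    using coeff_close[OF t] norm_triangle_ineq3[of "of_real (r t) * phase t" "T 0 t / (\<i> * of_real (\<kappa>\<^sub>0 t))"] by linarith
qed

lemma phase_close:
  assumes t: "t \<ge> 0"
  shows "norm (phase t - T 0 t / \<i>) \<le> 2 * dev t"
proof -
  let ?k = "\<kappa>\<^sub>0 t"
  have k: "?k > 0" using \<kappa>\<^sub>0_bounds[OF t] by simp
  have "phase t - T 0 t / \<i> = of_real ?k * (of_real (1 / ?k - r t) * phase t + (of_real (r t) * phase t - T 0 t / (\<i> * of_real ?k)))"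
    using k by (simp add: field_simps)
  then have "norm (phase t - T 0 t / \<i>) = ?k * norm (of_real (1 / ?k - r t) * phase t + (of_real (r t) * phase t - T 0 t / (\<i> * of_real ?k)))"
    using k by (simp add: norm_mult del: of_real_diff)
  also have "\<dots> \<le> ?k * (\<bar>1 / ?k - r t\<bar> + dev t / ?k)"
    using k coeff_close[OF t]
    by (intro mult_left_mono order_trans[OF norm_triangle_ineq] add_mono) (simp_all add: norm_mult norm_phase del: of_real_diff)
  also have "\<dots> \<le> ?k * (dev t / ?k + dev t / ?k)"
    using k r_close[OF t] by (intro mult_left_mono add_mono) (auto simp: abs_minus_commute)
  also have "\<dots> = 2 * dev t" using k by (simp add: field_simps)
  finally show ?thesis .
qed

lemma r_limit: "exp_decay (\<lambda>t. \<bar>r t - Linf / (2 * pi)\<bar>)"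
proof (rule exp_decay_mono)
  show "exp_decay (\<lambda>t. dev t / \<kappa>\<^sub>0 t + 1 / (2 * pi) * \<bar>L t - Linf\<bar>)"
    by (intro exp_decay_add exp_decay_cmult dev_div_exp_decay L_limit) simp
  fix t :: real assume t: "t \<ge> 0"
  have "L t / (2 * pi) - Linf / (2 * pi) = 1 / (2 * pi) * (L t - Linf)" by (simp add: field_simps)
  then have "\<bar>L t / (2 * pi) - Linf / (2 * pi)\<bar> = 1 / (2 * pi) * \<bar>L t - Linf\<bar>" by (simp add: abs_mult)
  then show "\<bar>r t - Linf / (2 * pi)\<bar> \<le> dev t / \<kappa>\<^sub>0 t + 1 / (2 * pi) * \<bar>L t - Linf\<bar>"
    using r_close[OF t] unfolding inverse_\<kappa>\<^sub>0(1)[OF t] by linarith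
qed

text \<open>
  On the unit circle the class of \<open>\<sigma>\<close> is \<open>phase\<close>, which converges to \<open>l / i\<close> with \<open>l\<close> the limit of the tangent at
  the base point. The limit angle \<open>\<alpha>\<close> corresponds to \<open>\<alpha> Linf / (2 \<pi>)\<close> in the limit; since the period \<open>L\<close>
  depends on time, its change enters as an additional error.
\<close>

lemma \<sigma>_limit: "\<exists>s. exp_decay (\<lambda>t. quotient_dist (L t) (\<sigma> t) s)"
proof -
  obtain l where l: "norm l = 1" "exp_decay (\<lambda>t. norm (T 0 t - l))" using T_base_limit by blast
  define \<alpha> where "\<alpha> = Arg (l / \<i>)"
  have "l / \<i> \<noteq> 0" using l by auto
  then have \<alpha>: "exp (\<i> * complex_of_real \<alpha>) = l / \<i>"
    using cis_Arg[of "l / \<i>"] l by (simp add: \<alpha>_def cis_conv_exp sgn_eq norm_divide norm_mult)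
  define s where "s = \<alpha> * Linf / (2 * pi)"
  have le: "quotient_dist (L t) (\<sigma> t) s \<le> Lmax / 4 * (2 * dev t + norm (T 0 t - l) + \<bar>\<alpha>\<bar> / Lmin * \<bar>L t - Linf\<bar>)"
    if t: "t \<ge> 0" for t
  proof -
    have "quotient_dist (L t) (\<sigma> t) s \<le> L t / 4 * norm (exp (\<i> * complex_of_real (2 * pi / L t * \<sigma> t)) - exp (\<i> * complex_of_real (2 * pi / L t * s)))"
      by (rule quotient_dist_le[OF L_pos[OF t]])
    also have "\<dots> \<le> Lmax / 4 * (2 * dev t + norm (T 0 t - l) + \<bar>\<alpha>\<bar> / Lmin * \<bar>L t - Linf\<bar>)"
    proof (intro mult_mono)
      have e: "exp (\<i> * complex_of_real (2 * pi / L t * \<sigma> t)) = phase t" by (simp add: phase_def \<kappa>\<^sub>0_def)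
      have 1: "norm (T 0 t / \<i> - l / \<i>) = norm (T 0 t - l)"
        unfolding diff_divide_distrib[symmetric] by (simp only: norm_divide norm_ii div_by_1)
      have "\<alpha> - 2 * pi / L t * s = \<alpha> / L t * (L t - Linf)"
        using L_pos[OF t] by (simp add: s_def field_simps)
      then have "\<bar>\<alpha> - 2 * pi / L t * s\<bar> = \<bar>\<alpha>\<bar> / L t * \<bar>L t - Linf\<bar>" using L_pos[OF t] by (simp add: abs_mult)
      also have "\<dots> \<le> \<bar>\<alpha>\<bar> / Lmin * \<bar>L t - Linf\<bar>"
        using L_ge[OF t] Lmin_pos L_pos[OF t] by (intro mult_right_mono divide_left_mono) auto
      finally have 2: "norm (l / \<i> - exp (\<i> * complex_of_real (2 * pi / L t * s))) \<le> \<bar>\<alpha>\<bar> / Lmin * \<bar>L t - Linf\<bar>"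
        unfolding \<alpha>[symmetric] by (rule order_trans[OF norm_exp_i_diff_le])
      have "phase t - exp (\<i> * complex_of_real (2 * pi / L t * s))
         = (phase t - T 0 t / \<i>) + (T 0 t / \<i> - l / \<i>) + (l / \<i> - exp (\<i> * complex_of_real (2 * pi / L t * s)))" by simp
      then have "norm (phase t - exp (\<i> * complex_of_real (2 * pi / L t * s)))
         \<le> norm (phase t - T 0 t / \<i>) + norm (T 0 t / \<i> - l / \<i>) + norm (l / \<i> - exp (\<i> * complex_of_real (2 * pi / L t * s)))"
        by (simp only:) (intro order_trans[OF norm_triangle_ineq] add_right_mono norm_triangle_ineq)
      then show "norm (exp (\<i> * complex_of_real (2 * pi / L t * \<sigma> t)) - exp (\<i> * complex_of_real (2 * pi / L t * s)))
         \<le> 2 * dev t + norm (T 0 t - l) + \<bar>\<alpha>\<bar> / Lmin * \<bar>L t - Linf\<bar>"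
        unfolding e using phase_close[OF t] 1 2 by linarith
    qed (use L_le[OF t] Lmax_pos in auto)
    finally show ?thesis .
  qed
  have dec: "exp_decay (\<lambda>t. Lmax / 4 * (2 * dev t + norm (T 0 t - l) + \<bar>\<alpha>\<bar> / Lmin * \<bar>L t - Linf\<bar>))"
    by (intro exp_decay_cmult exp_decay_add dev_exp_decay l(2) L_limit) (use Lmax_pos Lmin_pos in auto)
  show ?thesis by (rule exI[of _ s], rule exp_decay_mono[OF dec le])
qed

definition "cinf = (SOME c. exp_decay (\<lambda>t. norm (flow_center F t - c)))"

lemma center_limit: "exp_decay (\<lambda>t. norm (flow_center F t - cinf))"
  unfolding cinf_def by (rule someI_ex[OF flow_center_limit])

definition "Rinf = Linf / (2 * pi)"

lemma Rinf_pos: "Rinf > 0" using Linf_pos by (simp add: Rinf_def)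

text \<open>
  The \<open>j\<close>-th derivative in \<open>\<theta>\<close> of the difference of the normalized curve and the limit circle; the centre
  contributes only for \<open>j = 0\<close>.
\<close>

definition "gap j t \<theta> = (L t) ^ j *\<^sub>R arc_deriv j t (L t * \<theta> - \<sigma> t)
   - ((if j = 0 then cinf else 0) + Rinf *\<^sub>R ((2 * of_real pi * \<i>) ^ j * circ \<theta>))"

lemma gap_0: "gap 0 t \<theta> = normalized_curve F \<sigma> t \<theta> - (cinf + Rinf *\<^sub>R circ \<theta>)"
  by (simp add: gap_def arc_deriv_def normalized_curve_def)

lemma gap_deriv:
  assumes t: "t \<ge> 0"
  shows "(gap j t has_vector_derivative gap (Suc j) t \<theta>) (at \<theta>)"
proof -
  have i: "((\<lambda>\<theta>. L t * \<theta> - \<sigma> t) has_vector_derivative L t * 1 - 0) (at \<theta>)"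
    by (intro has_vector_derivative_diff has_vector_derivative_mult_right has_vector_derivative_id has_vector_derivative_const)
  have "((arc_deriv j t \<circ> (\<lambda>\<theta>. L t * \<theta> - \<sigma> t)) has_vector_derivative
     (L t * 1 - 0) *\<^sub>R arc_deriv (Suc j) t (L t * \<theta> - \<sigma> t)) (at \<theta>)"
    by (rule vector_diff_chain_at[OF i arc_deriv_derivative[OF t]])
  then have a: "((\<lambda>\<theta>. arc_deriv j t (L t * \<theta> - \<sigma> t)) has_vector_derivative
     L t *\<^sub>R arc_deriv (Suc j) t (L t * \<theta> - \<sigma> t)) (at \<theta>)" by (simp add: o_def)
  have "(gap j t has_vector_derivative (L t) ^ j *\<^sub>R (L t *\<^sub>R arc_deriv (Suc j) t (L t * \<theta> - \<sigma> t))
     - (0 + Rinf *\<^sub>R ((2 * of_real pi * \<i>) ^ j * (2 * of_real pi * \<i> * circ \<theta>)))) (at \<theta>)"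
    unfolding gap_def[abs_def]
    by (intro has_vector_derivative_diff has_vector_derivative_add has_vector_derivative_const
        bounded_linear.has_vector_derivative[OF bounded_linear_scaleR_right] has_vector_derivative_mult_right a circ_deriv)
  then show ?thesis by (simp add: gap_def mult_ac)
qed

lemma gap_bounded: "\<exists>B. \<forall>t\<ge>0. \<forall>\<theta>. norm (gap (Suc j) t \<theta>) \<le> B"
proof -
  obtain B where B: "\<And>p t. t \<ge> 0 \<Longrightarrow> norm (tangent_deriv j p t) \<le> B" using tangent_deriv_bounded[of j] unfolding uniformly_bounded_def by auto
  have B0: "B \<ge> 0" using B[of 0 0] norm_ge_zero order_trans by blast
  have "norm (gap (Suc j) t \<theta>) \<le> Lmax ^ Suc j * B + Rinf * (2 * pi) ^ Suc j" if t: "t \<ge> 0" for t \<theta>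
  proof -
    have "norm (gap (Suc j) t \<theta>) \<le> norm ((L t) ^ Suc j *\<^sub>R tangent_deriv j (prm t (L t * \<theta> - \<sigma> t)) t)
        + norm (Rinf *\<^sub>R ((2 * of_real pi * \<i>) ^ Suc j * circ \<theta>))"
    proof -
      have "gap (Suc j) t \<theta> = (L t) ^ Suc j *\<^sub>R tangent_deriv j (prm t (L t * \<theta> - \<sigma> t)) t
         - Rinf *\<^sub>R ((2 * of_real pi * \<i>) ^ Suc j * circ \<theta>)"
        by (simp add: gap_def arc_deriv_def del: power_Suc tangent_deriv.simps)
      then show ?thesis by (simp only: norm_triangle_ineq4)
    qed
    also have "\<dots> \<le> Lmax ^ Suc j * B + Rinf * (2 * pi) ^ Suc j"
    proof (rule add_mono)
      have "norm ((L t) ^ Suc j *\<^sub>R tangent_deriv j (prm t (L t * \<theta> - \<sigma> t)) t) = (L t) ^ Suc j * norm (tangent_deriv j (prm t (L t * \<theta> - \<sigma> t)) t)"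
        using L_pos[OF t] by (simp del: power_Suc)
      also have "\<dots> \<le> Lmax ^ Suc j * B"
        using B[OF t] L_pos[OF t] L_le[OF t] B0 by (intro mult_mono power_mono) auto
      finally show "norm ((L t) ^ Suc j *\<^sub>R tangent_deriv j (prm t (L t * \<theta> - \<sigma> t)) t) \<le> Lmax ^ Suc j * B" .
      show "norm (Rinf *\<^sub>R ((2 * of_real pi * \<i>) ^ Suc j * circ \<theta>)) \<le> Rinf * (2 * pi) ^ Suc j"
        using Rinf_pos by (simp add: norm_mult norm_power circ_norm del: power_Suc)
    qed
    finally show ?thesis .
  qed
  then show ?thesis by blast
qed

text \<open>
  With \<open>s = L \<theta> - \<sigma>\<close> and \<open>\<omega> = \<kappa>\<^sub>0\<close>, the curve is \<open>centre + twist * e\<^sup>i\<^sup>\<omega>\<^sup>s / (i \<omega>)\<close>. Here \<open>centre\<close> is close to the centre of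
  mass of the curve, \<open>twist / i\<close> is close to \<open>phase\<close>, and \<open>phase * e\<^sup>i\<^sup>\<omega>\<^sup>s\<close> is the point of the unit circle with
  parameter \<open>\<theta>\<close>: the shift by \<open>\<sigma>\<close> removes the rotation of the first Fourier mode.
\<close>

lemma gap_0_le:
  assumes t: "t \<ge> 0"
  shows "norm (gap 0 t \<theta>) \<le> 5 * (dev t / \<kappa>\<^sub>0 t) + norm (flow_center F t - cinf) + 1 / (2 * pi) * \<bar>L t - Linf\<bar>"
proof -
  let ?f = "flow_curve F t" and ?T = "\<lambda>s. T (prm t s) t" and ?k = "\<lambda>s. K 0 (prm t s) t"
  define s where "s = L t * \<theta> - \<sigma> t"
  let ?w = "\<kappa>\<^sub>0 t"
  have w: "?w > 0" using \<kappa>\<^sub>0_bounds[OF t] by simp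
  note u = unit_speed[OF t]
  define ce where "ce = unit_speed_curve.centre ?f ?T (L t) s"
  define tw where "tw = unit_speed_curve.twist ?T (L t) s"
  have ce: "norm (ce - flow_center F t) \<le> 2 * (dev t / ?w)"
    using unit_speed_curve.centre_close[OF u, of s] by (simp add: ce_def dev_def flow_center_eq[OF t] \<omega>_eq[OF t])
  have tw: "norm (tw - T 0 t) \<le> dev t"
    using unit_speed_curve.twist_close[OF u, of s] by (simp add: tw_def dev_def prm_0[OF t])
  have tw': "tw = ?T s * exp (- \<i> * of_real (?w * s))"
    unfolding tw_def unit_speed_curve.twist_def[OF u] \<omega>_eq[OF t] ..
  have es: "exp (\<i> * of_real (?w * s)) * phase t = circ \<theta>"
  proof -
    have "?w * s = 2 * pi * \<theta> - ?w * \<sigma> t" using L_pos[OF t] by (simp add: s_def \<kappa>\<^sub>0_def field_simps)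
    then have "complex_of_real (?w * s) + complex_of_real (?w * \<sigma> t) = complex_of_real (2 * pi * \<theta>)"
      by (simp only: of_real_add[symmetric]) simp
    then have "\<i> * complex_of_real (?w * s) + \<i> * complex_of_real (?w * \<sigma> t) = \<i> * complex_of_real (2 * pi * \<theta>)"
      by (simp only: distrib_left[symmetric])
    then show ?thesis unfolding phase_def circ_def by (simp only: exp_add[symmetric])
  qed
  have "exp (- \<i> * of_real (?w * s)) * exp (\<i> * of_real (?w * s)) = 1" by (simp add: exp_add[symmetric])
  then have Ts: "?T s = tw * exp (\<i> * of_real (?w * s))" unfolding tw' by (simp add: mult.assoc)
  have "?f s = ce + ?T s / (\<i> * of_real ?w)"
    unfolding ce_def unit_speed_curve.centre_def[OF u] \<omega>_eq[OF t] by simp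
  also have "\<dots> = ce + (tw / \<i>) * exp (\<i> * of_real (?w * s)) / of_real ?w"
    unfolding Ts by (simp only: divide_divide_eq_left[symmetric] times_divide_eq_left)
  finally have fs: "?f s = ce + (tw / \<i>) * exp (\<i> * of_real (?w * s)) / of_real ?w" .
  have "gap 0 t \<theta> = (ce - flow_center F t) + (flow_center F t - cinf)
     + (tw / \<i> - phase t) * exp (\<i> * of_real (?w * s)) / of_real ?w + of_real (1 / ?w - Rinf) * circ \<theta>"
  proof -
    have alg: "a + q * e / W - (z + R * (e * ph)) = (a - b) + (b - z) + (q - ph) * e / W + (1 / W - R) * (e * ph)"
      for a b z q e ph W R :: complex
      by (simp add: algebra_simps diff_divide_distrib)
    have "gap 0 t \<theta> = ?f s - (cinf + of_real Rinf * circ \<theta>)"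
      by (simp add: gap_def arc_deriv_def s_def scaleR_conv_of_real)
    also have "\<dots> = ce + (tw / \<i>) * exp (\<i> * of_real (?w * s)) / of_real ?w
       - (cinf + of_real Rinf * (exp (\<i> * of_real (?w * s)) * phase t))" unfolding fs es ..
    also have "\<dots> = (ce - flow_center F t) + (flow_center F t - cinf)
      + (tw / \<i> - phase t) * exp (\<i> * of_real (?w * s)) / of_real ?w
      + (1 / of_real ?w - of_real Rinf) * (exp (\<i> * of_real (?w * s)) * phase t)" by (rule alg)
    finally show ?thesis by (simp only: es of_real_diff of_real_divide of_real_1)
  qed
  then have "norm (gap 0 t \<theta>) \<le> norm (ce - flow_center F t) + norm (flow_center F t - cinf)
     + norm ((tw / \<i> - phase t) * exp (\<i> * of_real (?w * s)) / of_real ?w) + norm (of_real (1 / ?w - Rinf) * circ \<theta>)"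
    by (simp only:) (intro order_trans[OF norm_triangle_ineq] add_right_mono norm_triangle_ineq)
  moreover have "norm ((tw / \<i> - phase t) * exp (\<i> * of_real (?w * s)) / of_real ?w) \<le> 3 * (dev t / ?w)"
  proof -
    have "norm (tw / \<i> - phase t) \<le> norm (tw / \<i> - T 0 t / \<i>) + norm (phase t - T 0 t / \<i>)"
      by (metis norm_minus_commute norm_triangle_sub dist_norm dist_triangle2)
    also have "norm (tw / \<i> - T 0 t / \<i>) = norm (tw - T 0 t)"
      unfolding diff_divide_distrib[symmetric] by (simp only: norm_divide norm_ii div_by_1)
    finally have "norm (tw / \<i> - phase t) \<le> 3 * dev t" using tw phase_close[OF t] by linarith
    then show ?thesis using w by (simp add: norm_mult norm_divide divide_right_mono)
  qed
  moreover have "norm (of_real (1 / ?w - Rinf) * circ \<theta>) = 1 / (2 * pi) * \<bar>L t - Linf\<bar>"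
  proof -
    have "1 / ?w - Rinf = 1 / (2 * pi) * (L t - Linf)" using inverse_\<kappa>\<^sub>0(1)[OF t] by (simp add: Rinf_def field_simps)
    then show ?thesis by (simp only: norm_mult circ_norm norm_of_real) (simp add: abs_mult)
  qed
  ultimately show ?thesis using ce by linarith
qed

lemma gap_exp_decay: "\<exists>e. exp_decay e \<and> (\<forall>t\<ge>0. \<forall>\<theta>. norm (gap j t \<theta>) \<le> e t)"
proof (rule derivatives_exp_decay[OF gap_deriv gap_bounded _ gap_0_le])
  show "exp_decay (\<lambda>t. 5 * (dev t / \<kappa>\<^sub>0 t) + norm (flow_center F t - cinf) + 1 / (2 * pi) * \<bar>L t - Linf\<bar>)"
    by (intro exp_decay_add exp_decay_cmult dev_div_exp_decay center_limit L_limit) auto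
qed

lemma iterated_derivative_gap: "t \<ge> 0 \<Longrightarrow> iterated_derivative j (gap 0 t) = gap j t"
proof (induction j)
  case (Suc j)
  have "iterated_derivative (Suc j) (gap 0 t) = (\<lambda>x. vector_derivative (iterated_derivative j (gap 0 t)) (at x))"
    by (simp add: iterated_derivative_def)
  also have "\<dots> = gap (Suc j) t" 
    unfolding Suc.IH[OF Suc.prems] by (rule ext, rule vector_derivative_at[OF gap_deriv[OF Suc.prems]])
  finally show ?case .
qed (simp add: iterated_derivative_def)

lemma Ck_norm_exp_decay: "exp_decay (\<lambda>t. Ck_norm k (gap 0 t))"
proof -
  have "\<forall>j. \<exists>e. exp_decay e \<and> (\<forall>t\<ge>0. \<forall>\<theta>. norm (gap j t \<theta>) \<le> e t)" using gap_exp_decay by blast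
  then obtain e where e: "\<And>j. exp_decay (e j)" "\<And>j t \<theta>. t \<ge> 0 \<Longrightarrow> norm (gap j t \<theta>) \<le> e j t" by metis
  show ?thesis
  proof (rule exp_decay_mono[OF exp_decay_sum[OF e(1)]])
    show "Ck_norm k (gap 0 t) \<le> (\<Sum>j\<le>k. e j t)" if "t \<ge> 0" for t
      unfolding Ck_norm_def using that
      by (intro sum_mono cSUP_least) (auto simp: iterated_derivative_gap e(2))
  qed
qed

lemma gap_0_per: "t \<ge> 0 \<Longrightarrow> gap 0 t (\<theta> + 1) = gap 0 t \<theta>"
proof -
  assume t: "t \<ge> 0"
  have e: "L t * (\<theta> + 1) - \<sigma> t = (L t * \<theta> - \<sigma> t) + L t" by (simp add: algebra_simps)
  have "flow_curve F t (L t * (\<theta> + 1) - \<sigma> t) = flow_curve F t (L t * \<theta> - \<sigma> t)"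
    unfolding e by (rule unit_speed_curve.f_per[OF unit_speed[OF t]])
  then show ?thesis by (simp add: gap_0 normalized_curve_def circ_per)
qed

definition "enclosed_domain t = interior (convex hull (range (normalized_curve F \<sigma> t)))"

lemma eventually_near_circle:
  "\<exists>e s. exp_decay e \<and> s \<ge> 0 \<and> (\<forall>t\<ge>s. near_circle Rinf (e t) (gap 0 t) (gap 1 t) (gap 2 t)
     \<and> near_circle.body cinf Rinf (gap 0 t) = convex hull (range (normalized_curve F \<sigma> t))
     \<and> range (near_circle.\<gamma> cinf Rinf (gap 0 t)) = range (normalized_curve F \<sigma> t))"
proof -
  have "\<forall>j. \<exists>e. exp_decay e \<and> (\<forall>t\<ge>0. \<forall>\<theta>. norm (gap j t \<theta>) \<le> e t)" using gap_exp_decay by blast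
  then obtain e where e: "\<And>j. exp_decay (e j)" "\<And>j t \<theta>. t \<ge> 0 \<Longrightarrow> norm (gap j t \<theta>) \<le> e j t" by metis
  have e0: "e j t \<ge> 0" if "t \<ge> 0" for j t using e(2)[OF that, of j 0] norm_ge_zero order_trans by blast
  define d where "d t = e 0 t + e 1 t + e 2 t" for t
  have dd: "exp_decay d" unfolding d_def by (intro exp_decay_add e)
  obtain s where s: "s \<ge> 0" "\<And>t. t \<ge> s \<Longrightarrow> d t \<le> Rinf / 4"
    using exp_decay_small[OF dd, of "Rinf / 4"] Rinf_pos by auto
  have "near_circle Rinf (d t) (gap 0 t) (gap 1 t) (gap 2 t)
     \<and> near_circle.body cinf Rinf (gap 0 t) = convex hull (range (normalized_curve F \<sigma> t))
     \<and> range (near_circle.\<gamma> cinf Rinf (gap 0 t)) = range (normalized_curve F \<sigma> t)" if "t \<ge> s" for t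
  proof -
    have t: "t \<ge> 0" using that s by simp
    have nc: "near_circle Rinf (d t) (gap 0 t) (gap 1 t) (gap 2 t)"
    proof
      show "norm (gap 0 t x) \<le> d t" "norm (gap 1 t x) \<le> d t" "norm (gap 2 t x) \<le> d t" for x
        using e(2)[OF t, of 0 x] e(2)[OF t, of 1 x] e(2)[OF t, of 2 x] e0[OF t] by (auto simp: d_def add_increasing add_increasing2)
      show "(gap 0 t has_vector_derivative gap 1 t x) (at x)" for x using gap_deriv[OF t, of 0 x] by simp
      show "(gap 1 t has_vector_derivative gap 2 t x) (at x)" for x using gap_deriv[OF t, of 1 x] by (simp add: numeral_2_eq_2)
    qed (use Rinf_pos s(2)[OF that] gap_0_per[OF t] in auto)
    have "near_circle.\<gamma> cinf Rinf (gap 0 t) = normalized_curve F \<sigma> t"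
      by (simp add: fun_eq_iff near_circle.\<gamma>_def[OF nc] gap_0)
    then show ?thesis using nc by (simp add: near_circle.body_def[OF nc])
  qed
  then show ?thesis using dd s(1) by blast
qed

lemma enclosed_domain_properties:
  "\<exists>e s. exp_decay e \<and> s \<ge> 0 \<and> (\<forall>t\<ge>s. bounded_domain (enclosed_domain t)
     \<and> frontier (enclosed_domain t) = range (normalized_curve F \<sigma> t) \<and> strictly_convex (enclosed_domain t)
     \<and> hausdorff_dist (closure (enclosed_domain t)) (cball cinf Rinf) \<le> e t
     \<and> norm (integral (enclosed_domain t) (\<lambda>x. x) - (pi * Rinf\<^sup>2) *\<^sub>R cinf) \<le> (norm cinf + 2 * Rinf) * (4 * pi * Rinf * e t))"
proof -
  obtain e s where e: "exp_decay e" "s \<ge> 0"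
    and n: "\<And>t. t \<ge> s \<Longrightarrow> near_circle Rinf (e t) (gap 0 t) (gap 1 t) (gap 2 t)"
    and b: "\<And>t. t \<ge> s \<Longrightarrow> near_circle.body cinf Rinf (gap 0 t) = convex hull (range (normalized_curve F \<sigma> t))"
    and r: "\<And>t. t \<ge> s \<Longrightarrow> range (near_circle.\<gamma> cinf Rinf (gap 0 t)) = range (normalized_curve F \<sigma> t)"
    using eventually_near_circle by blast
  have "bounded_domain (enclosed_domain t)
     \<and> frontier (enclosed_domain t) = range (normalized_curve F \<sigma> t) \<and> strictly_convex (enclosed_domain t)
     \<and> hausdorff_dist (closure (enclosed_domain t)) (cball cinf Rinf) \<le> e t
     \<and> norm (integral (enclosed_domain t) (\<lambda>x. x) - (pi * Rinf\<^sup>2) *\<^sub>R cinf) \<le> (norm cinf + 2 * Rinf) * (4 * pi * Rinf * e t)"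
    if t: "t \<ge> s" for t
  proof -
    interpret near_circle cinf Rinf "e t" "gap 0 t" "gap 1 t" "gap 2 t" by (rule n[OF t])
    have dom: "enclosed_domain t = interior body" by (simp add: enclosed_domain_def b[OF t])
    have "norm (integral (enclosed_domain t) (\<lambda>x. x) - (pi * Rinf\<^sup>2) *\<^sub>R cinf) \<le> (norm cinf + 2 * Rinf) * (4 * pi * Rinf * e t)"
    proof (rule first_moment_close)
      show "ball cinf (Rinf - e t) \<subseteq> enclosed_domain t"
        unfolding dom using interior_mono[OF inner_disk] by simp
      show "enclosed_domain t \<subseteq> cball cinf (Rinf + e t)" unfolding dom using hull_subset interior_subset by blast
    qed (use eps small Rinf_pos in \<open>auto simp: dom\<close>)
    then show ?thesis
      using bounded_domain_interior_hull frontier_interior_hull r[OF t] strictly_convex_interior_hull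
        hausdorff_dist_le closure_interior_hull by (simp add: dom)
  qed
  then show ?thesis using e by blast
qed

text \<open>Both \<open>A b\<close>, the first moment, and \<open>A c\<close> converge to \<open>\<pi> Rinf\<^sup>2\<close> times the limit centre.\<close>

lemma moment_limit:
  "\<exists>C>0. \<exists>\<gamma>>0. \<forall>\<^sub>F t in at_top.
     norm (A t *\<^sub>R ((1 / A t) *\<^sub>R integral (enclosed_domain t) (\<lambda>x. x) - flow_center F t)) \<le> C * exp (- \<gamma> * t)"
proof -
  obtain e s where e: "exp_decay e" "s \<ge> 0"
    and m: "\<And>t. t \<ge> s \<Longrightarrow> norm (integral (enclosed_domain t) (\<lambda>x. x) - (pi * Rinf\<^sup>2) *\<^sub>R cinf)
        \<le> (norm cinf + 2 * Rinf) * (4 * pi * Rinf * e t)"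
    using enclosed_domain_properties by blast
  obtain B where B: "\<And>t. t \<ge> 0 \<Longrightarrow> A t \<le> B" using A_bounded by blast
  have B0: "B \<ge> 0" using B[of 0] A_0 by simp
  define h where "h t = (norm cinf + 2 * Rinf) * (4 * pi * Rinf) * e t
     + (B * norm (flow_center F t - cinf) + norm cinf * \<bar>A t - Linf\<^sup>2 / (4 * pi)\<bar>)" for t
  have "exp_decay h" unfolding h_def
    by (intro exp_decay_add exp_decay_cmult e center_limit A_limit) (use B0 Rinf_pos in auto)
  moreover have "norm (A t *\<^sub>R ((1 / A t) *\<^sub>R integral (enclosed_domain t) (\<lambda>x. x) - flow_center F t)) \<le> h t" if "t \<ge> s" for t
  proof -
    have t: "t \<ge> 0" using that e by simp
    have R: "pi * Rinf\<^sup>2 = Linf\<^sup>2 / (4 * pi)" by (simp add: Rinf_def power2_eq_square field_simps)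
    let ?I = "integral (enclosed_domain t) (\<lambda>x. x)"
    let ?J = "?I - (pi * Rinf\<^sup>2) *\<^sub>R cinf" and ?M = "A t *\<^sub>R (flow_center F t - cinf)"
      and ?N = "(A t - Linf\<^sup>2 / (4 * pi)) *\<^sub>R cinf"
    have split: "A t *\<^sub>R ((1 / A t) *\<^sub>R ?I - flow_center F t) = ?J - (?M + ?N)"
      unfolding R using A_pos[OF t] by (simp add: algebra_simps)
    have "norm (A t *\<^sub>R ((1 / A t) *\<^sub>R ?I - flow_center F t)) \<le> norm ?J + (norm ?M + norm ?N)"
      unfolding split using norm_triangle_ineq4[of ?J "?M + ?N"] norm_triangle_ineq[of ?M ?N] by linarith
    also have "\<dots> \<le> h t" unfolding h_def
    proof (intro add_mono)
      show "norm (?I - (pi * Rinf\<^sup>2) *\<^sub>R cinf) \<le> (norm cinf + 2 * Rinf) * (4 * pi * Rinf) * e t"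
        using m[OF that] by (simp only: mult.assoc)
      show "norm ?M \<le> B * norm (flow_center F t - cinf)"
        using A_pos[OF t] by (simp add: mult_right_mono[OF B[OF t]])
    qed (simp add: mult.commute)
    finally show ?thesis .
  qed
  ultimately show ?thesis by (rule exp_decay_eventually)
qed

end

section \<open>Convergence of the flow\<close>

theorem theorem4p3:
  fixes F :: "real \<Rightarrow> real \<Rightarrow> complex" and r \<sigma> :: "real \<Rightarrow> real"
  assumes "global_solution F"
    and "rotation_number (flow_length F 0) (flow_curve F 0) = 1"
    and "flow_area F 0 > 0"
    and "\<And>t. t \<ge> 0 \<Longrightarrow> r t \<ge> 0"
    and "\<And>t. t \<ge> 0 \<Longrightarrow>
           flow_coeff F 1 t =
             complex_of_real (sqrt (flow_length F t) * r t) *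
             exp (\<i> * complex_of_real (2 * pi * \<sigma> t / flow_length F t))"
  shows "\<exists>c_inf :: complex.
     (\<exists>C>0. \<exists>\<gamma>>0. \<forall>t\<ge>0. norm (flow_center F t - c_inf) \<le> C * exp (- \<gamma> * t)) \<and>
     (\<exists>C>0. \<exists>\<gamma>>0. \<forall>t\<ge>0. \<bar>r t - limit_length F / (2 * pi)\<bar> \<le> C * exp (- \<gamma> * t)) \<and>
     (\<exists>\<sigma>_inf :: real. \<exists>C>0. \<exists>\<gamma>>0. \<forall>t\<ge>0.
        quotient_dist (flow_length F t) (\<sigma> t) \<sigma>_inf \<le> C * exp (- \<gamma> * t)) \<and>
     (\<forall>k :: nat. \<exists>C>0. \<exists>\<gamma>>0. \<forall>t\<ge>0.
        Ck_norm k (\<lambda>\<theta>. normalized_curve F \<sigma> t \<theta> -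
                    (c_inf + (limit_length F / (2 * pi)) *\<^sub>R
                       Complex (cos (2 * pi * \<theta>)) (sin (2 * pi * \<theta>))))
          \<le> C * exp (- \<gamma> * t)) \<and>
     (\<exists>\<Omega> :: real \<Rightarrow> complex set.
        (\<forall>\<^sub>F t in at_top. bounded_domain (\<Omega> t) \<and> frontier (\<Omega> t) = range (normalized_curve F \<sigma> t)) \<and>
        (\<exists>T\<ge>0. \<forall>t\<ge>T. strictly_convex (\<Omega> t)) \<and>
        (\<exists>C>0. \<exists>\<gamma>>0. \<forall>\<^sub>F t in at_top.
           hausdorff_dist (closure (\<Omega> t)) (cball c_inf (limit_length F / (2 * pi)))
             \<le> C * exp (- \<gamma> * t)) \<and>
        (\<exists>C>0. \<exists>\<gamma>>0. \<forall>\<^sub>F t in at_top.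
           norm (flow_area F t *\<^sub>R
                  ((1 / flow_area F t) *\<^sub>R integral (\<Omega> t) (\<lambda>x. x) - flow_center F t))
             \<le> C * exp (- \<gamma> * t)))"
proof -
  interpret smooth_flow F by unfold_locales (rule assms(1))
  interpret fourier_flow F r \<sigma>
  proof unfold_locales
    show "arc_integral (K 0) 0 = 2 * pi"
      using assms(2) rotation_number_eq[of 0] by (simp add: field_simps)
  qed (use assms in auto)
  have lim: "limit_length F / (2 * pi) = Rinf" by (simp add: Rinf_def Linf_def)
  obtain e s where e: "exp_decay e" "s \<ge> 0"
    and dom: "\<And>t. t \<ge> s \<Longrightarrow> bounded_domain (enclosed_domain t)"
      "\<And>t. t \<ge> s \<Longrightarrow> frontier (enclosed_domain t) = range (normalized_curve F \<sigma> t)"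
      "\<And>t. t \<ge> s \<Longrightarrow> strictly_convex (enclosed_domain t)"
      "\<And>t. t \<ge> s \<Longrightarrow> hausdorff_dist (closure (enclosed_domain t)) (cball cinf Rinf) \<le> e t"
    using enclosed_domain_properties by blast
  have Ck: "exp_decay (\<lambda>t. Ck_norm k (\<lambda>\<theta>. normalized_curve F \<sigma> t \<theta> -
         (cinf + Rinf *\<^sub>R Complex (cos (2 * pi * \<theta>)) (sin (2 * pi * \<theta>)))))" for k
    using Ck_norm_exp_decay[of k] by (simp add: gap_0[abs_def] circ_Complex)
  have ev: "\<forall>\<^sub>F t in at_top. bounded_domain (enclosed_domain t) \<and> frontier (enclosed_domain t) = range (normalized_curve F \<sigma> t)"
    using eventually_ge_at_top[of s] by (rule eventually_mono) (simp add: dom)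
  note hd = exp_decay_eventually[OF e(1) dom(4)]
  have cv: "\<exists>T\<ge>0. \<forall>t\<ge>T. strictly_convex (enclosed_domain t)" using dom(3) e(2) by blast
  have rl: "\<exists>C>0. \<exists>\<gamma>>0. \<forall>t\<ge>0. \<bar>r t - Rinf\<bar> \<le> C * exp (- \<gamma> * t)"
    using r_limit by (simp only: exp_decay_def Rinf_def)
  have sl: "\<exists>\<sigma>\<^sub>0. \<exists>C>0. \<exists>\<gamma>>0. \<forall>t\<ge>0. quotient_dist (L t) (\<sigma> t) \<sigma>\<^sub>0 \<le> C * exp (- \<gamma> * t)"
    using \<sigma>_limit by (simp only: exp_decay_def)
  show ?thesis
    unfolding lim
  proof (rule exI[of _ cinf], intro conjI)
    show "\<exists>C>0. \<exists>\<gamma>>0. \<forall>t\<ge>0. norm (flow_center F t - cinf) \<le> C * exp (- \<gamma> * t)"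
      using center_limit by (simp only: exp_decay_def)
    show "\<forall>k. \<exists>C>0. \<exists>\<gamma>>0. \<forall>t\<ge>0.
        Ck_norm k (\<lambda>\<theta>. normalized_curve F \<sigma> t \<theta> -
          (cinf + Rinf *\<^sub>R Complex (cos (2 * pi * \<theta>)) (sin (2 * pi * \<theta>)))) \<le> C * exp (- \<gamma> * t)"
      using Ck[unfolded exp_decay_def] by (rule allI)
  qed (rule rl sl | (rule exI[of _ enclosed_domain], intro conjI; rule ev cv hd moment_limit))+
qed

end
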